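(* Let $n\ge0$. The vectors $$e_{a_1}\cdots e_{a_s}\,g^+_{b_1}\cdots g^+_{b_k}\,w_{-n},\qquad s,k\ge0,\quad 0\le b_1<\dots<b_k\le n-1,\quad 0\le a_1\le\dots\le a_s\le n-k-s,$$ form a basis of the Weyl module $W_{-n}$ for $\mathfrak{osp}(1,2)\otimes\mathbb{C}[t]$.
   Context: Everything is over $\mathbb{C}$. $\mathfrak{osp}(1,2)$ is the Lie superalgebra with even part $\mathfrak{sl}_2$ (standard basis $e,h,f$) and odd part with basis $g^+,g^-$; the nontrivial brackets are $[e,f]=h$, $[h,e]=2e$, $[h,f]=-2f$, $[h,g^\pm]=\pm g^\pm$, $[g^+,g^-]_+=h$, $[g^+,g^+]_+=2e$, $[g^-,g^-]_+=-2f$, $[f,g^+]=-g^-$, $[e,g^-]=-g^+$. Put $\mathfrak n^-=\mathrm{span}(f,g^-)$, $\mathfrak h=\mathbb{C}h$, and $y_i=y\otimes t^i$ for $y\in\mathfrak{osp}(1,2)$. The Weyl module $W_{-n}$ is the cyclic $\mathfrak{osp}(1,2)\otimes\mathbb{C}[t]$-module with generator $w_{-n}$ and defining relations $(\mathfrak n^-\oplus\mathfrak h)\otimes t\mathbb{C}[t].w_{-n}=0$, $(\mathfrak n^-\otimes 1).w_{-n}=0$, $h_0w_{-n}=-nw_{-n}$, $e_0^{n+1}w_{-n}=0$. (When $s=0$ or $k=0$ the corresponding condition on the indices is empty.) *)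

theory Defs
  imports "HOL-Library.Poly_Mapping" "Jordan_Normal_Form.VS_Connect"
begin

section \<open>The Lie superalgebra \<open>osp(1,2)\<close>\<close>

datatype osp = osp_e | osp_h | osp_f | osp_gp | osp_gm

fun osp_odd :: "osp \<Rightarrow> bool" where
  "osp_odd osp_gp = True"
| "osp_odd osp_gm = True"
| "osp_odd _ = False"

text \<open>The bracket of two basis vectors, expanded in the basis. For two odd arguments this is the
  (symmetric) bracket \<open>[_, _]\<^sub>+\<close>.\<close>

fun osp_bracket :: "osp \<Rightarrow> osp \<Rightarrow> (osp \<Rightarrow>\<^sub>0 complex)" where
  "osp_bracket osp_e osp_f = Poly_Mapping.single osp_h 1"
| "osp_bracket osp_f osp_e = Poly_Mapping.single osp_h (- 1)"
| "osp_bracket osp_h osp_e = Poly_Mapping.single osp_e 2"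
| "osp_bracket osp_e osp_h = Poly_Mapping.single osp_e (- 2)"
| "osp_bracket osp_h osp_f = Poly_Mapping.single osp_f (- 2)"
| "osp_bracket osp_f osp_h = Poly_Mapping.single osp_f 2"
| "osp_bracket osp_h osp_gp = Poly_Mapping.single osp_gp 1"
| "osp_bracket osp_gp osp_h = Poly_Mapping.single osp_gp (- 1)"
| "osp_bracket osp_h osp_gm = Poly_Mapping.single osp_gm (- 1)"
| "osp_bracket osp_gm osp_h = Poly_Mapping.single osp_gm 1"
| "osp_bracket osp_gp osp_gm = Poly_Mapping.single osp_h 1"
| "osp_bracket osp_gm osp_gp = Poly_Mapping.single osp_h 1"
| "osp_bracket osp_gp osp_gp = Poly_Mapping.single osp_e 2"
| "osp_bracket osp_gm osp_gm = Poly_Mapping.single osp_f (- 2)"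
| "osp_bracket osp_f osp_gp = Poly_Mapping.single osp_gm (- 1)"
| "osp_bracket osp_gp osp_f = Poly_Mapping.single osp_gm 1"
| "osp_bracket osp_e osp_gm = Poly_Mapping.single osp_gp (- 1)"
| "osp_bracket osp_gm osp_e = Poly_Mapping.single osp_gp 1"
| "osp_bracket _ _ = 0"

section \<open>The universal enveloping algebra of \<open>osp(1,2) \<otimes> \<complex>[t]\<close>\<close>

text \<open>Words in the letters \<open>(y, i)\<close>, standing for the basis vectors \<open>y \<otimes> t\<^sup>i\<close> of the current
  superalgebra. With concatenation as addition of words, the convolution product of
  \<^theory>\<open>HOL-Library.Poly_Mapping\<close> makes \<open>word \<Rightarrow>\<^sub>0 complex\<close> the tensor algebra.\<close>

datatype word = Word (letters: "(osp \<times> nat) list")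

instantiation word :: monoid_add
begin
definition zero_word :: word where "0 = Word []"
definition plus_word :: "word \<Rightarrow> word \<Rightarrow> word" where "v + w = Word (letters v @ letters w)"
instance
  by standard (simp_all add: zero_word_def plus_word_def)
end

type_synonym tens = "word \<Rightarrow>\<^sub>0 complex"

definition tens_scalar :: "complex \<Rightarrow> tens" where
  "tens_scalar c = Poly_Mapping.single 0 c"

definition tens_gen :: "osp \<Rightarrow> nat \<Rightarrow> tens" where
  "tens_gen y i = Poly_Mapping.single (Word [(y, i)]) 1"

definition tens_lin :: "(osp \<Rightarrow>\<^sub>0 complex) \<Rightarrow> nat \<Rightarrow> tens" where
  "tens_lin v i = (\<Sum>y\<in>Poly_Mapping.keys v. tens_scalar (Poly_Mapping.lookup v y) * tens_gen y i)"

inductive_set two_sided_ideal :: "'a::ring_1 set \<Rightarrow> 'a set" for R where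
  zero: "0 \<in> two_sided_ideal R"
| base: "r \<in> R \<Longrightarrow> r \<in> two_sided_ideal R"
| add: "x \<in> two_sided_ideal R \<Longrightarrow> y \<in> two_sided_ideal R \<Longrightarrow> x + y \<in> two_sided_ideal R"
| lmult: "x \<in> two_sided_ideal R \<Longrightarrow> a * x \<in> two_sided_ideal R"
| rmult: "x \<in> two_sided_ideal R \<Longrightarrow> x * a \<in> two_sided_ideal R"

inductive_set left_ideal :: "'a::ring_1 set \<Rightarrow> 'a set" for R where
  zero: "0 \<in> left_ideal R"
| base: "r \<in> R \<Longrightarrow> r \<in> left_ideal R"
| add: "x \<in> left_ideal R \<Longrightarrow> y \<in> left_ideal R \<Longrightarrow> x + y \<in> left_ideal R"
| lmult: "x \<in> left_ideal R \<Longrightarrow> a * x \<in> left_ideal R"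

lemma two_sided_ideal_uminus: "x \<in> two_sided_ideal R \<Longrightarrow> - x \<in> two_sided_ideal R"
  using two_sided_ideal.lmult[of x R "- 1"] by simp

lemma left_ideal_uminus: "x \<in> left_ideal R \<Longrightarrow> - x \<in> left_ideal R"
  using left_ideal.lmult[of x R "- 1"] by simp

text \<open>The defining relations: the supercommutator of \<open>x \<otimes> t\<^sup>i\<close> and \<open>y \<otimes> t\<^sup>j\<close> is
  \<open>[x, y] \<otimes> t\<^sup>i\<^sup>+\<^sup>j\<close>.\<close>

definition super_sign :: "osp \<Rightarrow> osp \<Rightarrow> 'a::ring_1" where
  "super_sign x y = (if osp_odd x \<and> osp_odd y then - 1 else 1)"

definition env_relations :: "tens set" where
  "env_relations =
    {tens_gen x i * tens_gen y j - super_sign x y * tens_gen y j * tens_gen x i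
       - tens_lin (osp_bracket x y) (i + j) | x y i j. True}"

definition env_rel :: "tens \<Rightarrow> tens \<Rightarrow> bool" where
  "env_rel p q \<longleftrightarrow> p - q \<in> two_sided_ideal env_relations"

lemma env_rel_refl: "env_rel p p"
  by (simp add: env_rel_def two_sided_ideal.zero)

lemma equivp_env_rel: "equivp env_rel"
proof (rule equivpI)
  show "reflp env_rel"
    by (auto intro: reflpI env_rel_refl)
  show "symp env_rel"
  proof (rule sympI)
    fix p q assume "env_rel p q"
    then show "env_rel q p"
      using two_sided_ideal_uminus[of "p - q"] by (simp add: env_rel_def)
  qed
  show "transp env_rel"
  proof (rule transpI)
    fix p q r assume "env_rel p q" "env_rel q r"
    then show "env_rel p r"
      using two_sided_ideal.add[of "p - q" _ "q - r"] by (simp add: env_rel_def)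
  qed
qed

text \<open>The relations have no constant term, so the ideal is proper.\<close>

lemma lookup_tens_mult_0:
  "Poly_Mapping.lookup (p * q :: tens) 0 = Poly_Mapping.lookup p 0 * Poly_Mapping.lookup q 0"
proof -
  let ?p = "Poly_Mapping.lookup p" and ?q = "Poly_Mapping.lookup q"
  have split: "0 = l + r \<longleftrightarrow> r = 0 \<and> l = 0" for l r :: word
    by (cases l; cases r) (auto simp: zero_word_def plus_word_def)
  have inner: "Sum_any (\<lambda>r. ?q r when 0 = l + r) = (?q 0 when l = 0)" for l
    by (cases "l = 0") (simp_all only: split simp_thms Sum_any_when_equal when_simps Sum_any.neutral)
  have "Poly_Mapping.lookup (p * q) 0 = Sum_any (\<lambda>l. ?p l * (?q 0 when l = 0))"
    by (simp only: lookup_mult inner)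
  also have "\<dots> = Sum_any (\<lambda>l. ?p l * ?q 0 when l = 0)"
    by (simp only: mult_when)
  also have "\<dots> = ?p 0 * ?q 0"
    by (simp only: Sum_any_when_equal)
  finally show ?thesis .
qed

lemma lookup_two_sided_ideal_0:
  assumes "p \<in> two_sided_ideal env_relations"
  shows "Poly_Mapping.lookup p 0 = 0"
  using assms
proof induction
  case (base r)
  have "Poly_Mapping.lookup (tens_gen y i) 0 = 0" for y i
    by (simp add: tens_gen_def lookup_single zero_word_def when_def)
  with base show ?case
    by (auto simp: env_relations_def tens_lin_def lookup_minus lookup_sum lookup_tens_mult_0)
qed (simp_all add: lookup_add lookup_tens_mult_0)

quotient_type uosp = tens / env_rel
  by (rule equivp_env_rel)

instantiation uosp :: ring_1
begin

lift_definition zero_uosp :: uosp is 0 .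
lift_definition one_uosp :: uosp is 1 .
lift_definition plus_uosp :: "uosp \<Rightarrow> uosp \<Rightarrow> uosp" is "(+)"
proof -
  fix p p' q q' :: tens
  assume "env_rel p p'" "env_rel q q'"
  then have "(p - p') + (q - q') \<in> two_sided_ideal env_relations"
    unfolding env_rel_def by (rule two_sided_ideal.add)
  then show "env_rel (p + q) (p' + q')"
    by (simp add: env_rel_def add_diff_add)
qed
lift_definition uminus_uosp :: "uosp \<Rightarrow> uosp" is uminus
proof -
  fix p p' :: tens
  assume "env_rel p p'"
  then have "- (p - p') \<in> two_sided_ideal env_relations"
    unfolding env_rel_def by (rule two_sided_ideal_uminus)
  then show "env_rel (- p) (- p')"
    by (simp add: env_rel_def)
qed
lift_definition minus_uosp :: "uosp \<Rightarrow> uosp \<Rightarrow> uosp" is "(-)"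
proof -
  fix p p' q q' :: tens
  assume "env_rel p p'" "env_rel q q'"
  then have "(p - p') + - (q - q') \<in> two_sided_ideal env_relations"
    unfolding env_rel_def by (intro two_sided_ideal.add two_sided_ideal_uminus)
  then show "env_rel (p - q) (p' - q')"
    by (simp add: env_rel_def algebra_simps)
qed
lift_definition times_uosp :: "uosp \<Rightarrow> uosp \<Rightarrow> uosp" is "(*)"
proof -
  fix p p' q q' :: tens
  assume "env_rel p p'" "env_rel q q'"
  moreover have "p * q - p' * q' = (p - p') * q + p' * (q - q')"
    by (simp add: algebra_simps)
  ultimately show "env_rel (p * q) (p' * q')"
    unfolding env_rel_def
    by (simp add: two_sided_ideal.add two_sided_ideal.lmult two_sided_ideal.rmult)
qed

instance
proof
  fix a b c :: uosp
  show "a + b + c = a + (b + c)" by transfer (simp add: env_rel_refl algebra_simps)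
  show "a + b = b + a" by transfer (simp add: env_rel_refl algebra_simps)
  show "0 + a = a" by transfer (simp add: env_rel_refl)
  show "- a + a = 0" by transfer (simp add: env_rel_refl)
  show "a - b = a + - b" by transfer (simp add: env_rel_refl)
  show "a * b * c = a * (b * c)" by transfer (simp add: env_rel_refl algebra_simps)
  show "(a + b) * c = a * c + b * c" by transfer (simp add: env_rel_refl algebra_simps)
  show "a * (b + c) = a * b + a * c" by transfer (simp add: env_rel_refl algebra_simps)
  show "1 * a = a" by transfer (simp add: env_rel_refl)
  show "a * 1 = a" by transfer (simp add: env_rel_refl)
  show "(0::uosp) \<noteq> 1"
  proof transfer
    show "\<not> env_rel 0 1"
      using lookup_two_sided_ideal_0[of "0 - 1"] by (auto simp: env_rel_def)
  qed
qed

end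

lift_definition uosp_scalar :: "complex \<Rightarrow> uosp" is tens_scalar .

text \<open>The element \<open>y\<^sub>i = y \<otimes> t\<^sup>i\<close>.\<close>

lift_definition cur :: "osp \<Rightarrow> nat \<Rightarrow> uosp" is tens_gen .

lift_definition cur_lin :: "(osp \<Rightarrow>\<^sub>0 complex) \<Rightarrow> nat \<Rightarrow> uosp" is tens_lin .

lemma super_commutator:
  "cur x i * cur y j - super_sign x y * cur y j * cur x i = cur_lin (osp_bracket x y) (i + j)"
proof -
  have rel: "env_rel (tens_gen x i * tens_gen y j - super_sign x y * tens_gen y j * tens_gen x i)
      (tens_lin (osp_bracket x y) (i + j))"
    unfolding env_rel_def by (rule two_sided_ideal.base) (auto simp: env_relations_def)
  show ?thesis
  proof (cases "osp_odd x \<and> osp_odd y")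
    case True
    then have sign: "super_sign x y = (- 1 :: 'a::ring_1)"
      by (simp add: super_sign_def)
    show ?thesis
      using rel unfolding sign by (transfer fixing: x y i j)
  next
    case False
    then have sign: "super_sign x y = (1 :: 'a::ring_1)"
      by (simp only: super_sign_def if_False)
    show ?thesis
      using rel unfolding sign by (transfer fixing: x y i j)
  qed
qed

lemma uosp_scalar_add: "uosp_scalar (c + d) = uosp_scalar c + uosp_scalar d"
  by transfer (simp add: tens_scalar_def single_add env_rel_refl)

lemma uosp_scalar_mult: "uosp_scalar (c * d) = uosp_scalar c * uosp_scalar d"
  by transfer (simp add: tens_scalar_def mult_single env_rel_refl)

lemma uosp_scalar_1: "uosp_scalar 1 = 1"
  by transfer (simp add: tens_scalar_def env_rel_refl)

section \<open>The Weyl modules\<close>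

text \<open>\<open>W\<^sub>-\<^sub>n\<close> is the quotient of the enveloping algebra by the left ideal generated by the elements
  that are required to annihilate the generator. Its elements are the cosets of this left ideal,
  and the generator is the coset of \<open>1\<close>.\<close>

definition weyl_relations :: "nat \<Rightarrow> uosp set" where
  "weyl_relations n =
     {cur y i | y i. y \<in> {osp_f, osp_gm, osp_h} \<and> i \<ge> 1}
   \<union> {cur osp_f 0, cur osp_gm 0}
   \<union> {cur osp_h 0 + of_nat n}
   \<union> {cur osp_e 0 ^ (n + 1)}"

definition weyl_coset :: "nat \<Rightarrow> uosp \<Rightarrow> uosp set" where
  "weyl_coset n u = {u + j | j. j \<in> left_ideal (weyl_relations n)}"

definition weyl_act :: "nat \<Rightarrow> uosp \<Rightarrow> uosp set \<Rightarrow> uosp set" where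
  "weyl_act n u X = (\<Union>x\<in>X. weyl_coset n (u * x))"

definition weyl_gen :: "nat \<Rightarrow> uosp set" where
  "weyl_gen n = weyl_coset n 1"

definition weyl_module :: "nat \<Rightarrow> (complex, uosp set) module" where
  "weyl_module n =
     \<lparr>carrier = range (weyl_coset n), mult = undefined, one = undefined,
      zero = weyl_coset n 0, add = (\<lambda>X Y. {x + y | x y. x \<in> X \<and> y \<in> Y}),
      smult = (\<lambda>c. weyl_act n (uosp_scalar c))\<rparr>"

lemma weyl_coset_eq_iff:
  "weyl_coset n u = weyl_coset n v \<longleftrightarrow> u - v \<in> left_ideal (weyl_relations n)"
proof
  assume "weyl_coset n u = weyl_coset n v"
  moreover have "u \<in> weyl_coset n u"
    unfolding weyl_coset_def using left_ideal.zero by force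
  ultimately show "u - v \<in> left_ideal (weyl_relations n)"
    by (auto simp: weyl_coset_def)
next
  assume uv: "u - v \<in> left_ideal (weyl_relations n)"
  have "u + j \<in> weyl_coset n v" "v + j \<in> weyl_coset n u"
    if "j \<in> left_ideal (weyl_relations n)" for j
  proof -
    have "(u - v) + j \<in> left_ideal (weyl_relations n)" "- (u - v) + j \<in> left_ideal (weyl_relations n)"
      using uv that by (blast intro: left_ideal.add left_ideal_uminus)+
    moreover have "u + j = v + ((u - v) + j)" "v + j = u + (- (u - v) + j)"
      by simp_all
    ultimately show "u + j \<in> weyl_coset n v" "v + j \<in> weyl_coset n u"
      unfolding weyl_coset_def by blast+
  qed
  then show "weyl_coset n u = weyl_coset n v"
    unfolding weyl_coset_def by blast
qed

lemma weyl_act_coset: "weyl_act n u (weyl_coset n v) = weyl_coset n (u * v)"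
proof -
  have "weyl_coset n (u * x) = weyl_coset n (u * v)" if "x \<in> weyl_coset n v" for x
    using that unfolding weyl_coset_eq_iff
    by (auto simp: weyl_coset_def algebra_simps intro: left_ideal.lmult)
  moreover have "v \<in> weyl_coset n v"
    unfolding weyl_coset_def using left_ideal.zero by force
  ultimately show ?thesis
    unfolding weyl_act_def by blast
qed

lemma weyl_coset_add:
  "{x + y | x y. x \<in> weyl_coset n u \<and> y \<in> weyl_coset n v} = weyl_coset n (u + v)" (is "?L = ?R")
proof
  show "?L \<subseteq> ?R"
    unfolding weyl_coset_def by (force intro: left_ideal.add simp: algebra_simps)
  show "?R \<subseteq> ?L"
  proof
    fix z assume "z \<in> ?R"
    then obtain j where j: "j \<in> left_ideal (weyl_relations n)" and z: "z = (u + 0) + (v + j)"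
      by (auto simp: weyl_coset_def add.assoc)
    have "u + 0 \<in> weyl_coset n u" "v + j \<in> weyl_coset n v"
      unfolding weyl_coset_def using j left_ideal.zero by blast+
    with z show "z \<in> ?L"
      by blast
  qed
qed

lemma weyl_gen_relations: "r \<in> weyl_relations n \<Longrightarrow> weyl_act n r (weyl_gen n) = weyl_coset n 0"
  by (simp add: weyl_gen_def weyl_act_coset weyl_coset_eq_iff left_ideal.base)

lemma vectorspace_weyl_module: "vectorspace (class_ring :: complex ring) (weyl_module n)"
proof (rule vectorspace.intro)
  have carr: "carrier (weyl_module n) = range (weyl_coset n)"
    and zero: "\<zero>\<^bsub>weyl_module n\<^esub> = weyl_coset n 0"
    and add: "\<And>u v. weyl_coset n u \<oplus>\<^bsub>weyl_module n\<^esub> weyl_coset n v = weyl_coset n (u + v)"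
    and smult: "\<And>c u. c \<odot>\<^bsub>weyl_module n\<^esub> weyl_coset n u = weyl_coset n (uosp_scalar c * u)"
    by (simp_all add: weyl_module_def weyl_coset_add weyl_act_coset)
  show "field (class_ring :: complex ring)"
    by (rule class_field)
  have "abelian_group (weyl_module n)"
  proof (rule abelian_groupI)
    fix x assume "x \<in> carrier (weyl_module n)"
    then obtain u where "x = weyl_coset n u"
      by (auto simp: carr)
    then show "\<exists>y\<in>carrier (weyl_module n). y \<oplus>\<^bsub>weyl_module n\<^esub> x = \<zero>\<^bsub>weyl_module n\<^esub>"
      by (intro bexI[of _ "weyl_coset n (- u)"]) (auto simp: carr zero add)
  qed (auto simp: carr zero add algebra_simps)
  then show "module (class_ring :: complex ring) (weyl_module n)"
    by (intro moduleI class_cring.is_cring)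
      (auto simp: carr add smult uosp_scalar_add uosp_scalar_mult uosp_scalar_1 algebra_simps)
qed

section \<open>The vectors of the basis\<close>

text \<open>\<open>e\<^sub>a\<^sub>1 \<dots> e\<^sub>a\<^sub>s g\<^sup>+\<^sub>b\<^sub>1 \<dots> g\<^sup>+\<^sub>b\<^sub>k w\<^sub>-\<^sub>n\<close> for \<open>as = [a\<^sub>1, \<dots>, a\<^sub>s]\<close> and \<open>bs = [b\<^sub>1, \<dots>, b\<^sub>k]\<close>.\<close>

definition weyl_vector :: "nat \<Rightarrow> nat list \<times> nat list \<Rightarrow> uosp set" where
  "weyl_vector n = (\<lambda>(as, bs).
     foldr (\<lambda>a. weyl_act n (cur osp_e a)) as
       (foldr (\<lambda>b. weyl_act n (cur osp_gp b)) bs (weyl_gen n)))"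

text \<open>The bounds are compared in the integers, since \<open>n - 1\<close> and \<open>n - k - s\<close> can be negative.\<close>

definition weyl_index :: "nat \<Rightarrow> (nat list \<times> nat list) set" where
  "weyl_index n = {(as, bs).
     sorted_wrt (<) bs \<and> (\<forall>b\<in>set bs. int b \<le> int n - 1) \<and>
     sorted_wrt (\<le>) as \<and> (\<forall>a\<in>set as. int a \<le> int n - int (length bs) - int (length as))}"

end

theory Submission
  imports Defs "HOL-Computational_Algebra.Formal_Power_Series" "HOL-Library.Complex_Order"
begin

text \<open>Spanning. Filter the module by the number of \<open>g\<^sup>+\<close>'s and then by \<open>b\<^sub>1 + \<dots> + b\<^sub>k\<close>. In the associated graded
  module the vector \<open>v = g\<^sup>+\<^sub>b\<^sub>1 \<dots> g\<^sup>+\<^sub>b\<^sub>k w\<^sub>-\<^sub>n\<close> satisfies the relations of the Weyl module of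
  \<open>sl\<^sub>2 \<otimes> \<complex>[t]\<close> for \<open>m = n - k\<close>. There, \<open>f\<^sub>1\<close> applied repeatedly to \<open>e\<^sub>0\<^sup>m\<^sup>+\<^sup>1 v = 0\<close> gives
  \<open>[u\<^sup>r] e(u)\<^sup>s v = 0\<close> for \<open>r + s > m\<close>, where \<open>e(u) = \<Sum> e\<^sub>i u\<^sup>i\<close>; the \<open>h\<^sub>c\<close> turn this into relations for products of
  shifted currents, and a combination of these expresses every monomial with largest index \<open>M > m - s\<close> through
  monomials with all indices below \<open>M\<close>.

  Independence. Act on the \<open>n\<close>-th tensor power of \<open>W\<^sub>-\<^sub>1 \<otimes> \<complex>[x]\<close>. Functionals of the form ``antisymmetrise in
  \<open>x\<^sub>1, \<dots>, x\<^sub>n\<close> and take the coefficient of \<open>x\<^sub>1\<^sup>0 \<dots> x\<^sub>n\<^sup>n\<^sup>-\<^sup>1\<close>'' vanish on multiples of power sums, so they descend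
  to the Weyl module, and a suitable family of them is triangular with respect to the claimed basis.\<close>

text \<open>Fewer g+ is lower in the first filtration, and a larger sum is lower in the second: the
  f_i and g-_i destroy a g+, and h_i with i \<ge> 1 raises one index. The exponent drops from n + 1
  to n - k + 1 because v has h_0-weight -(n - k) modulo lower terms, so that f_0 can strip off e_0
  one at a time. For spanning, the obstacle is that Garland's relations concern powers of e(u),
  which mix many monomials of one degree. Integrating a polynomial with prescribed zeros combines
  them so that a single monomial is left that involves indices from M on. For independence, h_i acts
  on the tensor power of the generator as minus the power sum of degree i. Multiples of power sums
  of positive degree must therefore be divided out, and antisymmetrisation against the exponents 0,
  ..., n - 1 vanishes on them. The odd g+ bring Koszul signs that could make contributions cancel;
  on the diagonal of the pairing all contributions turn out to have the same sign, so positivity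
  replaces an exact evaluation.\<close>

lemma poly_mapping_induct_single [case_names single add]:
  assumes "\<And>k v. P (Poly_Mapping.single k v)" and "\<And>p q. P p \<Longrightarrow> P q \<Longrightarrow> P (p + q)"
  shows "P (p :: 'a \<Rightarrow>\<^sub>0 'b::comm_monoid_add)"
proof -
  have "P (\<Sum>k\<in>A. Poly_Mapping.single k (Poly_Mapping.lookup p k))" if "finite A" for A
    using that by (induction A) (use assms(1)[of undefined 0] assms in auto)
  moreover have "p = (\<Sum>k\<in>Poly_Mapping.keys p. Poly_Mapping.single k (Poly_Mapping.lookup p k))"
    by (rule poly_mapping_eqI)
      (auto simp: lookup_sum lookup_single when_def in_keys_iff sum.delta)
  ultimately show ?thesis
    by (metis finite_keys)
qed

section \<open>Computing in the enveloping algebra\<close>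

lemma tens_scalar_comm: "tens_scalar c * p = p * tens_scalar c"
  by (induction p rule: poly_mapping_induct_single)
    (simp_all add: tens_scalar_def mult_single algebra_simps)

lemma uosp_scalar_comm: "uosp_scalar c * u = u * uosp_scalar c"
  by transfer (simp add: tens_scalar_comm env_rel_refl)

lemma uosp_scalar_left_comm: "u * (uosp_scalar c * v) = uosp_scalar c * (u * v)"
  by (metis mult.assoc uosp_scalar_comm)

lemma uosp_scalar_0 [simp]: "uosp_scalar 0 = 0"
  by transfer (simp add: tens_scalar_def env_rel_refl)

lemma uosp_scalar_uminus: "uosp_scalar (- c) = - uosp_scalar c"
  using uosp_scalar_add[of c "- c"] by (simp add: add_eq_0_iff)

lemma uosp_scalar_of_nat: "uosp_scalar (of_nat k) = of_nat k"
  by (induction k) (simp_all add: uosp_scalar_add uosp_scalar_1)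

lemma uosp_scalar_numeral: "uosp_scalar (numeral k) = numeral k"
  using uosp_scalar_of_nat[of "numeral k"] by simp

interpretation uosp: vector_space "\<lambda>c u. uosp_scalar c * u"
  by unfold_locales (simp_all add: algebra_simps uosp_scalar_add uosp_scalar_mult uosp_scalar_1)

lemma cur_lin_single: "cur_lin (Poly_Mapping.single y c) i = uosp_scalar c * cur y i"
  by transfer (cases "c = 0"; simp add: tens_lin_def env_rel_refl tens_scalar_def)

lemma cur_lin_0: "cur_lin 0 i = 0"
  by transfer (simp add: tens_lin_def env_rel_refl)

abbreviation "gE \<equiv> cur osp_e"
abbreviation "gH \<equiv> cur osp_h"
abbreviation "gF \<equiv> cur osp_f"
abbreviation "gP \<equiv> cur osp_gp"
abbreviation "gM \<equiv> cur osp_gm"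

lemma E_E: "gE i * gE j = gE j * gE i"
  using super_commutator[of osp_e i osp_e j]
  by (simp add: super_sign_def cur_lin_0)

lemma P_E: "gP i * gE j = gE j * gP i"
  using super_commutator[of osp_gp i osp_e j]
  by (simp add: super_sign_def cur_lin_0)

lemma P_P: "gP i * gP j = 2 * gE (i + j) - gP j * gP i"
  using super_commutator[of osp_gp i osp_gp j]
  by (simp add: super_sign_def cur_lin_single uosp_scalar_numeral algebra_simps)

lemma H_E: "gH i * gE j = gE j * gH i + 2 * gE (i + j)"
  using super_commutator[of osp_h i osp_e j]
  by (simp add: super_sign_def cur_lin_single uosp_scalar_numeral algebra_simps)

lemma F_E: "gF i * gE j = gE j * gF i - gH (i + j)"
  using super_commutator[of osp_f i osp_e j]
  by (simp add: super_sign_def cur_lin_single uosp_scalar_uminus uosp_scalar_1 algebra_simps)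

lemma H_P: "gH i * gP j = gP j * gH i + gP (i + j)"
  using super_commutator[of osp_h i osp_gp j]
  by (simp add: super_sign_def cur_lin_single uosp_scalar_1 algebra_simps)

lemma F_P: "gF i * gP j = gP j * gF i - gM (i + j)"
  using super_commutator[of osp_f i osp_gp j]
  by (simp add: super_sign_def cur_lin_single uosp_scalar_uminus uosp_scalar_1 algebra_simps)

lemma M_E: "gM i * gE j = gE j * gM i + gP (i + j)"
  using super_commutator[of osp_gm i osp_e j]
  by (simp add: super_sign_def cur_lin_single uosp_scalar_1 algebra_simps)

lemma M_P: "gM i * gP j = gH (i + j) - gP j * gM i"
  using super_commutator[of osp_gm i osp_gp j]
  by (simp add: super_sign_def cur_lin_single uosp_scalar_1 algebra_simps)

lemma subspace_left_ideal: "uosp.subspace (left_ideal R)"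
  by (rule uosp.subspaceI) (auto intro: left_ideal.intros)

lemma uosp_induct [case_names one add scalar cur]:
  assumes "P 1" and "\<And>u v. P u \<Longrightarrow> P v \<Longrightarrow> P (u + v)" and "\<And>c u. P u \<Longrightarrow> P (uosp_scalar c * u)"
    and "\<And>y i u. P u \<Longrightarrow> P (cur y i * u)"
  shows "P u"
proof -
  define ab where "ab p = abs_uosp p" for p
  have word: "P (ab (Poly_Mapping.single (Word ws) 1))" for ws
  proof (induction ws)
    case Nil
    have "ab (Poly_Mapping.single (Word []) 1) = 1"
      unfolding ab_def one_uosp_def by (simp flip: zero_word_def)
    with assms(1) show ?case by simp
  next
    case (Cons x ws)
    obtain y i where x: "x = (y, i)" by (cases x)
    have "Poly_Mapping.single (Word (x # ws)) 1 = tens_gen y i * Poly_Mapping.single (Word ws) 1"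
      by (simp add: tens_gen_def mult_single plus_word_def x)
    then have "ab (Poly_Mapping.single (Word (x # ws)) 1) = cur y i * ab (Poly_Mapping.single (Word ws) 1)"
      unfolding ab_def by (simp add: times_uosp.abs_eq cur_def)
    with Cons assms(4) show ?case by simp
  qed
  have "P (ab p)" for p
  proof (induction p rule: poly_mapping_induct_single)
    case (single k v)
    obtain ws where k: "k = Word ws" by (cases k)
    have "Poly_Mapping.single k v = tens_scalar v * Poly_Mapping.single (Word ws) 1"
      by (simp add: tens_scalar_def mult_single k)
    then have "ab (Poly_Mapping.single k v) = uosp_scalar v * ab (Poly_Mapping.single (Word ws) 1)"
      unfolding ab_def by (simp add: times_uosp.abs_eq uosp_scalar_def)
    with word assms(3) show ?case by simp
  next
    case (add p q)
    have "ab (p + q) = ab p + ab q"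
      unfolding ab_def by (simp add: plus_uosp.abs_eq)
    with add assms(2) show ?case by simp
  qed
  moreover have "\<exists>p. u = ab p"
    unfolding ab_def using Quotient3_abs_rep[OF Quotient3_uosp, of u] by metis
  ultimately show ?thesis by auto
qed

no_notation vec_index (infixl "$" 100)
unbundle fps_syntax

section \<open>The commutative subalgebra of the currents of \<open>e\<close>\<close>

text \<open>Turned into the type \<open>epoly\<close> below so that power series and polynomials
  over it live in commutative rings, where generating series in u can be multiplied and integrated
  freely.\<close>

inductive_set e_algebra :: "uosp set" where
  scalar: "uosp_scalar c \<in> e_algebra"
| gen: "gE i \<in> e_algebra"
| add: "u \<in> e_algebra \<Longrightarrow> v \<in> e_algebra \<Longrightarrow> u + v \<in> e_algebra"
| mult: "u \<in> e_algebra \<Longrightarrow> v \<in> e_algebra \<Longrightarrow> u * v \<in> e_algebra"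

lemma e_algebra_uminus: "u \<in> e_algebra \<Longrightarrow> - u \<in> e_algebra"
  using e_algebra.mult[OF e_algebra.scalar[of "-1"], of u]
  by (simp add: uosp_scalar_uminus uosp_scalar_1)

lemma e_algebra_gen_comm: "u \<in> e_algebra \<Longrightarrow> gE i * u = u * gE i"
proof (induction rule: e_algebra.induct)
  case (mult u v)
  then show ?case by (metis mult.assoc)
qed (auto simp: E_E uosp_scalar_comm algebra_simps)

lemma e_algebra_comm:
  assumes "u \<in> e_algebra" "v \<in> e_algebra" shows "u * v = v * u"
  using assms
proof (induction rule: e_algebra.induct)
  case (mult a b)
  then show ?case by (metis mult.assoc)
qed (auto simp: e_algebra_gen_comm uosp_scalar_comm algebra_simps)

typedef epoly = e_algebra
  morphisms ev Abs_epoly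
  using e_algebra.gen by blast

setup_lifting type_definition_epoly

instantiation epoly :: comm_ring_1
begin
lift_definition zero_epoly :: epoly is 0
  using e_algebra.scalar[of 0] by simp
lift_definition one_epoly :: epoly is 1
  using e_algebra.scalar[of 1] by (simp add: uosp_scalar_1)
lift_definition plus_epoly :: "epoly \<Rightarrow> epoly \<Rightarrow> epoly" is "(+)"
  by (rule e_algebra.add)
lift_definition uminus_epoly :: "epoly \<Rightarrow> epoly" is uminus
  by (rule e_algebra_uminus)
lift_definition minus_epoly :: "epoly \<Rightarrow> epoly \<Rightarrow> epoly" is "(-)"
  using e_algebra.add e_algebra_uminus by fastforce
lift_definition times_epoly :: "epoly \<Rightarrow> epoly \<Rightarrow> epoly" is "(*)"
  by (rule e_algebra.mult)
instance
  by standard (transfer; auto simp: algebra_simps e_algebra_comm)+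
end

lemmas ev_simps [simp] = zero_epoly.rep_eq one_epoly.rep_eq plus_epoly.rep_eq
  uminus_epoly.rep_eq minus_epoly.rep_eq times_epoly.rep_eq

lift_definition ee :: "nat \<Rightarrow> epoly" is gE by (rule e_algebra.gen)
lift_definition ec :: "complex \<Rightarrow> epoly" is uosp_scalar by (rule e_algebra.scalar)

lemmas ev_ee [simp] = ee.rep_eq
lemmas ev_ec [simp] = ec.rep_eq

lemma ec_add: "ec (a + b) = ec a + ec b"
  by transfer (rule uosp_scalar_add)
lemma ec_mult: "ec (a * b) = ec a * ec b"
  by transfer (rule uosp_scalar_mult)
lemma ec_1 [simp]: "ec 1 = 1"
  by transfer (rule uosp_scalar_1)
lemma ec_of_nat: "ec (of_nat k) = of_nat k"
  by (induction k) (simp_all add: ec_add, transfer, simp)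
lemma ec_minus_1: "ec (- 1) = - 1"
  by transfer (simp add: uosp_scalar_uminus uosp_scalar_1)
lemma ec_inverse_mult: "c \<noteq> 0 \<Longrightarrow> ec (inverse c) * (ec c * p) = p"
  by (simp flip: mult.assoc ec_mult)

lemma ev_numeral: "ev (numeral k) = numeral k"
proof -
  have "ev (of_nat j) = of_nat j" for j
    by (induction j) auto
  from this[of "numeral k"] show ?thesis by simp
qed

lemma ev_sum [simp]: "ev (sum f A) = (\<Sum>x\<in>A. ev (f x))"
  by (induction A rule: infinite_finite_induct) auto

lemma ev_prod_list: "ev (prod_list (map ee as)) = prod_list (map gE as)"
  by (induction as) auto

text \<open>When a product of \<open>s\<close> of the \<open>e\<^sub>i\<close> is read as a symmetrised monomial in \<open>s\<close> variables, this derivation is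
  multiplication by twice the power sum of degree \<open>c\<close>.\<close>

lift_definition der :: "nat \<Rightarrow> epoly \<Rightarrow> epoly" is "\<lambda>c u. gH c * u - u * gH c"
proof -
  fix c u assume "u \<in> e_algebra"
  then show "gH c * u - u * gH c \<in> e_algebra"
  proof (induction rule: e_algebra.induct)
    case (scalar a)
    then show ?case using e_algebra.scalar[of 0] by (simp add: uosp_scalar_comm)
  next
    case (gen i)
    have "uosp_scalar 2 * gE (c + i) \<in> e_algebra"
      by (intro e_algebra.intros)
    then show ?case by (simp add: H_E uosp_scalar_numeral)
  next
    case (add u v)
    then have "(gH c * u - u * gH c) + (gH c * v - v * gH c) \<in> e_algebra"
      by (intro e_algebra.intros)
    then show ?case by (simp add: algebra_simps)
  next
    case (mult u v)
    then have "(gH c * u - u * gH c) * v + u * (gH c * v - v * gH c) \<in> e_algebra"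
      by (intro e_algebra.intros)
    then show ?case by (simp add: algebra_simps)
  qed
qed

lemma der_add: "der c (p + q) = der c p + der c q"
  by transfer (simp add: algebra_simps)
lemma der_0 [simp]: "der c 0 = 0"
  by transfer simp
lemma der_1 [simp]: "der c 1 = 0"
  by transfer simp
lemma der_mult: "der c (p * q) = der c p * q + p * der c q"
  by transfer (simp add: algebra_simps)
lemma der_ee: "der c (ee i) = 2 * ee (i + c)"
  by (simp add: der.rep_eq H_E ev_numeral add.commute flip: ev_inject)
lemma der_sum: "der c (sum f A) = (\<Sum>x\<in>A. der c (f x))"
  by (induction A rule: infinite_finite_induct) (auto simp: der_add)

definition der_fps :: "nat \<Rightarrow> epoly fps \<Rightarrow> epoly fps" where
  "der_fps c F = Abs_fps (\<lambda>r. der c (F $ r))"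

lemma der_fps_nth [simp]: "der_fps c F $ r = der c (F $ r)"
  by (simp add: der_fps_def)

lemma der_fps_mult: "der_fps c (F * G) = der_fps c F * G + F * der_fps c G"
  by (rule fps_ext) (simp add: fps_mult_nth der_sum der_mult sum.distrib)

lemma der_fps_1 [simp]: "der_fps c 1 = 0"
  by (rule fps_ext) (simp add: fps_one_nth)

lemma der_fps_power: "der_fps c (F ^ s) = of_nat s * F ^ (s - 1) * der_fps c F"
proof (induction s)
  case (Suc s)
  then show ?case
    by (cases s) (simp_all add: der_fps_mult algebra_simps)
qed simp

section \<open>Generating series of the e-currents, shifted and truncated\<close>

definition Esh :: "nat \<Rightarrow> epoly fps" where
  "Esh c = Abs_fps (\<lambda>i. ee (i + c))"

text \<open>\<open>Esh c\<close> arises because \<open>der c\<close> shifts indices.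
  \<open>Ege c\<close> is that series moved back to its original positions, the tail of e(u), and
  \<open>Elt c\<close> is the complementary head.\<close>

definition Ege :: "nat \<Rightarrow> epoly fps" where
  "Ege c = Abs_fps (\<lambda>i. if c \<le> i then ee i else 0)"

definition Elt :: "nat \<Rightarrow> epoly fps" where
  "Elt c = Abs_fps (\<lambda>i. if i < c then ee i else 0)"

lemma Esh_nth [simp]: "Esh c $ i = ee (i + c)"
  by (simp add: Esh_def)
lemma Ege_nth: "Ege c $ i = (if c \<le> i then ee i else 0)"
  by (simp add: Ege_def)
lemma Elt_nth: "Elt c $ i = (if i < c then ee i else 0)"
  by (simp add: Elt_def)

lemma Ege_Esh: "Ege c = fps_X ^ c * Esh c"
  by (rule fps_ext) (auto simp: Ege_nth fps_X_power_mult_nth)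

lemma Elt_add_Ege: "Elt c + Ege c = Esh 0"
  by (rule fps_ext) (auto simp: Ege_nth Elt_nth)

lemma Ege_minus_Esh: "Ege c - Esh 0 = - Elt c"
  by (simp add: Elt_add_Ege[of c, symmetric])

lemma der_fps_Esh: "der_fps c (Esh a) = 2 * Esh (a + c)"
  by (rule fps_ext) (simp add: der_ee fps_numeral_fps_const ac_simps)

section \<open>Integration of polynomials over a commutative ring\<close>

text \<open>The series ring is only a commutative ring, so denominators enter through the complex
  scalars \<open>ec\<close>.\<close>

definition inv_Suc_const :: "nat \<Rightarrow> epoly fps" where
  "inv_Suc_const j = fps_const (ec (inverse (of_nat (Suc j))))"

lemma of_nat_Suc_inv_Suc_const: "of_nat (Suc j) * inv_Suc_const j = 1"
proof -
  have "of_nat (Suc j) * inv_Suc_const j = fps_const (ec (of_nat (Suc j) * inverse (of_nat (Suc j))))"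
    by (simp only: inv_Suc_const_def ec_mult ec_of_nat fps_const_mult[symmetric] fps_of_nat)
  then show ?thesis by (simp del: of_nat_Suc)
qed

text \<open>The formal integral of f(y) dy from 0 to b. Endpoint and coefficients are themselves
  power series in u.\<close>

definition poly_integral :: "epoly fps \<Rightarrow> epoly fps poly \<Rightarrow> epoly fps" where
  "poly_integral b f = (\<Sum>j\<le>degree f. inv_Suc_const j * coeff f j * b ^ Suc j)"

lemma poly_integral_bound: "degree f \<le> N \<Longrightarrow> poly_integral b f = (\<Sum>j\<le>N. inv_Suc_const j * coeff f j * b ^ Suc j)"
  unfolding poly_integral_def by (rule sum.mono_neutral_left) (auto simp: coeff_eq_0)

lemma poly_integral_add: "poly_integral b (f + g) = poly_integral b f + poly_integral b g"
proof -
  let ?N = "max (degree f) (degree g)"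
  have "degree (f + g) \<le> ?N" by (rule degree_add_le_max)
  then show ?thesis
    by (simp add: poly_integral_bound[of _ ?N] algebra_simps sum.distrib)
qed

lemma poly_integral_smult: "poly_integral b (Polynomial.smult a f) = a * poly_integral b f"
  using degree_smult_le[of a f]
  by (simp add: poly_integral_bound[of _ "degree f"] sum_distrib_left ac_simps)

lemma poly_integral_monom: "poly_integral b (monom a j) = inv_Suc_const j * a * b ^ Suc j"
proof -
  have "(\<Sum>i\<le>j. inv_Suc_const i * coeff (monom a j) i * b ^ Suc i) = (\<Sum>i\<le>j. if i = j then inv_Suc_const j * a * b ^ Suc j else 0)"
    by (rule sum.cong) auto
  then show ?thesis
    by (simp add: poly_integral_bound[of _ j] degree_monom_le)
qed

lemma poly_integral_0_left: "poly_integral 0 f = 0"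
  by (simp add: poly_integral_def)

lemma poly_monom_induct [case_names monom add]:
  assumes "\<And>a j. P (monom a j)" and "\<And>f g. P f \<Longrightarrow> P g \<Longrightarrow> P (f + g)"
  shows "P (f :: 'a::comm_monoid_add poly)"
proof -
  have "P (\<Sum>i\<in>A. monom (coeff f i) i)" if "finite A" for A
    using that by (induction A) (use assms(1)[of 0 0] assms in auto)
  then show ?thesis
    using poly_as_sum_of_monoms[of f] by (metis finite_atMost)
qed

lemma inv_Suc_const_binomial: "inv_Suc_const i * of_nat (j choose i) = inv_Suc_const j * of_nat (Suc j choose Suc i)"
proof -
  have "of_nat (Suc i) * of_nat (Suc j choose Suc i) = (of_nat (Suc j) * of_nat (j choose i) :: epoly fps)"
    by (simp only: of_nat_mult[symmetric] Suc_times_binomial_eq ac_simps)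
  then have "inv_Suc_const i * inv_Suc_const j * (of_nat (Suc i) * of_nat (Suc j choose Suc i))
      = inv_Suc_const i * inv_Suc_const j * (of_nat (Suc j) * of_nat (j choose i))"
    by (rule arg_cong)
  then have "(of_nat (Suc i) * inv_Suc_const i) * (inv_Suc_const j * of_nat (Suc j choose Suc i))
      = (of_nat (Suc j) * inv_Suc_const j) * (inv_Suc_const i * of_nat (j choose i))"
    by (simp only: ac_simps)
  then show ?thesis
    by (simp only: of_nat_Suc_inv_Suc_const mult_1)
qed

lemma poly_integral_linear_power: "poly_integral b ([:a, 1:] ^ j) = inv_Suc_const j * ((a + b) ^ Suc j - a ^ Suc j)"
proof -
  have "degree ([:a, 1:] ^ j) \<le> j"
    using degree_power_le[of "[:a, 1:]" j] by simp
  then have "poly_integral b ([:a, 1:] ^ j) = (\<Sum>i\<le>j. (inv_Suc_const i * of_nat (j choose i)) * a ^ (j - i) * b ^ Suc i)"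
    by (simp add: poly_integral_bound[of _ j] coeff_linear_poly_power mult.assoc)
  also have "\<dots> = inv_Suc_const j * (\<Sum>i\<le>j. of_nat (Suc j choose Suc i) * b ^ Suc i * a ^ (Suc j - Suc i))"
    unfolding inv_Suc_const_binomial sum_distrib_left by (simp add: ac_simps)
  also have "(\<Sum>i\<le>j. of_nat (Suc j choose Suc i) * b ^ Suc i * a ^ (Suc j - Suc i)) = (b + a) ^ Suc j - a ^ Suc j"
    unfolding binomial_ring[of b a "Suc j"] by (subst sum.atMost_Suc_shift) simp
  finally show ?thesis by (simp add: add.commute)
qed

text \<open>The path from 0 to a + b is cut at a, and y is replaced by a + y on the second piece. By
  linearity this reduces to powers of y, where it is the binomial theorem.\<close>

lemma poly_integral_shift: "poly_integral (a + b) g = poly_integral a g + poly_integral b (pcompose g [:a, 1:])"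
proof (induction g rule: poly_monom_induct)
  case (monom x j)
  have "pcompose ([:0, 1:] ^ j) [:a, 1:] = [:a, 1:] ^ j"
    by (induction j) (simp_all add: pcompose_1 pcompose_mult pcompose_idR pcompose_pCons)
  then have "pcompose (monom x j) [:a, 1:] = Polynomial.smult x ([:a, 1:] ^ j)"
    by (simp add: monom_altdef pcompose_smult)
  then show ?case
    by (simp add: poly_integral_monom poly_integral_smult poly_integral_linear_power algebra_simps)
qed (simp add: poly_integral_add pcompose_add)

definition linear_prod :: "'a::comm_ring_1 list \<Rightarrow> 'a poly" where
  "linear_prod ws = prod_list (map (\<lambda>w. [:w, 1:]) ws)"

lemma linear_prod_Cons: "linear_prod (w # ws) = [:w, 1:] * linear_prod ws"
  by (simp only: linear_prod_def list.map prod_list.Cons)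

lemma pcompose_linear_prod: "pcompose (linear_prod ws) [:a, 1:] = linear_prod (map ((+) a) ws)"
proof (induction ws)
  case (Cons w ws)
  have "pcompose [:w, 1:] [:a, 1:] = [:a + w, 1:]"
    by (simp add: pcompose_pCons add.commute)
  with Cons show ?case
    by (simp only: linear_prod_Cons pcompose_mult list.map)
qed (simp add: linear_prod_def pcompose_1)

lemma poly_integral_linear_prod_Nil: "poly_integral b (monom 1 j * linear_prod []) = inv_Suc_const j * b ^ Suc j"
  by (simp add: linear_prod_def poly_integral_monom)

text \<open>Splits the first factor y + w. The spare power of y keeps the shape stable, so
  inductions over the factors close with j left general.\<close>

lemma poly_integral_linear_prod_Cons:
  "poly_integral b (monom 1 j * linear_prod (w # ws)) = w * poly_integral b (monom 1 j * linear_prod ws) + poly_integral b (monom 1 (Suc j) * linear_prod ws)"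
proof -
  have "[:w, 1:] = [:w:] + monom 1 1"
    by (simp add: monom_Suc)
  then have "monom 1 j * linear_prod (w # ws) = Polynomial.smult w (monom 1 j * linear_prod ws) + monom 1 (Suc j) * linear_prod ws"
    by (simp add: linear_prod_def algebra_simps mult_monom flip: mult.assoc)
  then show ?thesis
    by (simp only: poly_integral_add poly_integral_smult)
qed

section \<open>Leading coefficients\<close>

text \<open>x may be zero: F has order at least a, with coefficient x there. This makes the
  predicate additive.\<close>

definition lowest_coeff :: "nat \<Rightarrow> 'a::comm_ring_1 \<Rightarrow> 'a fps \<Rightarrow> bool" where
  "lowest_coeff a x F \<longleftrightarrow> (\<forall>i<a. F $ i = 0) \<and> F $ a = x"

lemma lowest_coeff_mult:
  assumes "lowest_coeff a x F" "lowest_coeff b y G" shows "lowest_coeff (a + b) (x * y) (F * G)"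
proof -
  have z: "F $ i * G $ (k - i) = 0" if "k < a + b \<or> i \<noteq> a" "k \<le> a + b" "i \<le> k" for i k
    using assms that by (cases "i < a") (auto simp: lowest_coeff_def)
  have "(F * G) $ (a + b) = (\<Sum>i=0..a + b. if i = a then x * y else 0)"
    unfolding fps_mult_nth using assms by (intro sum.cong refl) (auto simp: z lowest_coeff_def)
  moreover have "(F * G) $ k = 0" if "k < a + b" for k
    unfolding fps_mult_nth using that by (intro sum.neutral) (auto simp: z)
  ultimately show ?thesis by (simp add: lowest_coeff_def)
qed

lemma lowest_coeff_add: "lowest_coeff a x F \<Longrightarrow> lowest_coeff a y G \<Longrightarrow> lowest_coeff a (x + y) (F + G)"
  by (simp add: lowest_coeff_def)

lemma lowest_coeff_weaken: "lowest_coeff a x F \<Longrightarrow> b < a \<Longrightarrow> lowest_coeff b 0 F"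
  by (simp add: lowest_coeff_def)

lemma lowest_coeff_power: "lowest_coeff a x F \<Longrightarrow> lowest_coeff (k * a) (x ^ k) (F ^ k)"
  by (induction k) (auto intro: lowest_coeff_mult, simp add: lowest_coeff_def)

lemma lowest_coeff_const: "lowest_coeff 0 x (fps_const x)"
  by (simp add: lowest_coeff_def)

text \<open>The endpoint has order M, so y and dy count M each. A factor y + \<open>Elt M\<close> -
  \<open>Elt c\<close> has its lowest term e_c in the constant part if c < M, and is just y if c =
  M. Either way it contributes e_c in degree c; only the scalar k depends on how often M
  occurs.\<close>

lemma lowest_coeff_poly_integral:
  assumes "\<forall>c\<in>set cs. c \<le> M"
  shows "\<exists>k. k \<noteq> 0 \<and> lowest_coeff (Suc j * M + sum_list cs) (ec k * ee M ^ Suc j * prod_list (map ee cs))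
    (poly_integral (Ege M) (monom 1 j * linear_prod (map (\<lambda>c. Elt M - Elt c) cs)))"
  using assms
proof (induction cs arbitrary: j)
  case Nil
  have "lowest_coeff M (ee M) (Ege M)"
    by (simp add: lowest_coeff_def Ege_nth)
  from lowest_coeff_mult[OF lowest_coeff_const lowest_coeff_power[OF this]]
  have "lowest_coeff (0 + Suc j * M) (ec (inverse (of_nat (Suc j))) * ee M ^ Suc j) (inv_Suc_const j * Ege M ^ Suc j)"
    unfolding inv_Suc_const_def .
  then show ?case
    by (intro exI[of _ "inverse (of_nat (Suc j))"])
      (simp add: poly_integral_linear_prod_Nil del: of_nat_Suc power_Suc mult_Suc)
next
  case (Cons c cs)
  then have cs: "\<forall>c\<in>set cs. c \<le> M" by simp
  from Cons.IH[OF this, of "Suc j"] obtain k' where k': "k' \<noteq> 0"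
    "lowest_coeff (Suc (Suc j) * M + sum_list cs) (ec k' * ee M ^ Suc (Suc j) * prod_list (map ee cs))
      (poly_integral (Ege M) (monom 1 (Suc j) * linear_prod (map (\<lambda>c. Elt M - Elt c) cs)))"
    by blast
  show ?case
  proof (cases "c = M")
    case True
    \<comment> \<open>Here w = 0, so everything comes from the summand with one more power of
      y.\<close>
    with k' show ?thesis
      by (intro exI[of _ k']) (simp add: poly_integral_linear_prod_Cons algebra_simps)
  next
    case False
    with Cons.prems have "c < M" by simp
    then have w: "lowest_coeff c (ee c) (Elt M - Elt c)"
      by (simp add: lowest_coeff_def Elt_nth)
    from Cons.IH[OF cs, of j] obtain k where k: "k \<noteq> 0"
      "lowest_coeff (Suc j * M + sum_list cs) (ec k * ee M ^ Suc j * prod_list (map ee cs))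
        (poly_integral (Ege M) (monom 1 j * linear_prod (map (\<lambda>c. Elt M - Elt c) cs)))"
      by blast
    \<comment> \<open>Taking y instead of w from this factor costs degree M > c, so that summand
      starts too late to matter.\<close>
    have "lowest_coeff (c + (Suc j * M + sum_list cs)) 0
      (poly_integral (Ege M) (monom 1 (Suc j) * linear_prod (map (\<lambda>c. Elt M - Elt c) cs)))"
      by (rule lowest_coeff_weaken[OF k'(2)]) (use \<open>c < M\<close> in simp)
    from lowest_coeff_add[OF lowest_coeff_mult[OF w k(2)] this] k(1) show ?thesis
      by (intro exI[of _ k]) (simp add: poly_integral_linear_prod_Cons algebra_simps)
  qed
qed

section \<open>Combinations of monomials with indices below M\<close>

inductive_set low_monomials :: "nat \<Rightarrow> nat \<Rightarrow> epoly set" for M s where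
  base: "length as = s \<Longrightarrow> \<forall>a\<in>set as. a < M \<Longrightarrow> prod_list (map ee as) \<in> low_monomials M s"
| zero: "0 \<in> low_monomials M s"
| add: "p \<in> low_monomials M s \<Longrightarrow> q \<in> low_monomials M s \<Longrightarrow> p + q \<in> low_monomials M s"
| smult: "p \<in> low_monomials M s \<Longrightarrow> ec c * p \<in> low_monomials M s"

lemma low_monomials_mult:
  assumes "p \<in> low_monomials M s" "q \<in> low_monomials M t" shows "p * q \<in> low_monomials M (s + t)"
  using assms
proof (induction rule: low_monomials.induct)
  case (base as)
  from base(3) show ?case
  proof (induction rule: low_monomials.induct)
    case (base bs)
    then show ?case
      using low_monomials.base[of "as @ bs" "s + t" M] \<open>length as = s\<close> \<open>\<forall>a\<in>set as. a < M\<close> by auto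
  next
    case (smult p c)
    then show ?case
      using low_monomials.smult by (metis mult.left_commute)
  qed (auto intro: low_monomials.intros simp: distrib_left)
qed (auto intro: low_monomials.intros simp: distrib_right mult.assoc)

lemma low_monomials_sum: "(\<And>x. x \<in> A \<Longrightarrow> f x \<in> low_monomials M s) \<Longrightarrow> sum f A \<in> low_monomials M s"
  by (induction A rule: infinite_finite_induct) (auto intro: low_monomials.intros)

definition low_series :: "nat \<Rightarrow> nat \<Rightarrow> epoly fps set" where
  "low_series M s = {F. \<forall>i. F $ i \<in> low_monomials M s}"

lemma low_series_add: "F \<in> low_series M s \<Longrightarrow> G \<in> low_series M s \<Longrightarrow> F + G \<in> low_series M s"
  by (auto simp: low_series_def intro: low_monomials.add)

lemma low_series_mult: "F \<in> low_series M s \<Longrightarrow> G \<in> low_series M t \<Longrightarrow> F * G \<in> low_series M (s + t)"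
  unfolding low_series_def by (auto simp: fps_mult_nth intro!: low_monomials_sum low_monomials_mult)

lemma low_series_const: "fps_const (ec c) \<in> low_series M 0"
  using low_monomials.smult[OF low_monomials.base[of "[]" 0 M], of c] by (auto simp: low_series_def intro: low_monomials.zero)

lemma low_series_power: "F \<in> low_series M s \<Longrightarrow> F ^ k \<in> low_series M (k * s)"
proof (induction k)
  case 0
  then show ?case using low_series_const[of 1] by simp
qed (auto intro: low_series_mult)

lemma low_series_Elt: "c \<le> M \<Longrightarrow> Elt c \<in> low_series M 1"
  using low_monomials.base[of "[_]" 1 M] by (auto simp: low_series_def Elt_nth intro: low_monomials.zero)

lemma low_series_uminus: "F \<in> low_series M s \<Longrightarrow> - F \<in> low_series M s"
  using low_monomials.smult[of _ M s "-1"] by (auto simp: low_series_def ec_minus_1)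

text \<open>Homogeneity: y, the endpoint and each w have degree one, and integration adds one
  more.\<close>

lemma low_series_poly_integral:
  assumes "Z \<in> low_series M 1" "\<forall>w\<in>set ws. w \<in> low_series M 1"
  shows "poly_integral Z (monom 1 j * linear_prod ws) \<in> low_series M (length ws + Suc j)"
  using assms
proof (induction ws arbitrary: j)
  case Nil
  then show ?case
    using low_series_mult[OF low_series_const low_series_power[of Z M 1 "Suc j"]]
    by (simp add: poly_integral_linear_prod_Nil inv_Suc_const_def)
next
  case (Cons w ws)
  then have "w * poly_integral Z (monom 1 j * linear_prod ws) \<in> low_series M (1 + (length ws + Suc j))"
    by (intro low_series_mult) auto
  moreover have "poly_integral Z (monom 1 (Suc j) * linear_prod ws) \<in> low_series M (1 + (length ws + Suc j))"
    using Cons.IH[of "Suc j"] Cons.prems by simp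
  ultimately show ?case
    by (auto simp: poly_integral_linear_prod_Cons intro!: low_series_add)
qed

section \<open>Spanning for the currents of \<open>sl\<^sub>2\<close>\<close>

text \<open>The relations of the sl_2 Weyl module, imposed modulo a subspace \<open>Y\<close> in
  place of an associated graded module. It is used with \<open>Y\<close> the Weyl ideal and v = 1,
  and then with \<open>Y\<close> the lower terms and v a product of g+.\<close>

locale sl2_weyl =
  fixes Y :: "uosp set" and v :: uosp and m :: nat
  assumes sub: "uosp.subspace Y"
    and E_Y: "u \<in> Y \<Longrightarrow> gE i * u \<in> Y"
    and H_Y: "i \<ge> 1 \<Longrightarrow> u \<in> Y \<Longrightarrow> gH i * u \<in> Y"
    and F_Y: "u \<in> Y \<Longrightarrow> gF 1 * u \<in> Y"
    and F_v: "gF 1 * v \<in> Y"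
    and H_v: "i \<ge> 1 \<Longrightarrow> gH i * v \<in> Y"
    and E_v: "gE 0 ^ Suc m * v \<in> Y"
begin

lemmas Y_0 = uosp.subspace_0[OF sub]
lemmas Y_add = uosp.subspace_add[OF sub]
lemmas Y_diff = uosp.subspace_diff[OF sub]
lemmas Y_scale = uosp.subspace_scale[OF sub]
lemmas Y_sum = uosp.subspace_sum[OF sub]

lemma e_algebra_Y: "a \<in> e_algebra \<Longrightarrow> u \<in> Y \<Longrightarrow> a * u \<in> Y"
  by (induction arbitrary: u rule: e_algebra.induct)
    (auto simp: algebra_simps intro: Y_add Y_scale E_Y)

lemma ev_Y: "u \<in> Y \<Longrightarrow> ev p * u \<in> Y"
  using e_algebra_Y ev by blast

definition I :: "epoly set" where "I = {p. ev p * v \<in> Y}"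

lemma I_0: "0 \<in> I" by (simp add: I_def Y_0)
lemma I_add: "p \<in> I \<Longrightarrow> q \<in> I \<Longrightarrow> p + q \<in> I" by (simp add: I_def algebra_simps Y_add)
lemma I_diff: "p \<in> I \<Longrightarrow> q \<in> I \<Longrightarrow> p - q \<in> I" by (simp add: I_def algebra_simps Y_diff)
lemma I_mult: "p \<in> I \<Longrightarrow> q * p \<in> I" by (simp add: I_def mult.assoc ev_Y)
lemma I_uminus: "p \<in> I \<Longrightarrow> - p \<in> I" using I_diff[OF I_0] by simp
lemma I_cancel: "of_nat (Suc k) * p \<in> I \<Longrightarrow> p \<in> I"
  using I_mult[of "of_nat (Suc k) * p" "ec (inverse (of_nat (Suc k)))"]
  by (simp only: ec_of_nat[symmetric] ec_inverse_mult of_nat_eq_0_iff nat.simps simp_thms)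

text \<open>\<open>I\<close> is the annihilator of v modulo \<open>Y\<close>. Applying
  \<open>gH c\<close> to \<open>ev p * v\<close> stays in \<open>Y\<close>, and so does
  \<open>ev p * (gH c * v)\<close>; the derivation is their difference.\<close>

lemma I_der: "c \<ge> 1 \<Longrightarrow> p \<in> I \<Longrightarrow> der c p \<in> I"
  using Y_diff[OF H_Y ev_Y[OF H_v], of c "ev p * v" c p]
  by (simp add: I_def der.rep_eq algebra_simps)

text \<open>The operator \<Sum> u^i der_(i+1) is a derivation that is linear over u and sends X =
  \<open>Esh 0\<close> to 2X', hence X^s to 2s X^(s-1) X'. Cutting the sum at i = r leaves the
  coefficients up to u^r unchanged.\<close>

lemma sum_der_power:
  "(\<Sum>i\<le>r. der (Suc i) ((Esh 0 ^ s) $ (r - i))) = (of_nat (2 * s) * (Esh 0 ^ (s - 1) * fps_deriv (Esh 0))) $ r"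
proof -
  define L where "L F = (\<Sum>i\<le>r. fps_X ^ i * der_fps (Suc i) F)" for F
  have L_nth: "L F $ k = (\<Sum>i\<le>k. der (Suc i) (F $ (k - i)))" if "k \<le> r" for F k
  proof -
    have "L F $ k = (\<Sum>i\<le>r. if i \<le> k then der (Suc i) (F $ (k - i)) else 0)"
      unfolding L_def fps_sum_nth by (intro sum.cong) (auto simp: fps_X_power_mult_nth)
    also have "\<dots> = (\<Sum>i\<le>k. der (Suc i) (F $ (k - i)))"
      using that by (intro sum.mono_neutral_cong_right) auto
    finally show ?thesis .
  qed
  have "L (Esh 0 ^ s) = of_nat s * Esh 0 ^ (s - 1) * L (Esh 0)"
    unfolding L_def der_fps_power sum_distrib_left by (simp add: ac_simps)
  moreover have "(F * L (Esh 0)) $ r = (F * (2 * fps_deriv (Esh 0))) $ r" for F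
  proof -
    have "L (Esh 0) $ k = (2 * fps_deriv (Esh 0)) $ k" if "k \<le> r" for k
    proof -
      have "(\<Sum>i\<le>k. der (Suc i) (Esh 0 $ (k - i))) = (\<Sum>i\<le>k. 2 * ee (Suc k))"
        by (intro sum.cong) (auto simp: der_ee)
      then show ?thesis
        using that by (simp add: L_nth fps_numeral_fps_const algebra_simps)
    qed
    then show ?thesis
      unfolding fps_mult_nth[of F] by (intro sum.cong refl) (metis diff_le_self)
  qed
  ultimately have "L (Esh 0 ^ s) $ r = (of_nat s * Esh 0 ^ (s - 1) * (2 * fps_deriv (Esh 0))) $ r"
    by simp
  then show ?thesis
    by (simp add: L_nth algebra_simps)
qed

text \<open>With X = \<open>Esh 0\<close>: passing \<open>gE i\<close> costs
  \<open>gH (Suc i)\<close>, which kills v modulo \<open>Y\<close> and so acts on the remaining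
  power as a derivation. By \<open>sum_der_power\<close> this adds 2s X^(s-1) X' to s(s-1) X^(s-1)
  X', and s(s-1) + 2s = (s+1)s.\<close>

lemma F_Esh_power:
  "gF 1 * (ev ((Esh 0 ^ s) $ r) * v)
    + ev ((of_nat (s * (s - 1)) * (Esh 0 ^ (s - 2) * fps_deriv (Esh 0))) $ r) * v \<in> Y"
proof (induction s arbitrary: r)
  case 0
  then show ?case
    using F_v by (cases r) (auto simp: fps_one_nth Y_0)
next
  case (Suc s)
  define D where "D = of_nat (s * (s - 1)) * (Esh 0 ^ (s - 2) * fps_deriv (Esh 0))"
  define p where "p i = (Esh 0 ^ s) $ i" for i
  have D: "of_nat (Suc s * (Suc s - 1)) * (Esh 0 ^ (Suc s - 2) * fps_deriv (Esh 0))
      = Esh 0 * D + of_nat (2 * s) * (Esh 0 ^ (s - 1) * fps_deriv (Esh 0))"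
  proof (cases s)
    case (Suc t)
    then show ?thesis
      by (cases t) (simp_all add: D_def algebra_simps)
  qed (simp add: D_def)
  have "gF 1 * (ev ((Esh 0 ^ Suc s) $ r) * v) = (\<Sum>i\<le>r. gF 1 * (gE i * (ev (p (r - i)) * v)))"
    by (simp add: fps_mult_nth sum_distrib_left sum_distrib_right p_def atLeast0AtMost mult.assoc)
  also have "\<dots> = (\<Sum>i\<le>r. gE i * (gF 1 * (ev (p (r - i)) * v)) - gH (Suc i) * (ev (p (r - i)) * v))"
    by (simp add: F_E left_diff_distrib flip: mult.assoc)
  finally have 1: "gF 1 * (ev ((Esh 0 ^ Suc s) $ r) * v) =
    (\<Sum>i\<le>r. gE i * (gF 1 * (ev (p (r - i)) * v)) - gH (Suc i) * (ev (p (r - i)) * v))" .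
  have 2: "ev ((Esh 0 * D) $ r) * v = (\<Sum>i\<le>r. gE i * (ev (D $ (r - i)) * v))"
    by (simp add: fps_mult_nth sum_distrib_right atLeast0AtMost mult.assoc)
  have 3: "ev ((of_nat (2 * s) * (Esh 0 ^ (s - 1) * fps_deriv (Esh 0))) $ r) * v
      = (\<Sum>i\<le>r. ev (der (Suc i) (p (r - i))) * v)"
    unfolding sum_der_power[symmetric] p_def by (simp add: sum_distrib_right)
  have "(\<Sum>i\<le>r. gE i * (gF 1 * (ev (p (r - i)) * v)) - gH (Suc i) * (ev (p (r - i)) * v)
      + gE i * (ev (D $ (r - i)) * v) + ev (der (Suc i) (p (r - i))) * v) \<in> Y"
  proof (rule Y_sum)
    fix i
    have "gE i * (gF 1 * (ev (p (r - i)) * v) + ev (D $ (r - i)) * v) \<in> Y"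
      by (rule E_Y) (use Suc.IH[of "r - i"] in \<open>simp add: D_def p_def\<close>)
    moreover have "ev (p (r - i)) * (gH (Suc i) * v) \<in> Y"
      by (intro ev_Y H_v) simp
    ultimately show "gE i * (gF 1 * (ev (p (r - i)) * v)) - gH (Suc i) * (ev (p (r - i)) * v)
      + gE i * (ev (D $ (r - i)) * v) + ev (der (Suc i) (p (r - i))) * v \<in> Y"
      using Y_diff by (fastforce simp: der.rep_eq algebra_simps)
  qed
  then show ?case
    unfolding D 1 fps_add_nth ev_simps distrib_right 2 3 by (simp add: sum.distrib sum_subtractf algebra_simps)
qed

text \<open>Garland's relations, by applying \<open>f\<^sub>1\<close> repeatedly to \<open>e\<^sub>0\<^sup>m\<^sup>+\<^sup>1 v\<close>.\<close>

lemma Esh_power_in_I: "r + s \<ge> Suc m \<Longrightarrow> (Esh 0 ^ s) $ r \<in> I"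
proof (induction r arbitrary: s)
  case 0
  then have "ee 0 ^ s = ee 0 ^ (s - Suc m) * ee 0 ^ Suc m"
    by (subst power_add[symmetric]) (use 0 in simp)
  moreover have "ev (ee 0 ^ k) = gE 0 ^ k" for k
    by (induction k) auto
  then have "ee 0 ^ Suc m \<in> I"
    using E_v by (simp add: I_def)
  ultimately show ?case
    by (simp add: fps_power_zeroth I_mult del: power_Suc)
next
  case (Suc r)
  show ?case
  proof (cases s)
    case 0
    then show ?thesis by (simp add: I_0)
  next
    case (Suc s')
    \<comment> \<open>One application of \<open>gF 1\<close> trades a factor for a degree: up to
      sign it turns [u^r] X^(s+1) into (s+1) [u^r] (X^s)', a nonzero multiple of [u^(r+1)]
      X^s.\<close>
    have "(Esh 0 ^ Suc s) $ r \<in> I"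
      using Suc.IH[of "Suc s"] Suc.prems by (simp del: power_Suc)
    then have "gF 1 * (ev ((Esh 0 ^ Suc s) $ r) * v) \<in> Y"
      by (auto simp: I_def intro: F_Y simp del: One_nat_def power_Suc)
    from Y_diff[OF F_Esh_power[of "Suc s" r] this]
    have "(of_nat (Suc s * (Suc s - 1)) * (Esh 0 ^ (Suc s - 2) * fps_deriv (Esh 0))) $ r \<in> I"
      by (simp only: I_def mem_Collect_eq add_diff_cancel_left')
    then have "(of_nat (Suc s * s) * (Esh 0 ^ (s - 1) * fps_deriv (Esh 0))) $ r \<in> I"
      by (simp add: Suc del: of_nat_Suc of_nat_mult)
    moreover have "fps_deriv (Esh 0 ^ s) = of_nat s * (Esh 0 ^ (s - 1) * fps_deriv (Esh 0))"
      by (simp add: fps_deriv_power' ac_simps)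
    ultimately have "(of_nat (Suc s) * fps_deriv (Esh 0 ^ s)) $ r \<in> I"
      by (simp only: of_nat_mult mult.assoc)
    then have "of_nat (Suc s) * (of_nat (Suc r) * (Esh 0 ^ s) $ Suc r) \<in> I"
      by (simp only: fps_mult_of_nat_nth fps_deriv_nth Suc_eq_plus1)
    then show ?thesis
      using I_cancel by blast
  qed
qed

text \<open>The Leibniz rule; each term is twice a product with one factor shifted. \<open>W\<close>
  carries the factors that the induction has passed.\<close>

lemma der_fps_prod_list_in_I:
  assumes "\<And>i. i < length cs \<Longrightarrow> (prod_list (map Esh (cs[i := cs ! i + c])) * W) $ R \<in> I"
  shows "(der_fps c (prod_list (map Esh cs)) * W) $ R \<in> I"
  using assms
proof (induction cs arbitrary: W)
  case Nil
  then show ?case by (simp add: I_0)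
next
  case (Cons a cs)
  have "(Esh (a + c) * prod_list (map Esh cs) * W) $ R \<in> I"
    using Cons.prems[of 0] by simp
  then have 1: "(2 * (Esh (a + c) * prod_list (map Esh cs) * W)) $ R \<in> I"
    by (simp add: fps_numeral_fps_const I_mult)
  have 2: "(der_fps c (prod_list (map Esh cs)) * (Esh a * W)) $ R \<in> I"
    using Cons.prems[of "Suc _"] by (intro Cons.IH) (simp add: ac_simps)
  show ?case
    using I_add[OF 1 2] by (simp add: der_fps_mult der_fps_Esh algebra_simps)
qed

text \<open>A new shifted factor is made from X = \<open>Esh 0\<close>: applying
  \<open>der_fps c\<close> to \<Prod>\<open>Esh bs\<close> X^(z+1) gives 2(z+1) \<open>Esh c\<close>
  \<Prod>\<open>Esh bs\<close> X^z plus products with as many shifted factors as before, which lie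
  in \<open>I\<close> by induction. The total number of factors never changes, so neither does the
  bound.\<close>

lemma Esh_prod_in_I:
  "R + length cs + z \<ge> Suc m \<Longrightarrow> (prod_list (map Esh cs) * Esh 0 ^ z) $ R \<in> I"
proof (induction "length cs" arbitrary: cs z)
  case 0
  then show ?case by (simp add: Esh_power_in_I)
next
  case (Suc l)
  then obtain c bs where cs: "cs = c # bs" by (cases cs) auto
  have IH: "(prod_list (map Esh as) * Esh 0 ^ Suc z) $ R \<in> I" if "length as = length bs" for as
    using Suc(1)[of as "Suc z"] Suc.prems Suc(2) that cs by simp
  show ?case
  proof (cases "c = 0")
    case True
    then show ?thesis using IH[of bs] by (simp add: cs ac_simps)
  next
    case False
    have "(der_fps c (prod_list (map Esh bs) * Esh 0 ^ Suc z)) $ R \<in> I"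
      using IH[of bs] False by (auto intro: I_der)
    moreover have "(der_fps c (prod_list (map Esh bs)) * Esh 0 ^ Suc z) $ R \<in> I"
      by (intro der_fps_prod_list_in_I IH) simp
    ultimately have "(prod_list (map Esh bs) * der_fps c (Esh 0 ^ Suc z)) $ R \<in> I"
      using I_diff by (fastforce simp: der_fps_mult)
    moreover have "prod_list (map Esh bs) * der_fps c (Esh 0 ^ Suc z)
        = of_nat (Suc (Suc (2 * z))) * (prod_list (map Esh cs) * Esh 0 ^ z)"
      by (simp only: der_fps_power der_fps_Esh cs) (simp add: algebra_simps)
    ultimately have "of_nat (Suc (Suc (2 * z))) * (prod_list (map Esh cs) * Esh 0 ^ z) $ R \<in> I"
      by (simp only: fps_mult_of_nat_nth)
    then show ?thesis by (rule I_cancel)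
  qed
qed

lemma Ege_prod_in_I:
  assumes "d + length cs + z \<ge> Suc m + sum_list cs"
  shows "(prod_list (map Ege cs) * Esh 0 ^ z) $ d \<in> I"
proof -
  have "prod_list (map Ege cs) = fps_X ^ sum_list cs * prod_list (map Esh cs)" for cs
    by (induction cs) (simp_all add: Ege_Esh power_add ac_simps)
  then show ?thesis
    using assms Esh_prod_in_I[of "d - sum_list cs" cs z]
    by (auto simp: fps_X_power_mult_nth mult.assoc I_0)
qed

text \<open>Expanding the product, each factor contributes either its \<open>Ege c\<close>,
  collected in \<open>ds\<close>, or a y, counted by j. Every resulting term satisfies the same
  bound, so \<open>Ege_prod_in_I\<close> covers them all.\<close>

lemma poly_integral_Ege_in_I:
  assumes "d + length ds + length cs + Suc j \<ge> Suc m + sum_list ds + sum_list cs"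
  shows "(prod_list (map Ege ds) * poly_integral (- Esh 0) (monom 1 j * linear_prod (map Ege cs))) $ d \<in> I"
  using assms
proof (induction cs arbitrary: ds j)
  case Nil
  have "prod_list (map Ege ds) * (inv_Suc_const j * (- Esh 0) ^ Suc j)
      = fps_const (ec (inverse (of_nat (Suc j))) * (- 1) ^ Suc j) * (prod_list (map Ege ds) * Esh 0 ^ Suc j)"
    unfolding inv_Suc_const_def power_minus[of "Esh 0"] fps_const_mult[symmetric] fps_const_power[symmetric]
      fps_const_neg[symmetric] fps_const_1_eq_1
    by (simp only: ac_simps)
  moreover have "(prod_list (map Ege ds) * Esh 0 ^ Suc j) $ d \<in> I"
    using Nil by (intro Ege_prod_in_I) simp
  ultimately show ?case
    by (simp only: list.map poly_integral_linear_prod_Nil fps_mult_left_const_nth I_mult)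
next
  case (Cons c cs)
  have "(prod_list (map Ege (c # ds)) * poly_integral (- Esh 0) (monom 1 j * linear_prod (map Ege cs))) $ d \<in> I"
    by (rule Cons.IH) (use Cons.prems in simp)
  moreover have "(prod_list (map Ege ds) * poly_integral (- Esh 0) (monom 1 (Suc j) * linear_prod (map Ege cs))) $ d \<in> I"
    by (rule Cons.IH) (use Cons.prems in simp)
  ultimately show ?case
    using I_add by (fastforce simp: poly_integral_linear_prod_Cons algebra_simps)
qed

text \<open>With \<open>X = e(u)\<close>, \<open>Z\<close> its truncation to indices below \<open>M\<close>, \<open>t\<^sub>c\<close> its truncation to indices below \<open>c\<close>
  and \<open>f(y) = \<Prod>(y - t\<^sub>c)\<close>, the coefficient of \<open>u\<^sup>d\<close> of \<open>\<integral>\<^sub>0\<^sup>X f\<close> lies in \<open>I\<close>, that of \<open>\<integral>\<^sub>0\<^sup>Z f\<close> only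
  involves indices below \<open>M\<close>, and that of \<open>\<integral>\<^sub>Z\<^sup>X f\<close> is a multiple of \<open>e\<^sub>M \<Prod>e\<^sub>c\<close>.\<close>

lemma straighten:
  assumes cs: "\<forall>c\<in>set cs. c \<le> M" and M: "Suc m \<le> M + Suc (length cs)"
  shows "\<exists>q\<in>low_monomials M (Suc (length cs)). ee M * prod_list (map ee cs) - q \<in> I"
proof -
  \<comment> \<open>The lowest degree of the piece from Z to X. In this degree the second hypothesis
    is exactly the bound of \<open>poly_integral_Ege_in_I\<close> for j = 0 and empty
    \<open>ds\<close>.\<close>
  define d where "d = M + sum_list cs"
  define t where "t = map (\<lambda>c. - Elt c) cs"
  have t: "map ((+) (- Esh 0)) (map Ege cs) = t"
    unfolding t_def by (auto simp: Ege_minus_Esh)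
  have "poly_integral (- Esh 0) (linear_prod (map Ege cs)) $ d \<in> I"
    using poly_integral_Ege_in_I[where ds = "[]" and cs = cs and d = d and j = 0] M by (simp add: d_def monom_0 flip: one_pCons)
  \<comment> \<open>Going from 0 to -X and back integrates to zero. Moving the origin to -X turns y
    + \<open>Ege c\<close> into y - t_c, because X - t_c = \<open>Ege c\<close>.\<close>
  moreover have "poly_integral (Esh 0) (linear_prod t) = - poly_integral (- Esh 0) (linear_prod (map Ege cs))"
    using poly_integral_shift[of "- Esh 0" "Esh 0" "linear_prod (map Ege cs)"]
    by (simp add: pcompose_linear_prod t poly_integral_0_left add_eq_0_iff del: map_map)
  ultimately have X: "poly_integral (Esh 0) (linear_prod t) $ d \<in> I"
    by (simp add: I_uminus)
  have V: "poly_integral (Esh 0) (linear_prod t) = poly_integral (Elt M) (linear_prod t) + poly_integral (Ege M) (linear_prod (map (\<lambda>c. Elt M - Elt c) cs))"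
    using poly_integral_shift[of "Elt M" "Ege M" "linear_prod t"]
    by (simp add: pcompose_linear_prod Elt_add_Ege t_def comp_def)
  have "poly_integral (Elt M) (monom 1 0 * linear_prod t) \<in> low_series M (length t + Suc 0)"
    by (rule low_series_poly_integral) (use cs in \<open>auto simp: t_def intro!: low_series_uminus low_series_Elt[unfolded One_nat_def]\<close>)
  then have Z: "poly_integral (Elt M) (linear_prod t) $ d \<in> low_monomials M (Suc (length cs))"
    by (simp add: t_def low_series_def monom_0 flip: one_pCons)
  obtain k where k: "k \<noteq> 0" and
    "poly_integral (Ege M) (linear_prod (map (\<lambda>c. Elt M - Elt c) cs)) $ d = ec k * (ee M * prod_list (map ee cs))"
    using lowest_coeff_poly_integral[OF cs, of 0] by (auto simp: lowest_coeff_def d_def mult.assoc monom_0 simp flip: one_pCons)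
  with X V have "poly_integral (Elt M) (linear_prod t) $ d + ec k * (ee M * prod_list (map ee cs)) \<in> I"
    by simp
  from I_mult[OF this, of "ec (inverse k)"]
  have "ee M * prod_list (map ee cs) - ec (- inverse k) * poly_integral (Elt M) (linear_prod t) $ d \<in> I"
    using k ec_mult[of "-1" "inverse k"] by (simp add: distrib_left ec_inverse_mult ec_minus_1 add.commute)
  with Z show ?thesis
    by (blast intro: low_monomials.smult)
qed

text \<open>Induction on a bound for the indices. If N occurs and the monomial is outside the box,
  one use of \<open>straighten\<close> removes all occurrences of N at once, since the replacing
  monomials have indices below N.\<close>

lemma box_spans:
  assumes T: "uosp.subspace T" "Y \<subseteq> T"
    and box: "\<And>as. \<forall>a\<in>set as. a + length as \<le> m \<Longrightarrow> prod_list (map gE as) * v \<in> T"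
  shows "prod_list (map gE as) * v \<in> T"
proof -
  have "\<forall>a\<in>set as. a < N \<Longrightarrow> ev (prod_list (map ee as)) * v \<in> T" for N
  proof (induction N arbitrary: as)
    case 0
    then show ?case using box[of as] by (simp add: ev_prod_list)
  next
    case (Suc N)
    consider "N + length as \<le> m" | "N \<notin> set as" | "N \<in> set as" "Suc m \<le> N + length as"
      by fastforce
    then show ?case
    proof cases
      case 1
      with Suc.prems show ?thesis
        using box[of as] by (force simp: ev_prod_list)
    next
      case 2
      with Suc.prems show ?thesis
        by (intro Suc.IH) (metis less_Suc_eq)
    next
      case 3
      define cs where "cs = remove1 N as"
      have "mset as = mset (N # cs)"
        using 3 by (simp add: cs_def)
      then have eq: "prod_list (map ee as) = ee N * prod_list (map ee cs)" and len: "length as = Suc (length cs)"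
        by (metis (no_types) list.simps(9) mset_map prod_list.Cons prod_mset_prod_list)
          (metis \<open>mset as = mset (N # cs)\<close> size_mset length_Cons)
      have "\<forall>c\<in>set cs. c \<le> N"
        using Suc.prems set_remove1_subset[of N as] unfolding cs_def by force
      then obtain q where q: "q \<in> low_monomials N (Suc (length cs))" "ee N * prod_list (map ee cs) - q \<in> I"
        using straighten[of cs N] 3 len by auto
      have "ev q * v \<in> T"
        using q(1)
      proof (induction rule: low_monomials.induct)
        case (base bs)
        then show ?case by (intro Suc.IH) auto
      qed (auto simp: distrib_right mult.assoc uosp.subspace_0[OF T(1)] uosp.subspace_add[OF T(1)] uosp.subspace_scale[OF T(1)])
      moreover have "ev (ee N * prod_list (map ee cs) - q) * v \<in> T"
        using q(2) T(2) by (auto simp: I_def)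
      ultimately show ?thesis
        using uosp.subspace_add[OF T(1)] unfolding eq by (fastforce simp: algebra_simps)
    qed
  qed
  from this[of "Suc (Max (insert 0 (set as)))"] show ?thesis
    by (simp add: ev_prod_list less_Suc_eq_le)
qed

end

section \<open>The spanning property\<close>

abbreviation e_mon :: "nat list \<Rightarrow> uosp" where "e_mon as \<equiv> prod_list (map gE as)"
abbreviation gp_mon :: "nat list \<Rightarrow> uosp" where "gp_mon bs \<equiv> prod_list (map gP bs)"

lemma e_mon_mset: "mset as = mset as' \<Longrightarrow> e_mon as = e_mon as'"
  by (metis ev_prod_list mset_map prod_mset_prod_list)

lemma P_e_mon: "gP b * (e_mon as * u) = e_mon as * (gP b * u)"
  by (induction as) (simp_all add: mult.assoc, metis P_E mult.assoc)

lemma gp_mon_E: "gp_mon bs * gE i = gE i * gp_mon bs"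
  by (induction bs) (simp_all add: mult.assoc, metis P_E mult.assoc)

lemma P_sq: "gP b * gP b = gE (b + b)"
proof -
  have "2 * (gP b * gP b) = 2 * gE (b + b)"
    using P_P[of b b] by (simp add: mult_2 algebra_simps)
  then have "uosp_scalar (1/2) * (uosp_scalar 2 * (gP b * gP b)) = uosp_scalar (1/2) * (uosp_scalar 2 * gE (b + b))"
    by (simp add: uosp_scalar_numeral)
  then show ?thesis
    by (simp add: mult.assoc[symmetric] uosp_scalar_mult[symmetric] uosp_scalar_1)
qed

lemma of_nat_left: "u * (of_nat k * v) = of_nat k * (u * v)" for u v :: "'a::ring_1"
  by (simp only: mult.assoc[symmetric] mult_of_nat_commute[of k u])

section \<open>Powers of e_0 passed by h_0 and f_0\<close>

lemma H_E_power: "gH 0 * gE 0 ^ N = gE 0 ^ N * gH 0 + of_nat (2 * N) * gE 0 ^ N"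
proof (induction N)
  case (Suc N)
  have "gH 0 * gE 0 ^ Suc N = gE 0 * (gH 0 * gE 0 ^ N) + 2 * gE 0 ^ Suc N"
    by (simp add: H_E distrib_right flip: mult.assoc)
  also have "gE 0 * (gH 0 * gE 0 ^ N) = gE 0 ^ Suc N * gH 0 + of_nat (2 * N) * gE 0 ^ Suc N"
    by (simp only: Suc distrib_left power_Suc mult.assoc of_nat_left[of "gE 0"])
  also have "gE 0 ^ Suc N * gH 0 + of_nat (2 * N) * gE 0 ^ Suc N + 2 * gE 0 ^ Suc N
      = gE 0 ^ Suc N * gH 0 + of_nat (2 * Suc N) * gE 0 ^ Suc N"
    by (simp add: distrib_right mult_2 del: power_Suc)
  finally show ?case .
qed simp

lemma F_E_power:
  "gF 0 * gE 0 ^ Suc N = gE 0 ^ Suc N * gF 0 - of_nat (Suc N) * (gE 0 ^ N * (gH 0 + of_nat N))"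
proof (induction N)
  case 0
  then show ?case by (simp add: F_E)
next
  case (Suc N)
  have "gF 0 * gE 0 ^ Suc (Suc N) = gE 0 * (gF 0 * gE 0 ^ Suc N) - gH 0 * gE 0 ^ Suc N"
    unfolding power_Suc[of _ "Suc N"] by (simp add: F_E left_diff_distrib del: power_Suc flip: mult.assoc)
  also have "gE 0 * (gF 0 * gE 0 ^ Suc N) = gE 0 ^ Suc (Suc N) * gF 0
      - of_nat (Suc N) * (gE 0 ^ Suc N * gH 0 + of_nat N * gE 0 ^ Suc N)"
    unfolding Suc
    by (simp only: right_diff_distrib distrib_left power_Suc mult.assoc of_nat_left[of "gE 0"]
        mult_of_nat_commute[of N "gE 0 ^ N", symmetric])
  also have "\<dots> - gH 0 * gE 0 ^ Suc N = gE 0 ^ Suc (Suc N) * gF 0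
      - (of_nat (Suc (Suc N)) * (gE 0 ^ Suc N * gH 0) + of_nat (Suc (Suc N) * Suc N) * gE 0 ^ Suc N)"
    unfolding H_E_power[of "Suc N"]
    by (simp add: distrib_left distrib_right algebra_simps mult_2 del: power_Suc)
  also have "of_nat (Suc (Suc N) * Suc N) * gE 0 ^ Suc N
      = of_nat (Suc (Suc N)) * (gE 0 ^ Suc N * of_nat (Suc N))"
    by (simp only: of_nat_mult mult.assoc mult_of_nat_commute[of "Suc N" "gE 0 ^ Suc N"])
  finally show ?case by (simp only: distrib_left)
qed

section \<open>First consequences of the Weyl relations\<close>

definition weyl_ideal :: "nat \<Rightarrow> uosp set" where
  "weyl_ideal n = left_ideal (weyl_relations n)"

lemma subspace_weyl_ideal: "uosp.subspace (weyl_ideal n)"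
  unfolding weyl_ideal_def by (rule subspace_left_ideal)

lemma weyl_ideal_lmult: "u \<in> weyl_ideal n \<Longrightarrow> a * u \<in> weyl_ideal n"
  unfolding weyl_ideal_def by (rule left_ideal.lmult)

lemma weyl_ideal_rels:
  "gF i \<in> weyl_ideal n" "gM i \<in> weyl_ideal n" "i \<ge> 1 \<Longrightarrow> gH i \<in> weyl_ideal n"
  "gH 0 + of_nat n \<in> weyl_ideal n" "gE 0 ^ Suc n \<in> weyl_ideal n"
proof -
  have "gF 0 \<in> weyl_ideal n" "gM 0 \<in> weyl_ideal n"
    unfolding weyl_ideal_def by (rule left_ideal.base, simp add: weyl_relations_def)+
  moreover have *: "cur y i \<in> weyl_ideal n" if "i \<ge> 1" "y \<in> {osp_f, osp_gm, osp_h}" for i y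
    unfolding weyl_ideal_def using that by (intro left_ideal.base) (auto simp: weyl_relations_def)
  ultimately show "gF i \<in> weyl_ideal n" "gM i \<in> weyl_ideal n"
    by (cases "i = 0"; simp)+
  show "i \<ge> 1 \<Longrightarrow> gH i \<in> weyl_ideal n"
    using * by simp
  show "gH 0 + of_nat n \<in> weyl_ideal n"
    unfolding weyl_ideal_def by (rule left_ideal.base) (simp add: weyl_relations_def)
  show "gE 0 ^ Suc n \<in> weyl_ideal n"
    unfolding weyl_ideal_def by (rule left_ideal.base) (simp add: weyl_relations_def)
qed

lemma sl2_weyl_ideal: "sl2_weyl (weyl_ideal n) 1 n"
proof
  show "gE 0 ^ Suc n * 1 \<in> weyl_ideal n"
    using weyl_ideal_rels(5) by (simp only: mult_1_right)
qed (simp_all add: weyl_ideal_lmult weyl_ideal_rels subspace_weyl_ideal)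

text \<open>Garland's relation for one factor puts \<open>gE b\<close> into the ideal as soon as b
  \<ge> n, and the commutator with \<open>gM 0\<close> turns it into \<open>gP b\<close>.\<close>

lemma P_weyl_ideal:
  assumes "b \<ge> n" shows "gP b \<in> weyl_ideal n"
proof -
  interpret sl2_weyl "weyl_ideal n" 1 n by (rule sl2_weyl_ideal)
  have "gE b \<in> weyl_ideal n"
    using Esh_power_in_I[of b 1] assms by (simp add: I_def)
  then have "gM 0 * gE b - gE b * gM 0 \<in> weyl_ideal n"
    by (intro uosp.subspace_diff subspace_weyl_ideal weyl_ideal_lmult weyl_ideal_rels)
  then show ?thesis
    by (simp add: M_E)
qed

text \<open>The lists in \<open>B\<close> may be unsorted and have repetitions, so that sets
  described by length and sum are stable under the currents. Sorting waits until
  \<open>gp_mon_strict\<close>.\<close>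

definition mspan :: "nat \<Rightarrow> nat list set \<Rightarrow> uosp set" where
  "mspan n B = uosp.span ({e_mon as * gp_mon bs | as bs. bs \<in> B} \<union> weyl_ideal n)"

lemma subspace_mspan: "uosp.subspace (mspan n B)"
  unfolding mspan_def by (rule uosp.subspace_span)

lemmas mspan_add = uosp.subspace_add[OF subspace_mspan]
lemmas mspan_diff = uosp.subspace_diff[OF subspace_mspan]
lemmas mspan_scale = uosp.subspace_scale[OF subspace_mspan]

lemma mspan_mono: "B \<subseteq> B' \<Longrightarrow> u \<in> mspan n B \<Longrightarrow> u \<in> mspan n B'"
  unfolding mspan_def using uosp.span_mono[of "{e_mon as * gp_mon bs |as bs. bs \<in> B} \<union> weyl_ideal n"
      "{e_mon as * gp_mon bs |as bs. bs \<in> B'} \<union> weyl_ideal n"] by blast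

lemma mspan_base: "bs \<in> B \<Longrightarrow> e_mon as * gp_mon bs \<in> mspan n B"
  unfolding mspan_def by (rule uosp.span_base) blast

lemma mspan_base': "bs \<in> B \<Longrightarrow> gp_mon bs \<in> mspan n B"
  using mspan_base[of bs B "[]"] by simp

lemma mspan_ideal: "u \<in> weyl_ideal n \<Longrightarrow> u \<in> mspan n B"
  unfolding mspan_def by (rule uosp.span_base) blast

lemma mspan_least:
  assumes "uosp.subspace T" "weyl_ideal n \<subseteq> T" "\<And>as bs. bs \<in> B \<Longrightarrow> e_mon as * gp_mon bs \<in> T"
    and "u \<in> mspan n B"
  shows "u \<in> T"
proof -
  have "mspan n B \<subseteq> T"
    unfolding mspan_def by (rule uosp.span_minimal) (use assms in auto)
  with assms(4) show ?thesis by blast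
qed

lemma mspan_lmult:
  assumes "\<And>as bs. bs \<in> B \<Longrightarrow> x * (e_mon as * gp_mon bs) \<in> mspan n B'" "u \<in> mspan n B"
  shows "x * u \<in> mspan n B'"
proof -
  have "uosp.subspace {u. x * u \<in> mspan n B'}"
    by (rule uosp.subspaceI)
      (simp_all add: distrib_left uosp_scalar_left_comm mspan_add mspan_scale uosp.subspace_0[OF subspace_mspan])
  from mspan_least[OF this _ _ assms(2)] show ?thesis
    using assms(1) by (auto intro: mspan_ideal weyl_ideal_lmult)
qed

lemma mspan_E: "u \<in> mspan n B \<Longrightarrow> gE i * u \<in> mspan n B"
  by (erule mspan_lmult[rotated]) (use mspan_base[of _ B "i # _"] in \<open>simp add: mult.assoc\<close>)

lemma mspan_e_mon: "u \<in> mspan n B \<Longrightarrow> e_mon as * u \<in> mspan n B"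
  by (induction as) (simp_all add: mult.assoc mspan_E)

lemma mspan_P: "u \<in> mspan n B \<Longrightarrow> (\<And>bs. bs \<in> B \<Longrightarrow> b # bs \<in> B') \<Longrightarrow> gP b * u \<in> mspan n B'"
  by (erule mspan_lmult[rotated]) (use mspan_base[of "b # _" B'] in \<open>simp add: P_e_mon\<close>)

text \<open>\<open>gH i\<close> shifts one g+ at a time by i; on the generator it is a scalar for i
  = 0 and zero otherwise. For i \<ge> 1 this is strict descent in the second filtration.\<close>

lemma H_gp_mon: "gH i * gp_mon bs \<in> mspan n {bs'. length bs' = length bs \<and> sum_list bs' = sum_list bs + i}"
proof (induction bs arbitrary: i)
  case Nil
  show ?case
  proof (cases "i = 0")
    case True
    have "(gH 0 + of_nat n) - uosp_scalar (of_nat n) * gp_mon [] \<in> mspan n {[]}"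
      by (intro mspan_diff mspan_scale mspan_base' mspan_ideal weyl_ideal_rels) simp
    then have "gH 0 \<in> mspan n {[]}"
      by (simp add: uosp_scalar_of_nat)
    with True show ?thesis
      by (auto elim: mspan_mono[rotated])
  next
    case False
    then show ?thesis by (simp add: mspan_ideal weyl_ideal_rels)
  qed
next
  case (Cons b bs)
  have "gP b * (gH i * gp_mon bs) \<in> mspan n {bs'. length bs' = length (b # bs) \<and> sum_list bs' = sum_list (b # bs) + i}"
    by (rule mspan_P[OF Cons]) auto
  moreover have "gp_mon ((i + b) # bs) \<in> mspan n {bs'. length bs' = length (b # bs) \<and> sum_list bs' = sum_list (b # bs) + i}"
    by (rule mspan_base') auto
  ultimately show ?case
    using mspan_add by (fastforce simp: H_P distrib_right simp flip: mult.assoc)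
qed

lemma H_0_gp_mon: "gH 0 * gp_mon bs + of_nat n * gp_mon bs - of_nat (length bs) * gp_mon bs \<in> weyl_ideal n"
proof (induction bs)
  case Nil
  then show ?case using weyl_ideal_rels(4) by simp
next
  case (Cons b bs)
  have "gH 0 * gp_mon (b # bs) + of_nat n * gp_mon (b # bs) - of_nat (length (b # bs)) * gp_mon (b # bs)
      = gP b * (gH 0 * gp_mon bs + of_nat n * gp_mon bs - of_nat (length bs) * gp_mon bs)"
    by (simp add: right_diff_distrib distrib_left of_nat_left[of "gP b"])
      (simp add: H_P distrib_right flip: mult.assoc)
  then show ?case
    using weyl_ideal_lmult[OF Cons] by metis
qed

text \<open>\<open>gM i\<close> contracts with a g+ to some \<open>gH\<close>, which preserves the
  number of g+. In the next lemma \<open>gF i\<close> first turns a g+ into a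
  \<open>gM\<close>.\<close>

lemma M_gp_mon: "gM i * gp_mon bs \<in> mspan n {bs'. length bs' < length bs}"
proof (induction bs arbitrary: i)
  case Nil
  then show ?case by (simp add: mspan_ideal weyl_ideal_rels)
next
  case (Cons b bs)
  have "gP b * (gM i * gp_mon bs) \<in> mspan n {bs'. length bs' < length (b # bs)}"
    by (rule mspan_P[OF Cons]) auto
  moreover have "gH (i + b) * gp_mon bs \<in> mspan n {bs'. length bs' < length (b # bs)}"
    by (rule mspan_mono[OF _ H_gp_mon]) auto
  ultimately show ?case
    using mspan_diff by (fastforce simp: M_P left_diff_distrib simp flip: mult.assoc)
qed

lemma F_gp_mon: "gF i * gp_mon bs \<in> mspan n {bs'. length bs' < length bs}"
proof (induction bs arbitrary: i)
  case Nil
  then show ?case by (simp add: mspan_ideal weyl_ideal_rels)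
next
  case (Cons b bs)
  have "gP b * (gF i * gp_mon bs) \<in> mspan n {bs'. length bs' < length (b # bs)}"
    by (rule mspan_P[OF Cons]) auto
  moreover have "gM (i + b) * gp_mon bs \<in> mspan n {bs'. length bs' < length (b # bs)}"
    by (rule mspan_mono[OF _ M_gp_mon]) auto
  ultimately show ?case
    using mspan_diff by (fastforce simp: F_P left_diff_distrib simp flip: mult.assoc)
qed

text \<open>Passing an e-current only creates e-currents, so stability has to be checked on pure
  products of g+.\<close>

lemma mspan_H:
  assumes "\<And>bs i. bs \<in> B \<Longrightarrow> gH i * gp_mon bs \<in> mspan n B" "u \<in> mspan n B"
  shows "gH i * u \<in> mspan n B"
proof (rule mspan_lmult[OF _ assms(2)])
  fix as bs assume bs: "bs \<in> B"
  show "gH i * (e_mon as * gp_mon bs) \<in> mspan n B"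
  proof (induction as)
    case Nil
    then show ?case using assms(1)[OF bs] by simp
  next
    case (Cons a as)
    have "gH i * (e_mon (a # as) * gp_mon bs) = gE a * (gH i * (e_mon as * gp_mon bs)) + uosp_scalar 2 * (e_mon ((i + a) # as) * gp_mon bs)"
      by (simp add: H_E algebra_simps uosp_scalar_numeral flip: mult.assoc)
    with Cons bs show ?case
      by (auto intro!: mspan_add mspan_E mspan_scale mspan_base simp del: list.map prod_list.Cons)
  qed
qed

lemma mspan_F:
  assumes H: "\<And>bs i. bs \<in> B \<Longrightarrow> gH i * gp_mon bs \<in> mspan n B" and F: "\<And>bs i. bs \<in> B \<Longrightarrow> gF i * gp_mon bs \<in> mspan n B"
    and u: "u \<in> mspan n B"
  shows "gF i * u \<in> mspan n B"
proof (rule mspan_lmult[OF _ u])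
  fix as bs assume bs: "bs \<in> B"
  show "gF i * (e_mon as * gp_mon bs) \<in> mspan n B"
  proof (induction as)
    case Nil
    then show ?case using F[OF bs] by simp
  next
    case (Cons a as)
    have "gF i * (e_mon (a # as) * gp_mon bs) = gE a * (gF i * (e_mon as * gp_mon bs)) - gH (i + a) * (e_mon as * gp_mon bs)"
      by (simp add: F_E algebra_simps flip: mult.assoc)
    with Cons bs show ?case
      by (auto intro!: mspan_diff mspan_E mspan_H[OF H] mspan_base simp del: list.map prod_list.Cons)
  qed
qed

lemma mspan_UNIV: "u \<in> mspan n UNIV"
proof (induction u rule: uosp_induct)
  case one
  then show ?case using mspan_base[of "[]" UNIV "[]" n] by simp
next
  case (cur y i u)
  have all: "v \<in> mspan n B \<Longrightarrow> v \<in> mspan n UNIV" for v B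
    by (rule mspan_mono) auto
  have "gM i * (e_mon as * gp_mon bs) \<in> mspan n UNIV" for as bs
  proof (induction as)
    case Nil
    then show ?case using all[OF M_gp_mon] by simp
  next
    case (Cons a as)
    have "gM i * (e_mon (a # as) * gp_mon bs) = gE a * (gM i * (e_mon as * gp_mon bs)) + gP (i + a) * (e_mon as * gp_mon bs)"
      by (simp add: M_E algebra_simps flip: mult.assoc)
    with Cons show ?case
      by (auto intro!: mspan_add mspan_E mspan_P[of _ _ UNIV] mspan_base simp del: list.map prod_list.Cons)
  qed
  with cur show ?case
    by (cases y)
      (auto intro: mspan_E mspan_P mspan_H mspan_F mspan_lmult all[OF H_gp_mon] all[OF F_gp_mon])
qed (auto intro: mspan_add mspan_scale)

text \<open>Contains at most one list, and none if X repeats an index or has one \<ge> n; in that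
  case \<open>gp_mon_strict\<close> says that the product reduces to fewer g+.\<close>

definition strict_arrangements :: "nat \<Rightarrow> nat multiset \<Rightarrow> nat list set" where
  "strict_arrangements n X = {ds. mset ds = X \<and> sorted_wrt (<) ds \<and> (\<forall>d\<in>set ds. d < n)}"

text \<open>One step of insertion sort. Passing a smaller index costs \<open>2 * gE (b + c)\<close>
  and meeting an equal one gives \<open>gE (b + b)\<close>; both lose two g+. An index \<ge> n that
  reaches the end is killed by the ideal.\<close>

lemma P_gp_mon_strict:
  assumes "sorted_wrt (<) cs" "\<forall>c\<in>set cs. c < n"
  shows "gP b * gp_mon cs \<in> mspan n ({ds. length ds < Suc (length cs)} \<union> strict_arrangements n (add_mset b (mset cs)))"
  using assms
proof (induction cs)
  case Nil
  show ?case
  proof (cases "b < n")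
    case True
    then have "gp_mon [b] \<in> mspan n ({ds. length ds < 1} \<union> strict_arrangements n {#b#})"
      by (intro mspan_base') (auto simp: strict_arrangements_def)
    then show ?thesis by simp
  qed (auto intro!: mspan_ideal P_weyl_ideal)
next
  case (Cons c cs)
  let ?B = "{ds. length ds < Suc (length (c # cs))} \<union> strict_arrangements n (add_mset b (mset (c # cs)))"
  consider "b < c" | "b = c" | "c < b" by linarith
  then show ?case
  proof cases
    case 1
    with Cons.prems have "gp_mon (b # c # cs) \<in> mspan n ?B"
      by (intro mspan_base') (auto simp: strict_arrangements_def)
    then show ?thesis by simp
  next
    case 2
    have "e_mon [b + b] * gp_mon cs \<in> mspan n ?B"
      by (intro mspan_base) auto
    with 2 show ?thesis by (simp add: P_sq flip: mult.assoc)
  next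
    case 3
    have "e_mon [b + c] * gp_mon cs \<in> mspan n ?B"
      by (intro mspan_base) auto
    moreover have "gP c * (gP b * gp_mon cs) \<in> mspan n ?B"
    proof (rule mspan_P)
      show "gP b * gp_mon cs \<in> mspan n ({ds. length ds < Suc (length cs)} \<union> strict_arrangements n (add_mset b (mset cs)))"
        using Cons by simp
      fix ds assume "ds \<in> {ds. length ds < Suc (length cs)} \<union> strict_arrangements n (add_mset b (mset cs))"
      moreover have "set ds = insert b (set cs)" if "mset ds = add_mset b (mset cs)"
        using that by (metis set_mset_add_mset_insert set_mset_mset)
      ultimately show "c # ds \<in> ?B"
        using Cons.prems 3 by (auto simp: strict_arrangements_def)
    qed
    ultimately have "uosp_scalar 2 * (e_mon [b + c] * gp_mon cs) - gP c * (gP b * gp_mon cs) \<in> mspan n ?B"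
      by (intro mspan_diff mspan_scale)
    then show ?thesis
      by (simp add: P_P[of b c] left_diff_distrib uosp_scalar_numeral flip: mult.assoc)
  qed
qed

lemma gp_mon_strict: "gp_mon bs \<in> mspan n ({ds. length ds < length bs} \<union> strict_arrangements n (mset bs))"
proof (induction bs)
  case Nil
  have "gp_mon [] \<in> mspan n (strict_arrangements n {#})"
    by (rule mspan_base') (simp add: strict_arrangements_def)
  then show ?case by simp
next
  case (Cons b bs)
  let ?B = "{ds. length ds < Suc (length bs)} \<union> strict_arrangements n (add_mset b (mset bs))"
  have "gP b * gp_mon bs \<in> mspan n ?B"
  proof (rule mspan_lmult[OF _ Cons])
    fix as ds assume ds: "ds \<in> {ds. length ds < length bs} \<union> strict_arrangements n (mset bs)"
    have "gP b * gp_mon ds \<in> mspan n ?B"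
    proof (cases "length ds < length bs")
      case True
      then have "gp_mon (b # ds) \<in> mspan n ?B"
        by (intro mspan_base') auto
      then show ?thesis by simp
    next
      case False
      with ds have "mset ds = mset bs" "sorted_wrt (<) ds" "\<forall>d\<in>set ds. d < n"
        by (auto simp: strict_arrangements_def)
      then show ?thesis
        using P_gp_mon_strict[of ds n b] by (metis mset_eq_length)
    qed
    then show "gP b * (e_mon as * gp_mon ds) \<in> mspan n ?B"
      by (simp add: P_e_mon mspan_e_mon)
  qed
  then show ?case by simp
qed

text \<open>Modulo \<open>Y\<close>, f_0 e_0^(N+1) v = -(N+1)(N-m) e_0^N v for v of weight -m killed
  by f_0. The factor is nonzero while N > m, so the exponent can be lowered to m + 1.\<close>

lemma E_power_lower:
  assumes Y: "uosp.subspace Y" "\<And>u i. u \<in> Y \<Longrightarrow> gE i * u \<in> Y" "\<And>u. u \<in> Y \<Longrightarrow> gF 0 * u \<in> Y"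
    and v: "gF 0 * v \<in> Y" "gH 0 * v + of_nat m * v \<in> Y"
    and "gE 0 ^ Suc (m + r) * v \<in> Y"
  shows "gE 0 ^ Suc m * v \<in> Y"
  using assms(6)
proof (induction r)
  case (Suc r)
  define N where "N = Suc (m + r)"
  have pow: "gE 0 ^ k * u \<in> Y" if "u \<in> Y" for k u
    using that by (induction k) (auto simp: mult.assoc Y(2))
  have scale: "of_nat k * u \<in> Y" if "u \<in> Y" for k u
    using uosp.subspace_scale[OF Y(1) that, of "of_nat k"] by (simp add: uosp_scalar_of_nat)
  have "gF 0 * (gE 0 ^ Suc N * v) = gE 0 ^ Suc N * (gF 0 * v) - of_nat (Suc N) * (gE 0 ^ N * (gH 0 * v + of_nat N * v))"
    by (simp only: mult.assoc[symmetric] F_E_power) (simp add: algebra_simps)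
  moreover have "of_nat N * v = of_nat m * v + of_nat (Suc r) * v"
    by (simp only: N_def distrib_right[symmetric] of_nat_add[symmetric]) simp
  ultimately have "of_nat (Suc N) * (gE 0 ^ N * (of_nat (Suc r) * v)) = gE 0 ^ Suc N * (gF 0 * v)
      - of_nat (Suc N) * (gE 0 ^ N * (gH 0 * v + of_nat m * v)) - gF 0 * (gE 0 ^ Suc N * v)"
    by (simp add: algebra_simps del: of_nat_Suc power_Suc)
  moreover have "gF 0 * (gE 0 ^ Suc N * v) \<in> Y"
    using Suc.prems by (intro Y) (simp add: N_def)
  ultimately have "of_nat (Suc N) * (gE 0 ^ N * (of_nat (Suc r) * v)) \<in> Y"
    by (metis pow scale v uosp.subspace_diff[OF Y(1)])
  moreover have "of_nat (Suc N) * (gE 0 ^ N * (of_nat (Suc r) * v)) = uosp_scalar (of_nat (Suc N * Suc r)) * (gE 0 ^ N * v)"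
    by (simp only: uosp_scalar_of_nat, simp only: of_nat_mult of_nat_left[of "gE 0 ^ N"] mult.assoc)
  ultimately have "uosp_scalar (inverse (of_nat (Suc N * Suc r))) * (uosp_scalar (of_nat (Suc N * Suc r)) * (gE 0 ^ N * v)) \<in> Y"
    using uosp.subspace_scale[OF Y(1)] by metis
  then have "gE 0 ^ N * v \<in> Y"
    by (simp only: mult.assoc[symmetric] uosp_scalar_mult[symmetric]) (simp add: uosp_scalar_1 field_simps del: of_nat_Suc of_nat_mult mult_Suc mult_Suc_right)
  then show ?case
    by (intro Suc.IH) (simp add: N_def)
qed simp

definition weyl_mon :: "nat list \<times> nat list \<Rightarrow> uosp" where
  "weyl_mon x = e_mon (fst x) * gp_mon (snd x)"

text \<open>Let k = \<open>length ds\<close>. Modulo lower terms \<open>gp_mon ds\<close> has weight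
  -(n - k) and is killed by f_i, which loses a g+, and by h_i with i \<ge> 1, which raises the sum.
  So \<open>sl2_weyl\<close> applies with m = n - k, and its box is the range of \<open>as\<close>
  in \<open>weyl_index\<close>.\<close>

lemma e_mon_strict_gp_mon_in:
  assumes T: "uosp.subspace T" "weyl_ideal n \<subseteq> T" "weyl_mon ` weyl_index n \<subseteq> T"
    and ds: "sorted_wrt (<) ds" "\<forall>d\<in>set ds. d < n"
    and lower: "\<And>as bs. length bs < length ds \<or> length bs = length ds \<and> sum_list bs > sum_list ds \<Longrightarrow> e_mon as * gp_mon bs \<in> T"
  shows "e_mon as * gp_mon ds \<in> T"
proof -
  define B where "B = {bs. length bs < length ds \<or> length bs = length ds \<and> sum_list bs > sum_list ds}"
  define Y where "Y = mspan n B"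
  \<comment> \<open>Keeps \<open>n - length ds\<close> from being truncated.\<close>
  have len: "length ds \<le> n"
  proof -
    have "card (set ds) \<le> card {..<n}"
      using ds by (intro card_mono) auto
    then show ?thesis
      using ds strict_sorted_iff distinct_card by (metis card_lessThan)
  qed
  have H: "gH i * gp_mon bs \<in> Y" if "bs \<in> B" for i bs
    unfolding Y_def by (rule mspan_mono[OF _ H_gp_mon]) (use that in \<open>auto simp: B_def\<close>)
  have F: "gF i * gp_mon bs \<in> Y" if "bs \<in> B" for i bs
    unfolding Y_def by (rule mspan_mono[OF _ F_gp_mon]) (use that in \<open>auto simp: B_def\<close>)
  have F_Y: "gF i * u \<in> Y" if "u \<in> Y" for i u
    using mspan_F H F that unfolding Y_def by blast
  have F_v: "gF i * gp_mon ds \<in> Y" for i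
    unfolding Y_def by (rule mspan_mono[OF _ F_gp_mon]) (auto simp: B_def)
  interpret sl2_weyl Y "gp_mon ds" "n - length ds"
  proof
    show "uosp.subspace Y" unfolding Y_def by (rule subspace_mspan)
    show "gE i * u \<in> Y" if "u \<in> Y" for i u
      using that unfolding Y_def by (rule mspan_E)
    show "gH i * u \<in> Y" if "u \<in> Y" for i u
      using that mspan_H H unfolding Y_def by blast
    show "gF 1 * u \<in> Y" if "u \<in> Y" for u using F_Y that by blast
    show "gF 1 * gp_mon ds \<in> Y" by (rule F_v)
    show "gH i * gp_mon ds \<in> Y" if "i \<ge> 1" for i
      unfolding Y_def by (rule mspan_mono[OF _ H_gp_mon]) (use that in \<open>auto simp: B_def\<close>)
    \<comment> \<open>e_0 commutes with every g+, so the relation for e_0^(n+1) carries over; the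
      weight then brings the exponent down.\<close>
    have "gp_mon ds * gE 0 ^ k = gE 0 ^ k * gp_mon ds" for k
      by (induction k) (simp_all, metis gp_mon_E mult.assoc)
    then have "gE 0 ^ Suc n * gp_mon ds \<in> weyl_ideal n"
      using weyl_ideal_lmult[OF weyl_ideal_rels(5), of "gp_mon ds" n] by metis
    then have "gE 0 ^ Suc ((n - length ds) + length ds) * gp_mon ds \<in> Y"
      using len unfolding Y_def by (intro mspan_ideal) simp
    moreover have "gH 0 * gp_mon ds + of_nat (n - length ds) * gp_mon ds \<in> Y"
      using mspan_ideal[OF H_0_gp_mon[of ds n]] len
      unfolding Y_def by (simp add: of_nat_diff algebra_simps)
    ultimately show "gE 0 ^ Suc (n - length ds) * gp_mon ds \<in> Y"
      by (intro E_power_lower[of Y "gp_mon ds" "n - length ds" "length ds"] F_v F_Y)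
        (auto simp: Y_def subspace_mspan mspan_E)
  qed
  show ?thesis
  proof (rule box_spans)
    show "uosp.subspace T" by fact
    show "Y \<subseteq> T"
    proof
      fix u assume "u \<in> Y"
      then show "u \<in> T"
        unfolding Y_def by (rule mspan_least[OF T(1,2), rotated]) (simp add: B_def lower)
    qed
    fix as assume as: "\<forall>a\<in>set as. a + length as \<le> n - length ds"
    have "(sort as, ds) \<in> weyl_index n"
      using as ds len by (auto simp: weyl_index_def)
    then have "weyl_mon (sort as, ds) \<in> T" using T(3) by blast
    then show "e_mon as * gp_mon ds \<in> T"
      using e_mon_mset[of "sort as" as] by (simp add: weyl_mon_def)
  qed
qed

text \<open>\<open>T\<close> is arbitrary so that it can later be the preimage of a span in the
  module. Strict lists are rewritten through fewer g+ or a larger sum, hence the induction on the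
  length and, inside it, on the distance of the sum from \<open>n * length bs\<close>.\<close>

theorem weyl_spanning:
  assumes T: "uosp.subspace T" "weyl_ideal n \<subseteq> T" "weyl_mon ` weyl_index n \<subseteq> T"
  shows "u \<in> T"
proof -
  have "e_mon as * gp_mon bs \<in> T" for as bs
  proof (induction "length bs" arbitrary: as bs rule: less_induct)
    case (less bs)
    have "length cs = length bs \<Longrightarrow> e_mon as * gp_mon cs \<in> T" for as cs
    proof (induction "n * length bs - sum_list cs" arbitrary: as cs rule: less_induct)
      case (less cs)
      note IH1 = \<open>\<And>ds as. length ds < length bs \<Longrightarrow> e_mon as * gp_mon ds \<in> T\<close>
      note IH2 = less(1) and len = less(2)
      have "e_mon as * gp_mon ds \<in> T" if ds: "ds \<in> strict_arrangements n (mset cs)" for ds as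
      proof (rule e_mon_strict_gp_mon_in[OF T])
        show "sorted_wrt (<) ds" "\<forall>d\<in>set ds. d < n"
          using ds by (auto simp: strict_arrangements_def)
        have eq: "length ds = length cs" "sum_list ds = sum_list cs"
          using ds by (auto simp: strict_arrangements_def dest: mset_eq_length) (metis sum_mset_sum_list)
        fix as' bs' assume bs': "length bs' < length ds \<or> length bs' = length ds \<and> sum_list ds < sum_list bs'"
        show "e_mon as' * gp_mon bs' \<in> T"
        proof (cases "length bs' < length ds")
          case True
          then show ?thesis using IH1 len eq by simp
        next
          case False
          with bs' have bs': "length bs' = length ds" "sum_list ds < sum_list bs'" by auto
          have "ds \<noteq> []" using bs' by auto
          \<comment> \<open>Strictness makes the truncated difference drop whenever the sum
            grows.\<close>
          have "sum_list ds < n * length ds"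
            using \<open>\<forall>d\<in>set ds. d < n\<close> \<open>ds \<noteq> []\<close>
          proof (induction ds)
            case (Cons d ds)
            then show ?case by (cases "ds = []") fastforce+
          qed simp
          then show ?thesis
            using bs' eq len by (intro IH2) auto
        qed
      qed
      with IH1 len have "e_mon as * gp_mon ds \<in> T"
        if "ds \<in> {ds. length ds < length cs} \<union> strict_arrangements n (mset cs)" for ds as
        using that by auto
      from mspan_least[OF T(1,2) this mspan_e_mon[OF gp_mon_strict]] show ?case .
    qed
    then show ?case by blast
  qed
  with mspan_least[OF T(1,2) _ mspan_UNIV] show ?thesis by blast
qed

section \<open>A right action on functionals on tensor powers of the loop module\<close>

text \<open>\<open>StW\<close>, \<open>StG\<close>, \<open>StE\<close> are the basis \<open>w, g\<^sup>+w, ew\<close> of \<open>W\<^sub>-\<^sub>1\<close>, and a list of pairs \<open>(s, p)\<close> stands for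
  a tensor of vectors \<open>s \<otimes> x\<^sup>p\<close>. Functionals are used so that no finitely supported sums are needed.\<close>

datatype st = StW | StG | StE

type_synonym functional = "(st \<times> nat) list \<Rightarrow> complex"

fun site :: "osp \<Rightarrow> (st \<Rightarrow> complex) \<Rightarrow> st \<Rightarrow> complex" where
  "site osp_e A s = (case s of StW \<Rightarrow> A StE | _ \<Rightarrow> 0)"
| "site osp_h A s = (case s of StW \<Rightarrow> - A StW | StG \<Rightarrow> 0 | StE \<Rightarrow> A StE)"
| "site osp_f A s = (case s of StE \<Rightarrow> A StW | _ \<Rightarrow> 0)"
| "site osp_gp A s = (case s of StW \<Rightarrow> A StG | StG \<Rightarrow> A StE | StE \<Rightarrow> 0)"
| "site osp_gm A s = (case s of StW \<Rightarrow> 0 | StG \<Rightarrow> - A StW | StE \<Rightarrow> A StG)"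

text \<open>The minus is the Koszul sign of an odd current passing the odd state \<open>StG\<close>.
  Functionals are composed with the action, so products come out reversed.\<close>

fun rho :: "osp \<Rightarrow> nat \<Rightarrow> functional \<Rightarrow> functional" where
  "rho y i \<phi> [] = 0"
| "rho y i \<phi> ((s, p) # l) = site y (\<lambda>s'. \<phi> ((s', p + i) # l)) s
     + (if osp_odd y \<and> s = StG then - 1 else 1) * rho y i (\<lambda>l'. \<phi> ((s, p) # l')) l"

lemma rho_add: "rho y i (\<lambda>l. \<phi> l + \<psi> l) l = rho y i \<phi> l + rho y i \<psi> l"
proof (induction y i \<phi> l arbitrary: \<psi> rule: rho.induct)
  case (2 y i \<phi> s p l)
  show ?case
    unfolding rho.simps 2 by (cases y; cases s) (simp_all add: algebra_simps)
qed simp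

lemma rho_scale: "rho y i (\<lambda>l. c * \<phi> l) l = c * rho y i \<phi> l"
proof (induction y i \<phi> l rule: rho.induct)
  case (2 y i \<phi> s p l)
  then show ?case by (cases y; cases s) (simp_all add: algebra_simps)
qed simp

lemma rho_uminus: "rho y i (\<lambda>l. - \<phi> l) l = - rho y i \<phi> l"
  using rho_scale[of y i "- 1" \<phi> l] by simp

lemma rho_diff: "rho y i (\<lambda>l. \<phi> l - \<psi> l) l = rho y i \<phi> l - rho y i \<psi> l"
  using rho_add[of y i \<phi> "\<lambda>l. - \<psi> l" l] by (simp add: rho_uminus)

lemma rho_0: "rho y i (\<lambda>l. 0) l = 0"
  using rho_scale[of y i 0 "\<lambda>_. 0" l] by simp

lemmas rho_linear = rho_add rho_scale rho_uminus rho_diff rho_0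

definition rho_lin :: "(osp \<Rightarrow>\<^sub>0 complex) \<Rightarrow> nat \<Rightarrow> functional \<Rightarrow> functional" where
  "rho_lin v i \<phi> l = (\<Sum>z\<in>Poly_Mapping.keys v. Poly_Mapping.lookup v z * rho z i \<phi> l)"

lemma rho_lin_single: "rho_lin (Poly_Mapping.single z c) i \<phi> l = c * rho z i \<phi> l"
  by (cases "c = 0") (simp_all add: rho_lin_def)

lemma rho_lin_0: "rho_lin 0 i \<phi> l = 0"
  by (simp add: rho_lin_def)

text \<open>\<open>rho y j (rho x i \<phi>)\<close> is \<phi> after x_i y_j. On one factor the
  identity says that W_-1 is a module, a finite check; terms acting on two different factors cancel
  by the Koszul signs.\<close>

lemma rho_commutator:
  "rho y j (rho x i \<phi>) l - super_sign x y * rho x i (rho y j \<phi>) l = rho_lin (osp_bracket x y) (i + j) \<phi> l"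
proof (induction l arbitrary: \<phi>)
  case Nil
  then show ?case by (cases x; cases y) (simp_all add: rho_lin_single rho_lin_0)
next
  case (Cons sp l)
  obtain s p where sp: "sp = (s, p)" by (cases sp)
  show ?case
    using Cons[of "\<lambda>l'. \<phi> ((s, p) # l')"] unfolding sp
    by (cases x; cases y; cases s)
      (simp_all add: rho_lin_single rho_lin_0 rho_linear super_sign_def algebra_simps)
qed

fun power_sum_act :: "nat \<Rightarrow> functional \<Rightarrow> functional" where
  "power_sum_act i \<phi> [] = 0"
| "power_sum_act i \<phi> ((s, p) # l) = \<phi> ((s, p + i) # l) + power_sum_act i (\<lambda>l'. \<phi> ((s, p) # l')) l"

lemma power_sum_act_add: "power_sum_act i (\<lambda>l. \<phi> l + \<psi> l) l = power_sum_act i \<phi> l + power_sum_act i \<psi> l"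
  by (induction i \<phi> l arbitrary: \<psi> rule: power_sum_act.induct) simp_all

lemma power_sum_act_scale: "power_sum_act i (\<lambda>l. c * \<phi> l) l = c * power_sum_act i \<phi> l"
  by (induction i \<phi> l rule: power_sum_act.induct) (simp_all add: distrib_left)

lemma power_sum_act_uminus: "power_sum_act i (\<lambda>l. - \<phi> l) l = - power_sum_act i \<phi> l"
  using power_sum_act_scale[of i "- 1" \<phi> l] by simp

lemma power_sum_act_diff: "power_sum_act i (\<lambda>l. \<phi> l - \<psi> l) l = power_sum_act i \<phi> l - power_sum_act i \<psi> l"
  using power_sum_act_add[of i \<phi> "\<lambda>l. - \<psi> l" l] by (simp add: power_sum_act_uminus)

lemma power_sum_act_0: "power_sum_act i (\<lambda>l. 0) l = 0"
  using power_sum_act_scale[of i 0 "\<lambda>_. 0" l] by simp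

lemmas power_sum_act_linear = power_sum_act_add power_sum_act_scale power_sum_act_uminus power_sum_act_diff power_sum_act_0

text \<open>A power sum ignores states, and currents touch the exponents only by shifting
  them.\<close>

lemma power_sum_act_rho: "power_sum_act j (rho y i \<phi>) l = rho y i (power_sum_act j \<phi>) l"
proof (induction l arbitrary: \<phi>)
  case (Cons sp l)
  obtain s p where sp: "sp = (s, p)" by (cases sp)
  show ?case
    using Cons[of "\<lambda>l'. \<phi> ((s, p) # l')"] unfolding sp
    by (cases y; cases s) (simp_all add: rho_linear power_sum_act_linear algebra_simps)
qed simp

section \<open>The action of the enveloping algebra\<close>

definition wact :: "word \<Rightarrow> functional \<Rightarrow> functional" where
  "wact w = fold (\<lambda>(y, i). rho y i) (letters w)"

lemma wact_linear:
  "wact w (\<lambda>l. \<phi> l + \<psi> l) = (\<lambda>l. wact w \<phi> l + wact w \<psi> l)"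
  "wact w (\<lambda>l. c * \<phi> l) = (\<lambda>l. c * wact w \<phi> l)"
proof -
  have "fold (\<lambda>(y, i). rho y i) ws (\<lambda>l. \<phi> l + \<psi> l)
      = (\<lambda>l. fold (\<lambda>(y, i). rho y i) ws \<phi> l + fold (\<lambda>(y, i). rho y i) ws \<psi> l)" for ws and \<phi> \<psi> :: functional
    by (induction ws arbitrary: \<phi> \<psi>) (auto simp: rho_add[abs_def])
  then show "wact w (\<lambda>l. \<phi> l + \<psi> l) = (\<lambda>l. wact w \<phi> l + wact w \<psi> l)"
    unfolding wact_def by blast
  have "fold (\<lambda>(y, i). rho y i) ws (\<lambda>l. c * \<phi> l)
      = (\<lambda>l. c * fold (\<lambda>(y, i). rho y i) ws \<phi> l)" for ws and \<phi> :: functional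
    by (induction ws arbitrary: \<phi>) (auto simp: rho_scale[abs_def])
  then show "wact w (\<lambda>l. c * \<phi> l) = (\<lambda>l. c * wact w \<phi> l)"
    unfolding wact_def by blast
qed

lemma wact_plus: "wact (v + w) \<phi> = wact w (wact v \<phi>)"
  by (simp add: wact_def plus_word_def)

definition tact :: "tens \<Rightarrow> functional \<Rightarrow> functional" where
  "tact p \<phi> l = (\<Sum>w\<in>Poly_Mapping.keys p. Poly_Mapping.lookup p w * wact w \<phi> l)"

lemma tact_single: "tact (Poly_Mapping.single w c) \<phi> l = c * wact w \<phi> l"
  by (cases "c = 0") (simp_all add: tact_def)

lemma tact_add: "tact (p + q) \<phi> l = tact p \<phi> l + tact q \<phi> l"
  unfolding tact_def by (rule setsum_keys_plus_distrib) (simp_all add: algebra_simps)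

lemma tact_0: "tact 0 \<phi> l = 0"
  by (simp add: tact_def)

lemma tact_uminus: "tact (- p) \<phi> l = - tact p \<phi> l"
  using tact_add[of p "- p" \<phi> l] by (simp add: tact_0 add_eq_0_iff)

lemma tact_diff: "tact (p - q) \<phi> l = tact p \<phi> l - tact q \<phi> l"
  using tact_add[of p "- q" \<phi> l] by (simp add: tact_uminus)

lemma tact_sum: "tact (sum f A) \<phi> l = (\<Sum>x\<in>A. tact (f x) \<phi> l)"
  by (induction A rule: infinite_finite_induct) (simp_all add: tact_0 tact_add)

lemma tact_linear:
  "tact p (\<lambda>l. \<phi> l + \<psi> l) = (\<lambda>l. tact p \<phi> l + tact p \<psi> l)"
  "tact p (\<lambda>l. c * \<phi> l) = (\<lambda>l. c * tact p \<phi> l)"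
  unfolding tact_def[abs_def] wact_linear
  by (simp_all add: algebra_simps sum.distrib sum_distrib_left)

lemma tact_mult: "tact (p * q) \<phi> = tact q (tact p \<phi>)"
proof (induction p rule: poly_mapping_induct_single)
  case (single v c)
  show ?case
  proof (induction q rule: poly_mapping_induct_single)
    case (single w d)
    show ?case
      by (rule ext) (simp add: mult_single tact_single[abs_def] wact_plus wact_linear algebra_simps)
  next
    case (add p q)
    then show ?case by (auto simp: distrib_left tact_add)
  qed
next
  case (add p p')
  then show ?case
    by (simp add: distrib_right tact_add[abs_def] tact_linear)
qed

lemma tact_gen: "tact (tens_gen y i) \<phi> = rho y i \<phi>"
  by (rule ext) (simp add: tens_gen_def tact_single wact_def)

lemma tact_scalar: "tact (tens_scalar c) \<phi> l = c * \<phi> l"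
  by (simp add: tens_scalar_def tact_single wact_def zero_word_def)

lemma tact_1: "tact 1 \<phi> = \<phi>"
  using tact_scalar[of 1 \<phi>] by (simp add: tens_scalar_def fun_eq_iff)

lemma tact_lin: "tact (tens_lin v i) \<phi> l = rho_lin v i \<phi> l"
  by (simp add: tens_lin_def tact_sum tact_mult tact_gen tact_scalar[abs_def] rho_scale rho_lin_def)

lemma tact_relations:
  assumes "p \<in> two_sided_ideal env_relations" shows "tact p \<phi> l = 0"
  using assms
proof (induction arbitrary: \<phi> l)
  case (base r)
  then obtain x y i j where r: "r = tens_gen x i * tens_gen y j - super_sign x y * tens_gen y j * tens_gen x i
      - tens_lin (osp_bracket x y) (i + j)"
    by (auto simp: env_relations_def)
  have "tact (super_sign x y * tens_gen y j * tens_gen x i) \<phi> l = super_sign x y * rho x i (rho y j \<phi>) l"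
    by (auto simp: super_sign_def tact_mult tact_gen tact_uminus[abs_def] tact_1 rho_uminus[abs_def] rho_uminus)
  then show ?case
    using rho_commutator[of y j x i \<phi> l] by (simp add: r tact_diff tact_lin tact_mult tact_gen)
next
  case (rmult x a)
  then have "tact x \<phi> = (\<lambda>_. 0)" for \<phi> by blast
  then show ?case
    using tact_linear(2)[of a 0 "\<lambda>_. 0"] by (simp add: tact_mult)
qed (simp_all add: tact_0 tact_add tact_mult)

lift_definition uact :: "uosp \<Rightarrow> functional \<Rightarrow> functional" is tact
proof -
  fix p q assume "env_rel p q"
  then have "tact (p - q) \<phi> l = 0" for \<phi> l
    unfolding env_rel_def by (rule tact_relations)
  then show "tact p = tact q"
    by (intro ext) (simp add: tact_diff)
qed

lemma uact_add: "uact (u + v) \<phi> l = uact u \<phi> l + uact v \<phi> l"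
  by transfer (rule tact_add)
lemma uact_0: "uact 0 \<phi> l = 0"
  by transfer (rule tact_0)
lemma uact_mult: "uact (u * v) \<phi> = uact v (uact u \<phi>)"
  by transfer (rule tact_mult)
lemma uact_cur: "uact (cur y i) \<phi> = rho y i \<phi>"
  by transfer (rule tact_gen)
lemma uact_scalar: "uact (uosp_scalar c) \<phi> l = c * \<phi> l"
  by transfer (rule tact_scalar)
lemma uact_scale: "uact (uosp_scalar c * u) \<phi> l = c * uact u \<phi> l"
  by (metis uact_mult uact_scalar uosp_scalar_comm)
lemma uact_1: "uact 1 \<phi> = \<phi>"
  using uact_scalar[of 1] by (simp add: uosp_scalar_1 fun_eq_iff)
lemma uact_sum: "uact (sum f A) \<phi> l = (\<Sum>x\<in>A. uact (f x) \<phi> l)"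
  by (induction A rule: infinite_finite_induct) (simp_all add: uact_0 uact_add)

text \<open>Such a functional lives on the tensor power with the polynomials in x_1, ..., x_n
  replaced by the coinvariant algebra of the symmetric group.\<close>

definition coinvariant :: "functional \<Rightarrow> bool" where
  "coinvariant \<phi> \<longleftrightarrow> (\<forall>i\<ge>1. \<forall>l. power_sum_act i \<phi> l = 0)"

lemma coinvariant_uact: "coinvariant \<phi> \<Longrightarrow> coinvariant (uact u \<phi>)"
proof (induction u arbitrary: \<phi> rule: uosp_induct)
  case (add u v)
  then show ?case
    by (simp add: coinvariant_def uact_add[abs_def] power_sum_act_add)
next
  case (scalar c u)
  then show ?case
    by (simp add: coinvariant_def uact_scale[abs_def] power_sum_act_scale)
next
  case (cur y i u)
  have "coinvariant (rho y i \<phi>)"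
    using cur.prems rho_0 unfolding coinvariant_def power_sum_act_rho
    by (metis (no_types, lifting) ext)
  then show ?case
    using cur.IH by (simp add: uact_mult uact_cur)
qed (simp add: uact_1)

section \<open>The Weyl relations on the tensor power of the generator\<close>

definition vacuum :: "nat \<Rightarrow> (st \<times> nat) list" where
  "vacuum n = replicate n (StW, 0)"

text \<open>The third equation makes h_i with i \<ge> 1 vanish under coinvariant functionals and
  gives the weight -n for i = 0.\<close>

lemma rho_vacuum:
  assumes "\<forall>x\<in>set l. fst x = StW"
  shows "rho osp_f i \<phi> l = 0" "rho osp_gm i \<phi> l = 0" "rho osp_h i \<phi> l = - power_sum_act i \<phi> l"
  using assms by (induction l arbitrary: \<phi>) auto

lemma power_sum_act_zero: "power_sum_act 0 \<phi> l = of_nat (length l) * \<phi> l"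
  by (induction "0::nat" \<phi> l rule: power_sum_act.induct) (simp_all add: algebra_simps)

abbreviation countW :: "(st \<times> nat) list \<Rightarrow> nat" where
  "countW l \<equiv> length (filter (\<lambda>x. fst x = StW) l)"

lemma rho_e_eq_0:
  "(\<And>l'. Suc (countW l') = countW l \<Longrightarrow> \<phi> l' = 0) \<Longrightarrow> rho osp_e i \<phi> l = 0"
proof (induction l arbitrary: \<phi>)
  case (Cons sp l)
  obtain s p where sp: "sp = (s, p)" by (cases sp)
  have "rho osp_e i (\<lambda>l'. \<phi> ((s, p) # l')) l = 0"
    by (rule Cons.IH) (use Cons.prems sp in auto)
  with Cons.prems sp show ?case by (cases s) auto
qed simp

text \<open>Every e uses up a factor in state \<open>StW\<close>.\<close>

lemma e_power_eq_0: "countW l < k \<Longrightarrow> uact (gE 0 ^ k) \<phi> l = 0"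
proof (induction k arbitrary: l)
  case (Suc k)
  then show ?case
    unfolding power_Suc2 uact_mult uact_cur by (intro rho_e_eq_0) auto
qed simp

text \<open>Left multiplication inside the ideal replaces \<phi> by another coinvariant functional,
  so the induction runs over all \<phi> at once.\<close>

lemma weyl_ideal_kills:
  assumes "u \<in> weyl_ideal n" "coinvariant \<phi>" shows "uact u \<phi> (vacuum n) = 0"
  using assms unfolding weyl_ideal_def
proof (induction arbitrary: \<phi> rule: left_ideal.induct)
  case (base r)
  have W: "\<forall>x\<in>set (vacuum n). fst x = StW"
    by (simp add: vacuum_def)
  have n: "uact (of_nat n) \<phi> (vacuum n) = of_nat n * \<phi> (vacuum n)"
    using uact_scalar[of "of_nat n"] by (simp add: uosp_scalar_of_nat)
  have "countW (vacuum n) = n"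
    by (simp add: vacuum_def)
  then have "uact (gE 0 ^ (n + 1)) \<phi> (vacuum n) = 0"
    by (intro e_power_eq_0) simp
  with base rho_vacuum[OF W] n show ?case
    by (auto simp: weyl_relations_def uact_cur uact_add power_sum_act_zero coinvariant_def vacuum_def)
qed (simp_all add: uact_0 uact_add uact_mult coinvariant_uact)

section \<open>The sign of a list\<close>

definition order_sgn :: "nat \<Rightarrow> nat \<Rightarrow> int" where
  "order_sgn x y = sgn (int y - int x)"

text \<open>The sign of the Vandermonde product, zero on repeated entries. The entries need not be
  consecutive, so it serves both for permutations and for the exponents of the g+.\<close>

fun list_sgn :: "nat list \<Rightarrow> int" where
  "list_sgn [] = 1"
| "list_sgn (x # xs) = prod_list (map (order_sgn x) xs) * list_sgn xs"

lemma order_sgn_swap: "order_sgn y x = - order_sgn x y"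
  by (simp add: order_sgn_def sgn_if)

lemma list_sgn_append: "list_sgn (xs @ ys) = list_sgn xs * list_sgn ys * prod_list (map (\<lambda>x. prod_list (map (order_sgn x) ys)) xs)"
  by (induction xs) (simp_all add: algebra_simps)

lemma list_sgn_move: "list_sgn (u @ x # m @ v) = (- 1) ^ length m * list_sgn (u @ m @ x # v)"
proof (induction m arbitrary: u)
  case (Cons y m)
  have "list_sgn (u @ x # y # m @ v) = - list_sgn (u @ y # x # m @ v)"
  proof -
    have "list_sgn (x # y # m @ v) = - list_sgn (y # x # m @ v)"
      by (simp add: order_sgn_swap[of x y])
    moreover have "prod_list (map (\<lambda>z. prod_list (map (order_sgn z) (x # y # m @ v))) u)
        = prod_list (map (\<lambda>z. prod_list (map (order_sgn z) (y # x # m @ v))) u)"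
      by (simp add: ac_simps)
    ultimately show ?thesis
      unfolding list_sgn_append by simp
  qed
  with Cons[of "u @ [y]"] show ?case by simp
qed simp

text \<open>Both long moves across \<open>m\<close> contribute the same power of -1, and one
  adjacent exchange remains.\<close>

lemma list_sgn_swap: "list_sgn (u @ x # m @ z # v) = - list_sgn (u @ z # m @ x # v)"
proof -
  have "list_sgn (u @ m @ x # z # v) = - list_sgn (u @ m @ z # x # v)"
    using list_sgn_move[of "u @ m" x "[z]" v] by simp
  then show ?thesis
    by (simp add: list_sgn_move[of u x m] list_sgn_move[of u z m])
qed

lemma list_update_two:
  assumes "a < b" "b < length l"
  obtains u m w where "\<And>x z. l[a := x, b := z] = u @ x # m @ z # w"
proof -
  define u where "u = take a l"
  define m where "m = take (b - Suc a) (drop (Suc a) l)"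
  define w where "w = drop (Suc b) l"
  have "l = u @ l ! a # drop (Suc a) l"
    using assms by (simp add: u_def id_take_nth_drop)
  moreover have "drop (Suc a) l = m @ l ! b # w"
    using assms id_take_nth_drop[of "b - Suc a" "drop (Suc a) l"] by (simp add: m_def w_def)
  ultimately have l: "l = u @ l ! a # m @ l ! b # w" by simp
  have len: "a = length u" "b = length u + Suc (length m)"
    using assms by (simp_all add: u_def m_def)
  have "(u @ p # m @ q # w)[a := x, b := z] = u @ x # m @ z # w" for p q x z
    unfolding len by (simp add: list_update_append)
  from this[of "l ! a" "l ! b"] have "l[a := x, b := z] = u @ x # m @ z # w" for x z
    unfolding l[symmetric] .
  with that show ?thesis .
qed

lemma list_sgn_update_swap:
  assumes "a \<noteq> b" "a < length l" "b < length l"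
  shows "list_sgn (l[a := x, b := z]) = - list_sgn (l[a := z, b := x])"
proof (cases "a < b")
  case True
  obtain u m w where "\<And>x z. l[a := x, b := z] = u @ x # m @ z # w"
    by (rule list_update_two[of a b l]) (use True assms in auto)
  then show ?thesis by (simp only: list_sgn_swap[of u x m z w])
next
  case False
  obtain u m w where "\<And>x z. l[b := x, a := z] = u @ x # m @ z # w"
    by (rule list_update_two[of b a l]) (use False assms in auto)
  then show ?thesis
    by (simp only: list_update_swap[OF assms(1), of l] list_sgn_swap[of u z m x w])
qed

definition perm_sgn :: "nat list \<Rightarrow> int" where
  "perm_sgn y = (if mset y = mset [0..<length y] then list_sgn y else 0)"

text \<open>If raising the \<open>j\<close>-th entry \<open>v\<close> by \<open>i\<close> produces a permutation, then \<open>v\<close> occurs at exactly one other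
  position, and raising that entry produces the transposed permutation.\<close>

lemma sum_perm_sgn_raise:
  assumes "i \<ge> 1"
  shows "(\<Sum>j<length y. perm_sgn (y[j := y ! j + i])) = 0"
proof (cases "\<exists>j<length y. mset (y[j := y ! j + i]) = mset [0..<length y]")
  case False
  then show ?thesis by (simp add: perm_sgn_def)
next
  case True
  then obtain j where j: "j < length y" and m: "mset (y[j := y ! j + i]) = mset [0..<length y]" by blast
  define v where "v = y ! j"
  have "v + i \<in> set (y[j := y ! j + i])"
    unfolding v_def using j by (rule set_update_memI)
  then have "v < length y"
    using m by (metis add_lessD1 atLeastLessThan_iff mset_eq_setD set_upt)
  then have "v \<in> set (y[j := y ! j + i])"
    using m by (metis atLeastLessThan_iff le0 mset_eq_setD set_upt)
  then obtain k where k: "k < length y" "y[j := y ! j + i] ! k = v"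
    by (metis in_set_conv_nth length_list_update)
  with assms j have kj: "k \<noteq> j" by (auto simp: v_def)
  with k have yk: "y ! k = v" by simp
  have jk: "y[j := y ! j + i] = y[j := v + i, k := v]" "y[k := y ! k + i] = y[j := v, k := v + i]"
    using kj yk v_def by (metis list_update_id list_update_swap)+
  have "mset (y[j := v, k := v + i]) = mset (y[j := v + i, k := v])"
    using mset_swap[of j "y[j := v + i, k := v]" k] j k kj
    by (simp add: list_update_swap[of k j] nth_list_update)
  then have "perm_sgn (y[j := y ! j + i]) + perm_sgn (y[k := y ! k + i]) = 0"
    using list_sgn_update_swap[of j k y "v + i" v] j k kj unfolding jk perm_sgn_def by simp
  \<comment> \<open>Positions j and k both hold v, and raising a third entry keeps that
    repetition.\<close>
  moreover have "perm_sgn (y[x := y ! x + i]) = 0" if "x \<noteq> j" "x \<noteq> k" "x < length y" for x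
  proof -
    have "\<not> distinct (y[x := y ! x + i])"
      using that j k kj yk v_def unfolding distinct_conv_nth
      by (intro notI) (metis length_list_update nth_list_update_neq)
    then have "mset (y[x := y ! x + i]) \<noteq> mset [0..<length y]"
      by (metis distinct_upt mset_eq_imp_distinct_iff)
    then show ?thesis by (simp add: perm_sgn_def)
  qed
  moreover have "(\<Sum>x<length y. perm_sgn (y[x := y ! x + i])) = (\<Sum>x\<in>{j, k}. perm_sgn (y[x := y ! x + i]))"
    by (rule sum.mono_neutral_right) (use j k calculation(2) in auto)
  ultimately show ?thesis using kj by simp
qed

lemma list_sgn_sorted: "sorted_wrt (<) xs \<Longrightarrow> list_sgn xs = 1"
proof (induction xs)
  case (Cons x xs)
  have "map (order_sgn x) xs = map (\<lambda>_. 1) xs"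
    using Cons.prems by (intro map_cong) (auto simp: order_sgn_def)
  with Cons show ?case by (simp add: map_replicate_const)
qed simp

lemma list_sgn_append_less:
  assumes "\<forall>x\<in>set xs. \<forall>y\<in>set ys. x < y"
  shows "list_sgn (xs @ ys) = list_sgn xs * list_sgn ys"
proof -
  have "prod_list (map (order_sgn x) ys) = 1" if "x \<in> set xs" for x
  proof -
    have "map (order_sgn x) ys = map (\<lambda>_. 1) ys"
      using assms that by (intro map_cong) (auto simp: order_sgn_def)
    then show ?thesis by (simp add: map_replicate_const)
  qed
  then have "map (\<lambda>x. prod_list (map (order_sgn x) ys)) xs = map (\<lambda>_. 1) xs"
    by (intro map_cong) auto
  then show ?thesis by (simp add: list_sgn_append map_replicate_const)
qed

text \<open>The power of -1 equals the Koszul sign of \<open>rho osp_gp\<close> acting behind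
  \<open>u\<close>; the two cancel in \<open>signed_value\<close>.\<close>

lemma list_sgn_insert:
  assumes "\<forall>x\<in>set u \<union> set v. b < x"
  shows "list_sgn (u @ b # v) = (- 1) ^ length u * list_sgn (u @ v)"
proof -
  have "map (order_sgn b) (u @ v) = map (\<lambda>_. 1) (u @ v)"
    using assms by (intro map_cong) (auto simp: order_sgn_def)
  then have "prod_list (map (order_sgn b) (u @ v)) = 1"
    by (simp only: map_replicate_const prod_list_replicate power_one)
  then have "list_sgn (u @ v) = list_sgn (b # u @ v)"
    by (simp only: list_sgn.simps mult_1)
  also have "\<dots> = (- 1) ^ length u * list_sgn (u @ b # v)"
    using list_sgn_move[of "[]" b u v] by (simp only: append_Nil)
  finally show ?thesis
    by (simp flip: power_add mult.assoc)
qed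

lemma list_sgn_cong:
  assumes "\<And>z z'. z \<in> set zs \<Longrightarrow> z' \<in> set zs \<Longrightarrow> order_sgn (f z) (f z') = order_sgn (g z) (g z')"
  shows "list_sgn (map f zs) = list_sgn (map g zs)"
  using assms
proof (induction zs)
  case (Cons z zs)
  have "map (\<lambda>z'. order_sgn (f z) (f z')) zs = map (\<lambda>z'. order_sgn (g z) (g z')) zs"
    using Cons.prems by (intro map_cong) auto
  then have "prod_list (map (\<lambda>z'. order_sgn (f z) (f z')) zs) = prod_list (map (\<lambda>z'. order_sgn (g z) (g z')) zs)"
    by (rule arg_cong)
  moreover have "list_sgn (map f zs) = list_sgn (map g zs)"
    by (rule Cons.IH) (use Cons.prems in auto)
  ultimately show ?case by (simp only: list.map list_sgn.simps map_map comp_def)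
qed simp

section \<open>Evaluating monomials at the vacuum\<close>

lemma rho_e_sum:
  "rho osp_e i \<phi> l = (\<Sum>j<length l. if fst (l ! j) = StW then \<phi> (l[j := (StE, snd (l ! j) + i)]) else 0)"
proof (induction l arbitrary: \<phi>)
  case (Cons sp l)
  obtain s p where "sp = (s, p)" by (cases sp)
  then show ?case
    by (cases s) (simp_all add: sum.lessThan_Suc_shift Cons del: sum.lessThan_Suc cong: if_cong)
qed simp

definition gvals :: "(st \<times> nat) list \<Rightarrow> nat list" where
  "gvals l = map snd (filter (\<lambda>x. fst x = StG) l)"
definition evals :: "(st \<times> nat) list \<Rightarrow> nat multiset" where
  "evals l = image_mset snd (filter_mset (\<lambda>x. fst x = StE) (mset l))"

lemma gvals_Cons: "gvals (x # l) = (if fst x = StG then snd x # gvals l else gvals l)"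
  by (simp add: gvals_def)
lemma gvals_append: "gvals (l @ l') = gvals l @ gvals l'"
  by (simp add: gvals_def)

lemma rho_gp_sum:
  "rho osp_gp i \<phi> l = (\<Sum>j<length l. (- 1) ^ length (gvals (take j l)) *
    (case fst (l ! j) of StW \<Rightarrow> \<phi> (l[j := (StG, snd (l ! j) + i)]) | StG \<Rightarrow> \<phi> (l[j := (StE, snd (l ! j) + i)]) | StE \<Rightarrow> 0))"
proof (induction l arbitrary: \<phi>)
  case (Cons sp l)
  obtain s p where "sp = (s, p)" by (cases sp)
  then show ?case
    by (cases s)
      (simp_all add: sum.lessThan_Suc_shift Cons gvals_Cons gvals_def[of "[]"] sum_negf
        del: sum.lessThan_Suc cong: st.case_cong)
qed simp

lemma power_sum_act_sum: "power_sum_act i \<phi> l = (\<Sum>j<length l. \<phi> (l[j := (fst (l ! j), snd (l ! j) + i)]))"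
proof (induction l arbitrary: \<phi>)
  case (Cons sp l)
  show ?case
    by (cases sp) (simp add: sum.lessThan_Suc_shift Cons del: sum.lessThan_Suc)
qed simp

text \<open>The outcomes of placing the g+_b, b in \<open>B\<close>, and the e_a, a in
  \<open>A\<close>, on distinct factors of the vacuum.\<close>

definition spread_states :: "nat \<Rightarrow> nat multiset \<Rightarrow> nat multiset \<Rightarrow> (st \<times> nat) list set" where
  "spread_states n B A = {l. length l = n \<and> mset (gvals l) = B \<and> evals l = A \<and> (\<forall>x\<in>set l. fst x = StW \<longrightarrow> snd x = 0)}"

lemma list_split_nth:
  assumes "j < length l"
  shows "l = take j l @ l ! j # drop (Suc j) l" "l[j := x] = take j l @ x # drop (Suc j) l"
  using assms by (simp_all add: id_take_nth_drop upd_conv_take_nth_drop)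

lemma gvals_upd:
  assumes "j < length l"
  shows "gvals l = gvals (take j l) @ gvals [l ! j] @ gvals (drop (Suc j) l)"
    and "gvals (l[j := x]) = gvals (take j l) @ gvals [x] @ gvals (drop (Suc j) l)"
  using list_split_nth[OF assms] gvals_append by (metis append_Cons append_Nil)+

lemma evals_upd:
  assumes "j < length l"
  shows "evals l = evals [l ! j] + (evals (take j l) + evals (drop (Suc j) l))"
    and "evals (l[j := x]) = evals [x] + (evals (take j l) + evals (drop (Suc j) l))"
proof -
  have "evals (u @ y # v) = evals [y] + (evals u + evals v)" for u v y
    by (simp add: evals_def)
  then show "evals l = evals [l ! j] + (evals (take j l) + evals (drop (Suc j) l))"
    "evals (l[j := x]) = evals [x] + (evals (take j l) + evals (drop (Suc j) l))"
    using list_split_nth[OF assms] by metis+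
qed

lemma set_upd:
  assumes "j < length l"
  shows "set l = insert (l ! j) (set (take j l) \<union> set (drop (Suc j) l))"
    and "set (l[j := x]) = insert x (set (take j l) \<union> set (drop (Suc j) l))"
proof -
  have "set (u @ y # v) = insert y (set u \<union> set v)" for u v and y :: 'a by auto
  then show "set l = insert (l ! j) (set (take j l) \<union> set (drop (Suc j) l))"
    "set (l[j := x]) = insert x (set (take j l) \<union> set (drop (Suc j) l))"
    using list_split_nth[OF assms] by metis+
qed

lemma vals_single:
  "gvals [(StW, p)] = []" "gvals [(StG, p)] = [p]" "gvals [(StE, p)] = []"
  "evals [(StW, p)] = {#}" "evals [(StG, p)] = {#}" "evals [(StE, p)] = {#p#}"
  by (simp_all add: gvals_def evals_def)

text \<open>Removes the Koszul sign of an arrangement of the g+, so that all arrangements of one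
  monomial are compared on the same scale.\<close>

definition signed_value :: "functional \<Rightarrow> functional" where
  "signed_value \<phi> l = \<phi> l * of_int (list_sgn (gvals l))"

text \<open>A functional that is bounded in this sense only sees those ways of applying \<open>e\<close>'s and \<open>g\<^sup>+\<close>'s to the
  vacuum in which no two of them hit the same tensor factor.\<close>

definition bounded_functional :: "complex set \<Rightarrow> functional \<Rightarrow> nat \<Rightarrow> nat multiset \<Rightarrow> nat multiset \<Rightarrow> bool" where
  "bounded_functional R \<phi> n B A \<longleftrightarrow>
    (\<forall>l. length (gvals l) < size B \<longrightarrow> \<phi> l = 0) \<and> (\<forall>l\<in>spread_states n B A. signed_value \<phi> l \<in> R)"

definition positive_functional :: "functional \<Rightarrow> nat \<Rightarrow> nat multiset \<Rightarrow> nat multiset \<Rightarrow> bool" where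
  "positive_functional \<phi> n B A \<longleftrightarrow> bounded_functional {0..} \<phi> n B A \<and> (\<exists>l\<in>spread_states n B A. 0 < signed_value \<phi> l)"

text \<open>Used for \<open>{0..}\<close> on the diagonal of the pairing and for \<open>{0}\<close>
  off it, so that one argument serves both.\<close>

definition sum_closed :: "complex set \<Rightarrow> bool" where
  "sum_closed R \<longleftrightarrow> 0 \<in> R \<and> (\<forall>x\<in>R. \<forall>y\<in>R. x + y \<in> R)"

lemma sum_closed_sum: "sum_closed R \<Longrightarrow> (\<And>x. x \<in> A \<Longrightarrow> f x \<in> R) \<Longrightarrow> sum f A \<in> R"
  by (induction A rule: infinite_finite_induct) (auto simp: sum_closed_def)

lemma full_upd_E:
  assumes "l \<in> spread_states n B A" "j < length l" "fst (l ! j) = StW"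
  shows "l[j := (StE, snd (l ! j) + a)] \<in> spread_states n B (add_mset a A)"
    and "gvals (l[j := (StE, snd (l ! j) + a)]) = gvals l"
proof -
  obtain p where p: "l ! j = (StW, p)" using assms(3) by (cases "l ! j") auto
  have "p = 0"
    using assms p nth_mem[OF assms(2)] by (force simp: spread_states_def)
  with p assms show "l[j := (StE, snd (l ! j) + a)] \<in> spread_states n B (add_mset a A)"
    "gvals (l[j := (StE, snd (l ! j) + a)]) = gvals l"
    using gvals_upd[OF assms(2)] evals_upd[OF assms(2)] set_upd[OF assms(2)]
    by (auto simp: spread_states_def vals_single)
qed

lemma signed_value_rho_e:
  assumes "l \<in> spread_states n B A"
  shows "signed_value (rho osp_e a \<phi>) l
    = (\<Sum>j<length l. if fst (l ! j) = StW then signed_value \<phi> (l[j := (StE, snd (l ! j) + a)]) else 0)"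
  unfolding signed_value_def rho_e_sum sum_distrib_right
  by (rule sum.cong) (auto simp: full_upd_E(2)[OF assms])

text \<open>Indices are stripped from the functional: what \<phi> satisfies with \<open>a\<close>
  placed, its transform satisfies without it.\<close>

lemma bounded_rho_e:
  assumes R: "sum_closed R" and \<phi>: "bounded_functional R \<phi> n B (add_mset a A)"
  shows "bounded_functional R (rho osp_e a \<phi>) n B A"
  unfolding bounded_functional_def
proof (intro conjI allI impI ballI)
  fix l assume l: "length (gvals l) < size B"
  have "gvals (l[j := (StE, p)]) = gvals l" if "j < length l" "fst (l ! j) = StW" for j p
    using gvals_upd[OF that(1)] that(2) by (cases "l ! j") (simp add: vals_single)
  with l \<phi> show "rho osp_e a \<phi> l = 0"
    unfolding rho_e_sum by (intro sum.neutral) (auto simp: bounded_functional_def)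
next
  fix l assume "l \<in> spread_states n B A"
  then show "signed_value (rho osp_e a \<phi>) l \<in> R"
    using \<phi> R full_upd_E(1) unfolding signed_value_rho_e[OF \<open>l \<in> spread_states n B A\<close>]
    by (intro sum_closed_sum) (auto simp: bounded_functional_def sum_closed_def)
qed

lemma sum_closed_nonneg: "sum_closed {0..}"
  by (auto simp: sum_closed_def)
lemma sum_closed_zero: "sum_closed {0}"
  by (auto simp: sum_closed_def)

lemma sum_pos_term:
  fixes f :: "'a \<Rightarrow> complex"
  assumes "finite A" "x \<in> A" "0 < f x" "\<And>y. y \<in> A \<Longrightarrow> 0 \<le> f y"
  shows "0 < sum f A"
proof -
  have "f x \<le> sum f A"
    using assms member_le_sum[of x A f] by auto
  with assms(3) show ?thesis by (rule less_le_trans)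
qed

lemma positive_rho_e:
  assumes "positive_functional \<phi> n B (add_mset a A)"
  shows "positive_functional (rho osp_e a \<phi>) n B A"
  unfolding positive_functional_def
proof
  have b: "bounded_functional {0..} \<phi> n B (add_mset a A)"
    using assms by (simp add: positive_functional_def)
  then show "bounded_functional {0..} (rho osp_e a \<phi>) n B A"
    by (rule bounded_rho_e[OF sum_closed_nonneg])
  obtain l where l: "l \<in> spread_states n B (add_mset a A)" "0 < signed_value \<phi> l"
    using assms by (auto simp: positive_functional_def)
  have "a \<in># evals l" using l by (simp add: spread_states_def)
  then have "(StE, a) \<in> set l" by (auto simp: evals_def)
  then obtain j where j: "j < length l" "l ! j = (StE, a)" by (metis in_set_conv_nth)
  \<comment> \<open>Undoing one placement of e_a gives a state at which the transformed functional
    has the value at l among its summands.\<close>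
  define l' where "l' = l[j := (StW, 0)]"
  have j': "j < length l'" "l' ! j = (StW, 0)" "l = l'[j := (StE, snd (l' ! j) + a)]"
    using j by (simp_all add: l'_def) (metis list_update_id)
  have l': "l' \<in> spread_states n B A"
    using l(1) j(2) gvals_upd[OF j(1)] evals_upd[OF j(1)] set_upd[OF j(1)]
    by (auto simp: spread_states_def vals_single l'_def)
  have "0 < signed_value (rho osp_e a \<phi>) l'"
    unfolding signed_value_rho_e[OF l']
  proof (rule sum_pos_term)
    show "j \<in> {..<length l'}" using j' by simp
    show "0 < (if fst (l' ! j) = StW then signed_value \<phi> (l'[j := (StE, snd (l' ! j) + a)]) else 0)"
      using l(2) j' by simp
    show "0 \<le> (if fst (l' ! i) = StW then signed_value \<phi> (l'[i := (StE, snd (l' ! i) + a)]) else 0)"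
      if "i \<in> {..<length l'}" for i
      using b full_upd_E(1)[OF l', of i] that by (auto simp: bounded_functional_def)
  qed simp
  with l' show "\<exists>l\<in>spread_states n B A. 0 < signed_value (rho osp_e a \<phi>) l" by blast
qed

text \<open>The g+ are stripped smallest index first, so b lies below all other placed indices and
  \<open>list_sgn_insert\<close> applies.\<close>

lemma full_upd_G:
  assumes "l \<in> spread_states n B {#}" "j < length l" "fst (l ! j) = StW" "\<forall>x\<in>#B. b < x"
  shows "l[j := (StG, snd (l ! j) + b)] \<in> spread_states n (add_mset b B) {#}"
    and "list_sgn (gvals (l[j := (StG, snd (l ! j) + b)])) = (- 1) ^ length (gvals (take j l)) * list_sgn (gvals l)"
proof -
  obtain p where p: "l ! j = (StW, p)" using assms(3) by (cases "l ! j") auto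
  have [simp]: "p = 0"
    using assms p nth_mem[OF assms(2)] by (force simp: spread_states_def)
  show "l[j := (StG, snd (l ! j) + b)] \<in> spread_states n (add_mset b B) {#}"
    using p assms(1) gvals_upd[OF assms(2)] evals_upd[OF assms(2)] set_upd[OF assms(2)]
    by (auto simp: spread_states_def vals_single)
  have g: "gvals l = gvals (take j l) @ gvals (drop (Suc j) l)"
    using gvals_upd(1)[OF assms(2)] p by (simp add: vals_single)
  have "set (gvals l) = set_mset B"
    using assms(1) by (auto simp: spread_states_def)
  then have "\<forall>x\<in>set (gvals (take j l)) \<union> set (gvals (drop (Suc j) l)). b < x"
    using assms(4) g by auto
  from list_sgn_insert[OF this] show
    "list_sgn (gvals (l[j := (StG, snd (l ! j) + b)])) = (- 1) ^ length (gvals (take j l)) * list_sgn (gvals l)"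
    unfolding gvals_upd(2)[OF assms(2)] g using p by (simp add: vals_single)
qed

text \<open>The collision of two g+ on one factor yields e there and leaves fewer g+ than \<phi> can
  see.\<close>

lemma gp_term_zero:
  assumes \<phi>: "\<forall>l. length (gvals l) < Suc k \<longrightarrow> \<phi> l = 0"
    and l: "length (gvals l) \<le> k" "j < length l" "fst (l ! j) = StG"
  shows "\<phi> (l[j := (StE, p)]) = 0"
proof -
  obtain q where "l ! j = (StG, q)" using l(3) by (cases "l ! j") auto
  then have "length (gvals (l[j := (StE, p)])) < length (gvals l)"
    using gvals_upd[OF l(2)] by (simp add: vals_single)
  with \<phi> l(1) show ?thesis by simp
qed

lemma signed_value_rho_gp:
  assumes \<phi>: "\<forall>l. length (gvals l) < Suc (size B) \<longrightarrow> \<phi> l = 0"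
    and l: "l \<in> spread_states n B {#}" and b: "\<forall>x\<in>#B. b < x"
  shows "signed_value (rho osp_gp b \<phi>) l
    = (\<Sum>j<length l. if fst (l ! j) = StW then signed_value \<phi> (l[j := (StG, snd (l ! j) + b)]) else 0)"
  unfolding signed_value_def rho_gp_sum sum_distrib_right
proof (rule sum.cong[OF refl])
  fix j assume "j \<in> {..<length l}"
  then have j: "j < length l" by simp
  have "length (gvals l) \<le> size B"
    using l by (auto simp: spread_states_def)
  with gp_term_zero[OF \<phi> _ j] full_upd_G(2)[OF l j _ b]
  show "(- 1) ^ length (gvals (take j l)) *
      (case fst (l ! j) of StW \<Rightarrow> \<phi> (l[j := (StG, snd (l ! j) + b)]) | StG \<Rightarrow> \<phi> (l[j := (StE, snd (l ! j) + b)]) | StE \<Rightarrow> 0)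
      * of_int (list_sgn (gvals l))
    = (if fst (l ! j) = StW then \<phi> (l[j := (StG, snd (l ! j) + b)]) * of_int (list_sgn (gvals (l[j := (StG, snd (l ! j) + b)]))) else 0)"
    by (cases "fst (l ! j)") simp_all
qed

lemma bounded_rho_gp:
  assumes R: "sum_closed R" and \<phi>: "bounded_functional R \<phi> n (add_mset b B) {#}" and b: "\<forall>x\<in>#B. b < x"
  shows "bounded_functional R (rho osp_gp b \<phi>) n B {#}"
  unfolding bounded_functional_def
proof (intro conjI allI impI ballI)
  have \<phi>0: "\<forall>l. length (gvals l) < Suc (size B) \<longrightarrow> \<phi> l = 0"
    using \<phi> by (simp add: bounded_functional_def)
  fix l
  { assume l: "length (gvals l) < size B"
    have "\<phi> (l[j := (StG, p)]) = 0" if j: "j < length l" "fst (l ! j) = StW" for j p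
    proof -
      obtain q where "l ! j = (StW, q)" using j(2) by (cases "l ! j") auto
      then have "length (gvals (l[j := (StG, p)])) = Suc (length (gvals l))"
        using gvals_upd[OF j(1)] by (simp add: vals_single)
      with \<phi>0 l show ?thesis by simp
    qed
    with gp_term_zero[OF \<phi>0, of l] l show "rho osp_gp b \<phi> l = 0"
      unfolding rho_gp_sum by (intro sum.neutral) (auto split: st.split) }
  { assume l: "l \<in> spread_states n B {#}"
    show "signed_value (rho osp_gp b \<phi>) l \<in> R"
      using \<phi> R full_upd_G(1)[OF l _ _ b] unfolding signed_value_rho_gp[OF \<phi>0 l b]
      by (intro sum_closed_sum) (auto simp: bounded_functional_def sum_closed_def) }
qed

lemma positive_rho_gp:
  assumes \<phi>: "positive_functional \<phi> n (add_mset b B) {#}" and b: "\<forall>x\<in>#B. b < x"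
  shows "positive_functional (rho osp_gp b \<phi>) n B {#}"
  unfolding positive_functional_def
proof
  have bd: "bounded_functional {0..} \<phi> n (add_mset b B) {#}"
    using \<phi> by (simp add: positive_functional_def)
  then show "bounded_functional {0..} (rho osp_gp b \<phi>) n B {#}"
    by (rule bounded_rho_gp[OF sum_closed_nonneg _ b])
  have \<phi>0: "\<forall>l. length (gvals l) < Suc (size B) \<longrightarrow> \<phi> l = 0"
    using bd by (simp add: bounded_functional_def)
  obtain l where l: "l \<in> spread_states n (add_mset b B) {#}" "0 < signed_value \<phi> l"
    using \<phi> by (auto simp: positive_functional_def)
  have "b \<in># mset (gvals l)" using l by (simp add: spread_states_def)
  then have "(StG, b) \<in> set l" by (auto simp: gvals_def)
  then obtain j where j: "j < length l" "l ! j = (StG, b)" by (metis in_set_conv_nth)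
  define l' where "l' = l[j := (StW, 0)]"
  have j': "j < length l'" "l' ! j = (StW, 0)" "l = l'[j := (StG, snd (l' ! j) + b)]"
    using j by (simp_all add: l'_def) (metis list_update_id)
  have l': "l' \<in> spread_states n B {#}"
    using l(1) j(2) gvals_upd[OF j(1)] evals_upd[OF j(1)] set_upd[OF j(1)]
    by (auto simp: spread_states_def vals_single l'_def)
  have "0 < signed_value (rho osp_gp b \<phi>) l'"
    unfolding signed_value_rho_gp[OF \<phi>0 l' b]
  proof (rule sum_pos_term)
    show "j \<in> {..<length l'}" using j' by simp
    show "0 < (if fst (l' ! j) = StW then signed_value \<phi> (l'[j := (StG, snd (l' ! j) + b)]) else 0)"
      using l(2) j' by simp
    show "0 \<le> (if fst (l' ! i) = StW then signed_value \<phi> (l'[i := (StG, snd (l' ! i) + b)]) else 0)"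
      if "i \<in> {..<length l'}" for i
      using bd full_upd_G(1)[OF l' _ _ b, of i] that by (auto simp: bounded_functional_def)
  qed simp
  with l' show "\<exists>l\<in>spread_states n B {#}. 0 < signed_value (rho osp_gp b \<phi>) l" by blast
qed

text \<open>The leftmost currents are stripped first: the e's, then the g+ in increasing order. What
  remains is the vacuum, the only spread state without indices.\<close>

lemma uact_mon:
  assumes bs: "sorted_wrt (<) bs"
  shows "sum_closed R \<Longrightarrow> bounded_functional R \<phi> n (mset bs) (mset as) \<Longrightarrow> uact (weyl_mon (as, bs)) \<phi> (vacuum n) \<in> R"
    and "positive_functional \<phi> n (mset bs) (mset as) \<Longrightarrow> 0 < uact (weyl_mon (as, bs)) \<phi> (vacuum n)"
proof -
  have 1: "bounded_functional R (uact (e_mon as) \<phi>) n B {#}"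
    if "sum_closed R" "bounded_functional R \<phi> n B (mset as)" for R \<phi> B
    using that(2) by (induction as arbitrary: \<phi>)
      (auto simp: uact_1 uact_mult uact_cur intro: bounded_rho_e[OF that(1)])
  have 2: "positive_functional (uact (e_mon as) \<phi>) n B {#}"
    if "positive_functional \<phi> n B (mset as)" for \<phi> B
    using that by (induction as arbitrary: \<phi>)
      (auto simp: uact_1 uact_mult uact_cur intro: positive_rho_e)
  have 3: "bounded_functional R (uact (gp_mon bs) \<phi>) n {#} {#}"
    if "sum_closed R" "bounded_functional R \<phi> n (mset bs) {#}" for R \<phi>
    using that(2) bs
  proof (induction bs arbitrary: \<phi>)
    case (Cons b bs)
    then show ?case
      using bounded_rho_gp[OF that(1), of \<phi> n b "mset bs"] by (simp add: uact_mult uact_cur)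
  qed (simp add: uact_1)
  have 4: "positive_functional (uact (gp_mon bs) \<phi>) n {#} {#}"
    if "positive_functional \<phi> n (mset bs) {#}" for \<phi>
    using that bs
  proof (induction bs arbitrary: \<phi>)
    case (Cons b bs)
    then show ?case
      using positive_rho_gp[of \<phi> n b "mset bs"] by (simp add: uact_mult uact_cur)
  qed (simp add: uact_1)
  have full0: "spread_states n {#} {#} = {vacuum n}"
  proof (intro equalityI subsetI)
    fix l assume l: "l \<in> spread_states n {#} {#}"
    then have "gvals l = []" "set_mset (evals l) = {}"
      by (auto simp: spread_states_def)
    then have "x = (StW, 0)" if "x \<in> set l" for x
      using l that by (cases x; cases "fst x") (auto simp: spread_states_def gvals_def evals_def filter_empty_conv)
    with l show "l \<in> {vacuum n}"
      by (auto simp: spread_states_def vacuum_def intro: replicate_eqI)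
  qed (auto simp: spread_states_def vacuum_def gvals_def evals_def)
  have sgnd_vac: "signed_value \<phi> (vacuum n) = \<phi> (vacuum n)" for \<phi>
    by (simp add: signed_value_def vacuum_def gvals_def)
  show "sum_closed R \<Longrightarrow> bounded_functional R \<phi> n (mset bs) (mset as) \<Longrightarrow> uact (weyl_mon (as, bs)) \<phi> (vacuum n) \<in> R"
    using 3[OF _ 1] by (auto simp: bounded_functional_def full0 sgnd_vac weyl_mon_def uact_mult)
  show "positive_functional \<phi> n (mset bs) (mset as) \<Longrightarrow> 0 < uact (weyl_mon (as, bs)) \<phi> (vacuum n)"
    using 4[OF 2] by (auto simp: positive_functional_def full0 sgnd_vac weyl_mon_def uact_mult)
qed

section \<open>Linear independence\<close>

text \<open>Z pairs the first entry b of \<beta> with some y, at most the first and largest entry c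
  of \<gamma>; as b + y \<ge> N, also b + c \<ge> N. Equality forces y = c, and the pair is removed.
  So either \<beta> and \<gamma> are aligned or the first deviation is upward, which is what a
  lexicographic comparison needs.\<close>

lemma greedy_matching:
  assumes "image_mset fst Z = mset \<beta>" "image_mset snd Z = mset \<gamma>"
    and "image_mset (\<lambda>z. fst z + snd z) Z = mset [N..<N + k]"
    and "length \<beta> = k" "length \<gamma> = k" "sorted_wrt (\<ge>) \<gamma>"
  shows "(\<forall>i<k. \<beta> ! i + \<gamma> ! i = N + i) \<and> Z = mset (zip \<beta> \<gamma>)
    \<or> (\<exists>i<k. (\<forall>j<i. \<beta> ! j + \<gamma> ! j = N + j) \<and> N + i < \<beta> ! i + \<gamma> ! i)"
  using assms
proof (induction k arbitrary: N \<beta> \<gamma> Z)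
  case (Suc k)
  obtain b \<beta>' where \<beta>: "\<beta> = b # \<beta>'" using Suc.prems by (cases \<beta>) auto
  obtain c \<gamma>' where \<gamma>: "\<gamma> = c # \<gamma>'" using Suc.prems by (cases \<gamma>) auto
  have "b \<in># image_mset fst Z" using Suc.prems \<beta> by simp
  then obtain y where y: "(b, y) \<in># Z" by auto
  then have "y \<in># image_mset snd Z" by force
  then have "y \<in> set \<gamma>" using Suc.prems by simp
  then have yc: "y \<le> c" using Suc.prems \<gamma> by auto
  have "b + y \<in># image_mset (\<lambda>z. fst z + snd z) Z" using y by force
  then have "b + y \<in># mset [N..<N + Suc k]" using Suc.prems by metis
  then have N: "N \<le> b + y" by (metis atLeastLessThan_iff set_mset_mset set_upt)
  show ?case
  proof (cases "b + c = N")
    case False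
    with N yc have "N < b + c" by simp
    then show ?thesis using \<beta> \<gamma> by (intro disjI2 exI[of _ 0]) simp
  next
    case True
    with N yc have yc: "y = c" by simp
    define Z' where "Z' = Z - {#(b, c)#}"
    have Z: "Z = add_mset (b, c) Z'" using y yc by (simp add: Z'_def)
    have upt: "[N..<N + Suc k] = N # [Suc N..<Suc N + k]"
      by (subst upt_conv_Cons) simp_all
    have sums: "image_mset (\<lambda>z. fst z + snd z) Z' = mset [Suc N..<Suc N + k]"
      using Suc.prems(3) unfolding Z upt
      by (simp only: image_mset_add_mset fst_conv snd_conv True mset.simps add_mset_add_mset_same_iff)
    have "(\<forall>i<k. \<beta>' ! i + \<gamma>' ! i = Suc N + i) \<and> Z' = mset (zip \<beta>' \<gamma>')
      \<or> (\<exists>i<k. (\<forall>j<i. \<beta>' ! j + \<gamma>' ! j = Suc N + j) \<and> Suc N + i < \<beta>' ! i + \<gamma>' ! i)"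
      by (rule Suc.IH[OF _ _ sums]) (use Suc.prems Z \<beta> \<gamma> in auto)
    then show ?thesis
    proof
      assume "(\<forall>i<k. \<beta>' ! i + \<gamma>' ! i = Suc N + i) \<and> Z' = mset (zip \<beta>' \<gamma>')"
      then show ?thesis using Z \<beta> \<gamma> True by (auto simp: less_Suc_eq_0_disj)
    next
      assume "\<exists>i<k. (\<forall>j<i. \<beta>' ! j + \<gamma>' ! j = Suc N + j) \<and> Suc N + i < \<beta>' ! i + \<gamma>' ! i"
      then obtain i where i: "i < k" "\<forall>j<i. \<beta>' ! j + \<gamma>' ! j = Suc N + j" "Suc N + i < \<beta>' ! i + \<gamma>' ! i"
        by blast
      then show ?thesis
        using \<beta> \<gamma> True by (intro disjI2 exI[of _ "Suc i"]) (auto simp: less_Suc_eq_0_disj)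
    qed
  qed
qed simp

text \<open>For the set A of entries and the top interval T, A - T and T - A have equal size, and n
  - \<open>length ys\<close> separates the former from the latter.\<close>

lemma sum_list_top:
  assumes "distinct ys" "set ys \<subseteq> {..<n}"
  shows "sum_list ys \<le> sum_list [n - length ys..<n]"
    and "sum_list ys = sum_list [n - length ys..<n] \<Longrightarrow> mset ys = mset [n - length ys..<n]"
proof -
  define A where "A = set ys"
  define T where "T = {n - length ys..<n}"
  have fin: "finite A" "finite T" by (simp_all add: A_def T_def)
  have cardA: "card A = length ys" using assms(1) by (simp add: A_def distinct_card)
  then have "length ys \<le> n"
    using assms(2) card_mono[of "{..<n}" A] by (simp add: A_def)
  then have cardT: "card T = card A" by (simp add: T_def cardA)
  have sums: "sum_list ys = \<Sum>A" "sum_list [n - length ys..<n] = \<Sum>T"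
    using assms(1) by (simp_all add: A_def T_def distinct_sum_list_conv_Sum)
  have split: "\<Sum>A = \<Sum>(A \<inter> T) + \<Sum>(A - T)" "\<Sum>T = \<Sum>(A \<inter> T) + \<Sum>(T - A)"
    using fin by (metis sum.Int_Diff, metis sum.Int_Diff inf_commute)
  have card: "card (A - T) = card (T - A)"
    using card_Diff_subset_Int[of A T] card_Diff_subset_Int[of T A] fin cardT by (simp add: inf_commute)
  have "\<Sum>(A - T) + card (A - T) \<le> card (A - T) * (n - length ys)"
  proof -
    have "(\<Sum>x\<in>A - T. x + 1) \<le> (\<Sum>x\<in>A - T. n - length ys)"
      using assms(2) by (intro sum_mono) (auto simp: A_def T_def)
    then show ?thesis by (simp only: sum.distrib sum_constant mult_1_right of_nat_id)
  qed
  moreover have "card (T - A) * (n - length ys) \<le> \<Sum>(T - A)"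
    using sum_mono[of "T - A" "\<lambda>_. n - length ys" "\<lambda>x. x"] by (auto simp: T_def)
  ultimately have *: "\<Sum>(A - T) + card (A - T) \<le> \<Sum>(T - A)"
    using card by simp
  then show "sum_list ys \<le> sum_list [n - length ys..<n]"
    using sums split by simp
  assume "sum_list ys = sum_list [n - length ys..<n]"
  with * sums split have "card (A - T) = 0" by simp
  with card fin have "A = T" by auto
  then show "mset ys = mset [n - length ys..<n]"
    using assms(1) by (intro iffD1[OF set_eq_iff_mset_eq_distinct]) (simp_all add: A_def T_def)
qed

lemma strict_nth_diff:
  fixes bs :: "nat list"
  shows "sorted_wrt (<) bs \<Longrightarrow> i \<le> j \<Longrightarrow> j < length bs \<Longrightarrow> bs ! i + (j - i) \<le> bs ! j"
proof (induction "j - i" arbitrary: j)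
  case (Suc d)
  then obtain j' where j': "j = Suc j'" "i \<le> j'" by (cases j) auto
  have "bs ! j' < bs ! j"
    using Suc.prems j' by (auto intro: sorted_wrt_nth_less)
  moreover have "bs ! i + (j' - i) \<le> bs ! j'"
    using Suc j' by auto
  ultimately show ?case using j' by auto
qed simp

lemma strict_nth_bound:
  assumes "sorted_wrt (<) bs" "\<forall>b\<in>set bs. b < n" "i < length bs"
  shows "bs ! i + length bs \<le> n + i"
  using strict_nth_diff[OF assms(1), of i "length bs - 1"] assms(2,3)
    nth_mem[of "length bs - 1" bs] by fastforce

lemma strict_length_bound:
  assumes "sorted_wrt (<) bs" "\<forall>b\<in>set bs. b < n"
  shows "length bs \<le> n"
  using strict_nth_bound[OF assms, of 0] by (cases "bs = []") auto

section \<open>The functionals paired with the basis vectors\<close>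

definition weyl_states :: "nat \<Rightarrow> nat \<Rightarrow> nat \<Rightarrow> st list" where
  "weyl_states n k s = replicate (n - k - s) StW @ replicate s StE @ replicate k StG"

text \<open>On \<open>weyl_index\<close> no difference is truncated: the entries of
  \<open>as\<close> are at most r, and the i-th entry of a strict list is at most n - k + i.
  Reversing \<open>as\<close> makes its block strictly increasing, so that it has no repetitions;
  the block of \<open>bs\<close> is weakly decreasing, as \<open>greedy_matching\<close>
  wants.\<close>

definition weyl_offset :: "nat \<Rightarrow> nat list \<Rightarrow> nat list \<Rightarrow> nat list" where
  "weyl_offset n as bs = (let k = length bs; s = length as; r = n - k - s in
     [0..<r] @ map2 (-) [r..<r + s] (rev as) @ map2 (-) [r + s..<n] bs)"

text \<open>The coefficient extraction \<open>P \<mapsto> \<Sum> sgn(\<sigma>) [x\<^sup>\<sigma>\<^sup>(\<^sup>\<delta>\<^sup>)] x\<^sup>q P\<close>, \<open>\<delta> = (0, \<dots>, n - 1)\<close>, kills all multiples of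
  symmetric polynomials of positive degree. The exponents \<open>q\<close> are chosen such that adding those of the vector
  \<open>(as, bs)\<close>, arranged by state, gives \<open>\<delta>\<close>.\<close>

definition weyl_functional :: "nat \<Rightarrow> nat list \<Rightarrow> nat list \<Rightarrow> functional" where
  "weyl_functional n as bs l = (if map fst l = weyl_states n (length bs) (length as)
     then of_int (perm_sgn (map2 (+) (map snd l) (weyl_offset n as bs))) else 0)"

lemma weyl_indexD:
  assumes "(as, bs) \<in> weyl_index n"
  shows "sorted_wrt (<) bs" "\<forall>b\<in>set bs. b < n" "sorted_wrt (\<le>) as" "length bs + length as \<le> n"
    "\<forall>a\<in>set as. a \<le> n - length bs - length as"
proof -
  show bs: "sorted_wrt (<) bs" "\<forall>b\<in>set bs. b < n" "sorted_wrt (\<le>) as"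
    using assms by (auto simp: weyl_index_def)
  show "\<forall>a\<in>set as. a \<le> n - length bs - length as"
    using assms by (auto simp: weyl_index_def)
  show "length bs + length as \<le> n"
  proof (cases as)
    case Nil
    then show ?thesis using strict_length_bound[OF bs(1,2)] by simp
  next
    case (Cons a as')
    \<comment> \<open>A natural number that is at most n - k - s forces this integer to be
      nonnegative.\<close>
    then show ?thesis using assms by (auto simp: weyl_index_def)
  qed
qed

lemma map2_plus_update:
  "length xs = length q \<Longrightarrow> j < length xs \<Longrightarrow>
    map2 (+) (xs[j := xs ! j + i]) q = (map2 (+) xs q)[j := map2 (+) xs q ! j + i]" for xs q :: "nat list"
  by (rule nth_equalityI) (auto simp: nth_list_update)

lemma coinvariant_weyl_functional:
  assumes "(as, bs) \<in> weyl_index n"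
  shows "coinvariant (weyl_functional n as bs)"
  unfolding coinvariant_def
proof (intro allI impI)
  fix i :: nat and l :: "(st \<times> nat) list" assume i: "1 \<le> i"
  let ?l = "\<lambda>j. l[j := (fst (l ! j), snd (l ! j) + i)]"
  have fst: "map fst (?l j) = map fst l" for j
    using list_update_id[of "map fst l" j] by (cases "j < length l") (simp_all add: map_update not_less list_update_beyond)
  show "power_sum_act i (weyl_functional n as bs) l = 0"
  proof (cases "map fst l = weyl_states n (length bs) (length as)")
    case False
    then show ?thesis by (simp add: power_sum_act_sum weyl_functional_def fst)
  next
    case True
    define y where "y = map2 (+) (map snd l) (weyl_offset n as bs)"
    have len: "length l = n" "length (weyl_offset n as bs) = n"
      using weyl_indexD[OF assms] arg_cong[OF True, of length] by (simp_all add: weyl_states_def weyl_offset_def Let_def)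
    then have y: "length y = length l" by (simp add: y_def)
    have "weyl_functional n as bs (?l j) = of_int (perm_sgn (y[j := y ! j + i]))" if "j < length l" for j
    proof -
      have "map snd (?l j) = (map snd l)[j := map snd l ! j + i]"
        using that by (simp add: map_update)
      then have "map2 (+) (map snd (?l j)) (weyl_offset n as bs) = y[j := y ! j + i]"
        using map2_plus_update[of "map snd l" "weyl_offset n as bs" j i] that len by (simp only: y_def length_map)
      then show ?thesis
        by (simp only: weyl_functional_def fst True if_True simp_thms)
    qed
    then have "power_sum_act i (weyl_functional n as bs) l = of_int (\<Sum>j<length y. perm_sgn (y[j := y ! j + i]))"
      unfolding power_sum_act_sum of_int_sum y by (intro sum.cong) auto
    then show ?thesis
      by (simp only: sum_perm_sgn_raise[OF i] of_int_0)
  qed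
qed

lemma vals_replicate:
  assumes "map fst l = replicate m s"
  shows "gvals l = (if s = StG then map snd l else [])" "evals l = (if s = StE then mset (map snd l) else {#})"
proof -
  have "\<forall>x\<in>set l. fst x = s"
    by (metis assms in_set_replicate image_eqI list.set_map)
  then show "gvals l = (if s = StG then map snd l else [])" "evals l = (if s = StE then mset (map snd l) else {#})"
    by (induction l) (auto simp: gvals_def evals_def)
qed

lemma evals_append: "evals (l @ l') = evals l + evals l'"
  by (simp add: evals_def)

lemma weyl_states_split:
  assumes "map fst l = weyl_states n k s" "\<forall>x\<in>set l. fst x = StW \<longrightarrow> snd x = 0"
  obtains xS xK where "map snd l = replicate (n - k - s) 0 @ xS @ xK" "length xS = s" "length xK = k"
    "gvals l = xK" "evals l = mset xS"
proof -
  obtain l1 l' where l': "l = l1 @ l'" "map fst l1 = replicate (n - k - s) StW"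
    "map fst l' = replicate s StE @ replicate k StG"
    using assms(1)[unfolded weyl_states_def map_eq_append_conv[of fst l]] by metis
  obtain l2 l3 where "l' = l2 @ l3" "map fst l2 = replicate s StE" "map fst l3 = replicate k StG"
    using l'(3)[unfolded map_eq_append_conv] by metis
  with l' have l: "l = l1 @ l2 @ l3" "map fst l1 = replicate (n - k - s) StW"
    "map fst l2 = replicate s StE" "map fst l3 = replicate k StG"
    by simp_all
  have len: "length l1 = n - k - s" "length l2 = s" "length l3 = k"
    using l(2-4) by (metis length_map length_replicate)+
  have "\<forall>x\<in>set l1. fst x = StW"
    by (metis l(2) in_set_replicate image_eqI list.set_map)
  with assms(2) l(1) have "\<forall>x\<in>set l1. snd x = 0" by auto
  then have "map snd l1 = replicate (n - k - s) 0"
    using len by (auto intro!: replicate_eqI)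
  with l len show ?thesis
    using vals_replicate[OF l(2)] vals_replicate[OF l(3)] vals_replicate[OF l(4)]
    by (intro that[of "map snd l2" "map snd l3"]) (simp_all add: gvals_append evals_append)
qed

text \<open>The complement of the sum makes larger sums come earlier, in agreement with the
  filtration. The later entries are compared where \<open>greedy_matching\<close> finds its first
  deviation.\<close>

definition weyl_key :: "nat \<Rightarrow> nat list \<times> nat list \<Rightarrow> nat list" where
  "weyl_key n = (\<lambda>(as, bs). [length bs, n * length bs - sum_list bs] @ bs @ rev as)"

lemma lexord_first_diff:
  assumes "i < length xs" "i < length ys" "\<forall>j<i. xs ! j = ys ! j" "xs ! i < ys ! i"
  shows "(xs @ u, ys @ v) \<in> lexord less_than"
  unfolding lexord_take_index_conv
proof (intro disjI2 exI[of _ i] conjI)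
  show "take i (xs @ u) = take i (ys @ v)"
    using assms by (auto intro: nth_equalityI)
qed (use assms in \<open>auto simp: nth_append\<close>)

lemma sum_list_map2_plus:
  "length xs = length ys \<Longrightarrow> sum_list (map2 (+) xs ys) = sum_list xs + sum_list ys" for xs ys :: "nat list"
  by (induction xs ys rule: list_induct2) simp_all

lemma map2_plus_minus:
  assumes "length xs = length ys" "\<And>i. i < length xs \<Longrightarrow> ys ! i \<le> xs ! i"
  shows "map2 (+) ys (map2 (-) xs ys) = (xs :: nat list)"
  using assms by (intro nth_equalityI) auto

lemma mset_zip_eqD:
  assumes "mset (zip q xs) = mset (zip q ys)" "distinct q" "length xs = length q" "length ys = length q"
  shows "xs = ys"
proof (rule nth_equalityI)
  show "length xs = length ys" using assms by simp
  fix i assume i: "i < length xs"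
  then have "(q ! i, xs ! i) \<in> set (zip q ys)"
    using assms by (metis mset_eq_setD nth_mem nth_zip length_zip min.idem)
  then obtain j where "j < length q" "q ! j = q ! i" "ys ! j = xs ! i"
    using assms by (auto simp: in_set_zip)
  then show "xs ! i = ys ! i"
    using assms i by (metis nth_eq_iff_index_eq)
qed

lemma upt_split3: "[0..<r + s + k] = [0..<r] @ [r..<r + s] @ [r + s..<r + s + k]"
  using upt_add_eq_append[of 0 "r + s" k] upt_add_eq_append[of 0 r s] by simp

lemma list_sgn_upt: "list_sgn [a..<b] = 1"
  by (rule list_sgn_sorted) simp

lemma sum_list_le_mult: "\<forall>b\<in>set bs. b < n \<Longrightarrow> sum_list bs \<le> n * length bs" for n :: nat
  by (induction bs) auto

text \<open>A nonzero value means that exponents plus offsets permute 0, ..., n - 1. The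
  \<open>StW\<close> part fills 0, ..., r - 1, and the g+ part sums to at most the top k values,
  which compares the sums of \<open>bs\<close> and \<open>bs'\<close>. If these agree, the g+ part
  fills the top block and the e part the middle one, and \<open>greedy_matching\<close> compares
  each block.\<close>

lemma weyl_functional_triangular:
  assumes x: "(as, bs) \<in> weyl_index n" and x': "(as', bs') \<in> weyl_index n"
    and len: "length bs = length bs'"
    and l: "l \<in> spread_states n (mset bs) (mset as)" and nz: "weyl_functional n as' bs' l \<noteq> 0"
  shows "(as, bs) = (as', bs') \<and> weyl_functional n as' bs' l = of_int (list_sgn (gvals l))
    \<or> (weyl_key n (as', bs'), weyl_key n (as, bs)) \<in> lexord less_than"
proof -
  define k where "k = length bs'"
  define s where "s = length as'"
  define r where "r = n - k - s"
  note D = weyl_indexD[OF x] and D' = weyl_indexD[OF x']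
  have n: "r + s + k = n" using D' by (simp add: r_def k_def s_def)
  have cfg: "map fst l = weyl_states n k s"
    using nz by (auto simp: weyl_functional_def k_def s_def split: if_splits)
  have zeros: "\<forall>x\<in>set l. fst x = StW \<longrightarrow> snd x = 0" using l by (simp add: spread_states_def)
  obtain xS xK where xs: "map snd l = replicate r 0 @ xS @ xK" "length xS = s" "length xK = k"
    "gvals l = xK" "evals l = mset xS"
    using weyl_states_split[OF cfg zeros] unfolding r_def by metis
  have ms: "mset xK = mset bs" "mset xS = mset as"
    using l xs by (auto simp: spread_states_def)
  have lens: "length bs = k" "length as = s" "length bs' = k" "length as' = s"
    using ms xs len mset_eq_length[of xS as] by (simp_all add: k_def s_def)
  define qS where "qS = map2 (-) [r..<r + s] (rev as')"
  define qK where "qK = map2 (-) [r + s..<n] bs'"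
  have ql: "length qS = s" "length qK = k" using n lens by (simp_all add: qS_def qK_def)
  have weyl_offset: "weyl_offset n as' bs' = [0..<r] @ qS @ qK"
    by (simp add: weyl_offset_def Let_def qS_def qK_def r_def k_def s_def)
  have as'r: "rev as' ! i \<le> r + i" if "i < s" for i
  proof -
    have "rev as' ! i \<in> set as'" using that lens by (metis length_rev nth_mem set_rev)
    then show ?thesis using D'(5) lens by (force simp: r_def)
  qed
  have bs'n: "bs' ! i \<le> r + s + i" if "i < k" for i
    using strict_nth_bound[OF D'(1,2), of i] that lens n by simp
  have qS_nth: "qS ! i + rev as' ! i = r + i" if "i < s" for i
    using that as'r[OF that] lens by (simp add: qS_def)
  have qK_nth: "bs' ! i + qK ! i = r + s + i" if "i < k" for i
    using that bs'n[OF that] lens n by (simp add: qK_def)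
  have bq: "map2 (+) bs' qK = [r + s..<n]"
    using lens ql n qK_nth by (intro nth_equalityI) auto
  define YS where "YS = map2 (+) xS qS"
  define YK where "YK = map2 (+) xK qK"
  have "map2 (+) (replicate r 0) [0..<r] = [0..<r]"
    by (intro nth_equalityI) auto
  then have Y: "map2 (+) (map snd l) (weyl_offset n as' bs') = [0..<r] @ YS @ YK"
    using xs ql by (simp add: weyl_offset YS_def YK_def)
  have Yl: "length YS = s" "length YK = k" using xs ql by (simp_all add: YS_def YK_def)
  have weyl_functional: "weyl_functional n as' bs' l = of_int (perm_sgn ([0..<r] @ YS @ YK))"
    using cfg by (simp add: weyl_functional_def Y k_def s_def)
  have len_Y: "length ([0..<r] @ YS @ YK) = n" using Yl n by simp
  have mset_Y: "mset ([0..<r] @ YS @ YK) = mset [0..<n]"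
    using nz Yl n unfolding weyl_functional perm_sgn_def by (auto split: if_splits simp: add.assoc)
  have dist: "distinct ([0..<r] @ YS @ YK)"
    using mset_Y by (metis distinct_upt mset_eq_imp_distinct_iff)
  have upt: "[0..<n] = [0..<r] @ [r..<r + s] @ [r + s..<n]"
    using upt_split3[of r s k] n by simp
  have mset_SK: "mset YS + mset YK = mset [r..<r + s] + mset [r + s..<n]"
    using mset_Y unfolding upt by simp
  have "set ([0..<r] @ YS @ YK) = {..<n}"
    using mset_eq_setD[OF mset_Y] by (simp add: atLeast0LessThan)
  then have "set YK \<subseteq> {..<n}" by auto
  moreover have "distinct YK" using dist by simp
  moreover have nk: "n - length YK = r + s" using n Yl by simp
  ultimately have top: "sum_list YK \<le> sum_list [r + s..<n]"
    "sum_list YK = sum_list [r + s..<n] \<Longrightarrow> mset YK = mset [r + s..<n]"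
    using sum_list_top[of YK n] by simp_all
  have "sum_list xK = sum_list bs"
    using ms(1) by (metis sum_mset_sum_list)
  then have "sum_list YK = sum_list bs + sum_list qK"
    using xs ql by (simp add: YK_def sum_list_map2_plus)
  moreover have "sum_list [r + s..<n] = sum_list bs' + sum_list qK"
    using lens ql by (simp add: sum_list_map2_plus flip: bq)
  ultimately have sums: "sum_list bs \<le> sum_list bs'" "sum_list bs = sum_list bs' \<Longrightarrow> mset YK = mset [r + s..<n]"
    using top by simp_all
  show ?thesis
  proof (cases "sum_list bs = sum_list bs'")
    case False
    with sums have "sum_list bs < sum_list bs'" by simp
    moreover have "sum_list bs' \<le> n * k"
      using sum_list_le_mult[OF D'(2)] lens by simp
    ultimately show ?thesis
      using lens by (auto simp: weyl_key_def)
  next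
    case eq: True
    have YK: "mset YK = mset [r + s..<r + s + k]" using sums(2)[OF eq] n by simp
    then have YS: "mset YS = mset [r..<r + s]" using mset_SK n by simp
    have sorted_qK: "sorted_wrt (\<ge>) qK"
      unfolding sorted_wrt_iff_nth_less
    proof (intro allI impI)
      fix i j assume ij: "i < j" "j < length qK"
      then have "bs' ! i + (j - i) \<le> bs' ! j"
        using strict_nth_diff[OF D'(1), of i j] ql lens by simp
      then show "qK ! j \<le> qK ! i"
        using qK_nth[of i] qK_nth[of j] ij ql by linarith
    qed
    \<comment> \<open>As \<open>bs' ! i + qK ! i = r + s + i\<close>, the second alternative says
      that \<open>bs\<close> exceeds \<open>bs'\<close> at their first difference.\<close>
    have K: "(\<forall>i<k. bs ! i + qK ! i = r + s + i) \<and> mset (zip xK qK) = mset (zip bs qK)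
        \<or> (\<exists>i<k. (\<forall>j<i. bs ! j + qK ! j = r + s + j) \<and> r + s + i < bs ! i + qK ! i)"
    proof (rule greedy_matching)
      show "image_mset fst (mset (zip xK qK)) = mset bs" "image_mset snd (mset (zip xK qK)) = mset qK"
        using xs ql ms by (simp_all flip: mset_map)
      show "image_mset (\<lambda>z. fst z + snd z) (mset (zip xK qK)) = mset [r + s..<r + s + k]"
        using YK by (simp add: YK_def case_prod_unfold)
    qed (use lens ql sorted_qK in auto)
    have S: "(\<forall>i<s. qS ! i + rev as ! i = r + i) \<and> mset (zip qS xS) = mset (zip qS (rev as))
        \<or> (\<exists>i<s. (\<forall>j<i. qS ! j + rev as ! j = r + j) \<and> r + i < qS ! i + rev as ! i)"
    proof (rule greedy_matching)
      show "image_mset fst (mset (zip qS xS)) = mset qS" "image_mset snd (mset (zip qS xS)) = mset (rev as)"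
        using xs ql ms by (simp_all flip: mset_map)
      have "map (\<lambda>z. fst z + snd z) (zip qS xS) = YS"
        using xs ql by (intro nth_equalityI) (auto simp: YS_def)
      then show "image_mset (\<lambda>z. fst z + snd z) (mset (zip qS xS)) = mset [r..<r + s]"
        using YS by (simp flip: mset_map)
    qed (use lens ql D(3) in \<open>auto simp: sorted_wrt_rev\<close>)
    from K show ?thesis
    proof
      assume "\<exists>i<k. (\<forall>j<i. bs ! j + qK ! j = r + s + j) \<and> r + s + i < bs ! i + qK ! i"
      then obtain i where i: "i < k" "\<forall>j<i. bs ! j + qK ! j = r + s + j" "r + s + i < bs ! i + qK ! i"
        by blast
      have "\<forall>j<i. bs' ! j = bs ! j"
        using i qK_nth by (metis add_right_cancel less_trans)
      moreover have "bs' ! i < bs ! i" using i qK_nth[OF i(1)] by simp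
      ultimately have "(bs' @ rev as', bs @ rev as) \<in> lexord less_than"
        using i lens by (intro lexord_first_diff[of i]) auto
      then show ?thesis using eq lens by (simp add: weyl_key_def)
    next
      assume K: "(\<forall>i<k. bs ! i + qK ! i = r + s + i) \<and> mset (zip xK qK) = mset (zip bs qK)"
      then have bs: "bs = bs'"
        using qK_nth lens by (intro nth_equalityI) (simp, metis add_right_cancel)
      from S show ?thesis
      proof
        assume "\<exists>i<s. (\<forall>j<i. qS ! j + rev as ! j = r + j) \<and> r + i < qS ! i + rev as ! i"
        then obtain i where i: "i < s" "\<forall>j<i. qS ! j + rev as ! j = r + j" "r + i < qS ! i + rev as ! i"
          by blast
        have "\<forall>j<i. rev as' ! j = rev as ! j"
          using i qS_nth by (metis add_left_cancel less_trans)
        moreover have "rev as' ! i < rev as ! i" using i qS_nth[OF i(1)] by simp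
        ultimately have "(rev as' @ [], rev as @ []) \<in> lexord less_than"
          using i lens by (intro lexord_first_diff[of i]) auto
        then show ?thesis using lens bs by (simp add: weyl_key_def lexord_append_leftI)
      next
        assume S: "(\<forall>i<s. qS ! i + rev as ! i = r + i) \<and> mset (zip qS xS) = mset (zip qS (rev as))"
        then have "rev as = rev as'"
          using qS_nth lens by (intro nth_equalityI) (simp, metis add_left_cancel length_rev)
        then have as: "as = as'" by simp
        \<comment> \<open>\<open>r + i - rev as ! i\<close> increases strictly with i because
          \<open>rev as\<close> decreases weakly. So the e block has a single arrangement, while the
          g+ block may have several.\<close>
        have "distinct qS"
          unfolding distinct_conv_nth
        proof (intro allI impI)
          fix i j assume ij: "i < length qS" "j < length qS" "i \<noteq> j"
          have anti: "rev as ! j \<le> rev as ! i" if "i < j" "j < s" for i j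
            using D(3) lens that sorted_wrt_rev[of "(\<ge>)" as] by (auto simp: sorted_wrt_iff_nth_less)
          have "qS ! i + rev as ! i = r + i" "qS ! j + rev as ! j = r + j"
            using S ij ql by auto
          then show "qS ! i \<noteq> qS ! j"
            using ij ql anti[of i j] anti[of j i] by linarith
        qed
        then have "xS = rev as"
          using S xs ql lens by (intro mset_zip_eqD[of qS]) auto
        then have YS_eq: "YS = [r..<r + s]"
          using S ql lens by (intro nth_equalityI) (auto simp: YS_def add.commute)
        \<comment> \<open>Each pair is some \<open>(bs ! i, qK ! i)\<close> with sum r + s + i, so
          first entries and sums are ordered alike.\<close>
        have "list_sgn (map (\<lambda>z. fst z + snd z) (zip xK qK)) = list_sgn (map fst (zip xK qK))"
        proof (rule list_sgn_cong)
          fix z z' assume "z \<in> set (zip xK qK)" "z' \<in> set (zip xK qK)"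
          then have "z \<in> set (zip bs qK)" "z' \<in> set (zip bs qK)"
            using K mset_eq_setD by blast+
          then obtain i j where ij: "i < k" "z = (bs ! i, qK ! i)" "j < k" "z' = (bs ! j, qK ! j)"
            using lens ql by (auto simp: in_set_zip)
          have "order_sgn (bs ! i) (bs ! j) = order_sgn i j"
          proof -
            have "bs ! i < bs ! j" if "i < j" "j < k" for i j
              using D(1) that lens by (auto intro: sorted_wrt_nth_less)
            then show ?thesis
              using ij by (cases i j rule: linorder_cases) (auto simp: order_sgn_def)
          qed
          moreover have "order_sgn (r + s + i) (r + s + j) = order_sgn i j" by (simp add: order_sgn_def)
          ultimately show "order_sgn (fst z + snd z) (fst z' + snd z') = order_sgn (fst z) (fst z')"
            using ij K by simp
        qed
        then have "list_sgn YK = list_sgn xK"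
          using xs ql by (simp add: YK_def case_prod_unfold)
        moreover have "list_sgn ([0..<r] @ YS @ YK) = list_sgn [0..<r] * (list_sgn YS * list_sgn YK)"
        proof -
          have "set YK = {r + s..<r + s + k}" using mset_eq_setD[OF YK] by simp
          then show ?thesis
            by (subst list_sgn_append_less, force simp: YS_eq, subst list_sgn_append_less) (auto simp: YS_eq)
        qed
        ultimately have "weyl_functional n as' bs' l = of_int (list_sgn (gvals l))"
          unfolding weyl_functional perm_sgn_def len_Y using mset_Y xs by (simp add: YS_eq list_sgn_upt del: mset_append mset_upt)
        with as bs show ?thesis by simp
      qed
    qed
  qed
qed

lemma weyl_functional_short:
  assumes "length (gvals l) \<noteq> length bs"
  shows "weyl_functional n as bs l = 0"
proof (rule ccontr)
  assume "weyl_functional n as bs l \<noteq> 0"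
  then have "map fst l = weyl_states n (length bs) (length as)"
    by (auto simp: weyl_functional_def split: if_splits)
  then have "length (filter (\<lambda>s. s = StG) (map fst l)) = length bs"
    by (simp add: weyl_states_def)
  then have "length (gvals l) = length bs"
    by (simp add: gvals_def filter_map comp_def)
  with assms show False ..
qed

text \<open>By triangularity every nonzero value on the diagonal is the sign of its arrangement, so
  \<open>signed_value\<close> is a square. One arrangement has to be shown to give a nonzero
  value.\<close>

lemma weyl_functional_positive:
  assumes x: "(as, bs) \<in> weyl_index n"
  shows "positive_functional (weyl_functional n as bs) n (mset bs) (mset as)"
  unfolding positive_functional_def bounded_functional_def
proof (intro conjI allI impI ballI)
  show "weyl_functional n as bs l = 0" if "length (gvals l) < size (mset bs)" for l
    using that by (intro weyl_functional_short) simp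
  have "0 \<le> signed_value (weyl_functional n as bs) l" if l: "l \<in> spread_states n (mset bs) (mset as)" for l
  proof (cases "weyl_functional n as bs l = 0")
    case False
    have "(weyl_key n (as, bs), weyl_key n (as, bs)) \<notin> lexord less_than"
      by (intro lexord_irreflexive) simp
    with weyl_functional_triangular[OF x x refl l False] have "weyl_functional n as bs l = of_int (list_sgn (gvals l))" by blast
    then have "signed_value (weyl_functional n as bs) l = of_int (list_sgn (gvals l) * list_sgn (gvals l))"
      by (simp add: signed_value_def)
    then show ?thesis by (simp only: of_int_0_le_iff zero_le_square less_eq_complex_def) simp
  qed (simp add: signed_value_def)
  then show "signed_value (weyl_functional n as bs) l \<in> {0..}" if "l \<in> spread_states n (mset bs) (mset as)" for l
    using that by simp
  note D = weyl_indexD[OF x]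
  define k where "k = length bs"
  define s where "s = length as"
  define r where "r = n - k - s"
  have n: "r + s + k = n" using D by (simp add: r_def k_def s_def)
  \<comment> \<open>The standard arrangement, whose exponents the offsets complete to
    \<open>[0..<n]\<close>.\<close>
  define l where "l = zip (weyl_states n k s) (replicate r 0 @ rev as @ bs)"
  have lz: "l = zip (replicate r StW) (replicate r 0) @ zip (replicate s StE) (rev as) @ zip (replicate k StG) bs"
    by (simp add: l_def weyl_states_def r_def k_def s_def)
  have g: "gvals l = bs" "evals l = mset as" "length l = n"
    using n vals_replicate[of "zip (replicate r StW) (replicate r 0)" r StW]
      vals_replicate[of "zip (replicate s StE) (rev as)" s StE] vals_replicate[of "zip (replicate k StG) bs" k StG]
    by (simp_all add: lz gvals_append evals_append s_def k_def)
  have spread_states: "l \<in> spread_states n (mset bs) (mset as)"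
    using g by (auto simp: spread_states_def lz in_set_zip)
  have "map fst l = weyl_states n k s" "map snd l = replicate r 0 @ rev as @ bs"
    by (simp_all add: l_def weyl_states_def r_def k_def s_def)
  moreover have "map2 (+) (replicate r 0 @ rev as @ bs) (weyl_offset n as bs) = [0..<n]"
  proof -
    have S: "map2 (+) (rev as) (map2 (-) [r..<r + s] (rev as)) = [r..<r + s]"
    proof (rule map2_plus_minus)
      fix i assume "i < length [r..<r + s]"
      then have "i < length (rev as)" by (simp add: s_def)
      then have "rev as ! i \<in> set as" by (metis nth_mem set_rev)
      then have "rev as ! i \<le> r"
        using D(5) by (auto simp: r_def k_def s_def)
      with \<open>i < length [r..<r + s]\<close> show "rev as ! i \<le> [r..<r + s] ! i" by simp
    qed (simp add: s_def)
    have K: "map2 (+) bs (map2 (-) [r + s..<n] bs) = [r + s..<n]"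
    proof (rule map2_plus_minus)
      fix i assume "i < length [r + s..<n]"
      then have "i < length bs" using n by (simp add: k_def)
      then show "bs ! i \<le> [r + s..<n] ! i"
        using strict_nth_bound[OF D(1,2), of i] n by (simp add: k_def)
    qed (use n in \<open>simp add: k_def\<close>)
    have "map2 (+) (replicate r 0) [0..<r] = [0..<r]"
      by (intro nth_equalityI) auto
    moreover have "[0..<n] = [0..<r] @ [r..<r + s] @ [r + s..<n]"
      using upt_split3[of r s k] n by simp
    ultimately show ?thesis
      using S K n by (simp add: weyl_offset_def Let_def s_def k_def r_def)
  qed
  ultimately have "weyl_functional n as bs l = 1"
    by (simp add: weyl_functional_def k_def s_def perm_sgn_def list_sgn_upt)
  then have "signed_value (weyl_functional n as bs) l = 1"
    using list_sgn_sorted[OF D(1)] by (simp add: signed_value_def g)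
  with spread_states show "\<exists>l\<in>spread_states n (mset bs) (mset as). 0 < signed_value (weyl_functional n as bs) l"
    by (intro bexI[of _ l]) (simp_all add: less_complex_def)
qed

lemma weyl_functional_orthogonal:
  assumes x: "(as, bs) \<in> weyl_index n" and x': "(as', bs') \<in> weyl_index n" and ne: "(as, bs) \<noteq> (as', bs')"
    and max: "(weyl_key n (as', bs'), weyl_key n (as, bs)) \<notin> lexord less_than"
  shows "uact (weyl_mon (as, bs)) (weyl_functional n as' bs') (vacuum n) = 0"
proof -
  have le: "length bs \<le> length bs'"
    using max by (auto simp: weyl_key_def)
  have "bounded_functional {0} (weyl_functional n as' bs') n (mset bs) (mset as)"
    unfolding bounded_functional_def
  proof (intro conjI allI impI ballI)
    show "weyl_functional n as' bs' l = 0" if "length (gvals l) < size (mset bs)" for l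
      using that le by (intro weyl_functional_short) simp
    fix l assume l: "l \<in> spread_states n (mset bs) (mset as)"
    have "weyl_functional n as' bs' l = 0"
    proof (rule ccontr)
      assume nz: "weyl_functional n as' bs' l \<noteq> 0"
      then have "length (gvals l) = length bs'" using weyl_functional_short by blast
      moreover have "length (gvals l) = length bs"
        using l by (auto simp: spread_states_def dest: mset_eq_length)
      ultimately show False
        using weyl_functional_triangular[OF x x' _ l nz] ne max by auto
    qed
    then show "signed_value (weyl_functional n as' bs') l \<in> {0}" by (simp add: signed_value_def)
  qed
  then show ?thesis
    using uact_mon(1)[OF weyl_indexD(1)[OF x] sum_closed_zero] by blast
qed

text \<open>Pairing the relation with the functional of a vector x' of maximal key in its support
  leaves only \<open>c x'\<close> times a positive number.\<close>

theorem weyl_independent: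
  assumes fin: "finite S" and S: "S \<subseteq> weyl_index n"
    and rel: "(\<Sum>x\<in>S. uosp_scalar (c x) * weyl_mon x) \<in> weyl_ideal n" and "x \<in> S"
  shows "c x = 0"
proof (rule ccontr)
  assume "c x \<noteq> 0"
  define T where "T = {x\<in>S. c x \<noteq> 0}"
  have T: "finite T" "T \<noteq> {}" using fin \<open>c x \<noteq> 0\<close> \<open>x \<in> S\<close> unfolding T_def by (simp, blast)
  define R where "R x y = ((weyl_key n x, weyl_key n y) \<in> lexord less_than)" for x y
  have "transp_on T R"
    unfolding R_def by (rule transp_onI) (metis lexord_transI trans_less_than transD)
  moreover have "asymp_on T R"
    unfolding R_def by (rule asymp_onI) (metis lexord_asymmetric asym_less_than)
  ultimately obtain x' where x': "x' \<in> T" "\<forall>y\<in>T. y \<noteq> x' \<longrightarrow> \<not> R x' y"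
    using Finite_Set.bex_max_element[OF T(1), of R] T(2) by blast
  obtain as' bs' where eq: "x' = (as', bs')" by (cases x')
  have idx: "(as', bs') \<in> weyl_index n" using x' S eq by (auto simp: T_def)
  let ?v = "\<lambda>y. c y * uact (weyl_mon y) (weyl_functional n as' bs') (vacuum n)"
  have "(\<Sum>y\<in>S. ?v y) = 0"
    using weyl_ideal_kills[OF rel coinvariant_weyl_functional[OF idx]] by (simp add: uact_sum uact_scale)
  moreover have "?v y = 0" if "y \<in> S" "y \<noteq> x'" for y
  proof (cases "c y = 0")
    case False
    then have "y \<in> T" using that by (simp add: T_def)
    with x' that eq S idx show ?thesis
      using weyl_functional_orthogonal[of "fst y" "snd y" n as' bs'] by (auto simp: R_def)
  qed simp
  moreover have "(\<Sum>y\<in>S. ?v y) = ?v x' + (\<Sum>y\<in>S - {x'}. ?v y)"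
    using x' fin by (intro sum.remove) (auto simp: T_def)
  ultimately have "?v x' = 0" by simp
  moreover have "0 < uact (weyl_mon x') (weyl_functional n as' bs') (vacuum n)"
    unfolding eq by (rule uact_mon(2)[OF weyl_indexD(1)[OF idx] weyl_functional_positive[OF idx]])
  ultimately show False using x' by (auto simp: T_def)
qed

section \<open>The basis of the Weyl module\<close>

lemma weyl_vector_eq: "weyl_vector n x = weyl_coset n (weyl_mon x)"
proof -
  have "foldr (\<lambda>b. weyl_act n (cur osp_gp b)) bs (weyl_gen n) = weyl_coset n (gp_mon bs)" for bs
    by (induction bs) (simp_all add: weyl_gen_def weyl_act_coset)
  moreover have "foldr (\<lambda>a. weyl_act n (cur osp_e a)) as (weyl_coset n u) = weyl_coset n (e_mon as * u)" for as u
    by (induction as) (simp_all add: weyl_act_coset mult.assoc)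
  ultimately show ?thesis
    by (cases x) (simp add: weyl_vector_def weyl_mon_def)
qed

lemma weyl_coset_0_iff: "weyl_coset n u = weyl_coset n 0 \<longleftrightarrow> u \<in> weyl_ideal n"
  by (simp add: weyl_coset_eq_iff weyl_ideal_def)

lemma weyl_vector_inj: "inj_on (weyl_vector n) (weyl_index n)"
proof (rule inj_onI, rule ccontr)
  fix x y assume xy: "x \<in> weyl_index n" "y \<in> weyl_index n" "weyl_vector n x = weyl_vector n y" "x \<noteq> y"
  define c where "c z = (if z = x then 1 else - 1 :: complex)" for z
  have "weyl_mon x - weyl_mon y \<in> weyl_ideal n"
    using xy by (simp add: weyl_vector_eq weyl_coset_eq_iff weyl_ideal_def)
  then have "(\<Sum>z\<in>{x, y}. uosp_scalar (c z) * weyl_mon z) \<in> weyl_ideal n"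
    using xy by (simp add: c_def uosp_scalar_uminus uosp_scalar_1)
  then have "c x = 0"
    by (rule weyl_independent[rotated 2]) (use xy in auto)
  then show False by (simp add: c_def)
qed

interpretation W: vectorspace "class_ring :: complex ring" "weyl_module n" for n
  by (rule vectorspace_weyl_module)

lemma weyl_module_simps:
  "carrier (weyl_module n) = range (weyl_coset n)"
  "\<zero>\<^bsub>weyl_module n\<^esub> = weyl_coset n 0"
  "weyl_coset n u \<oplus>\<^bsub>weyl_module n\<^esub> weyl_coset n v = weyl_coset n (u + v)"
  "c \<odot>\<^bsub>weyl_module n\<^esub> weyl_coset n u = weyl_coset n (uosp_scalar c * u)"
  by (simp_all add: weyl_module_def weyl_act_coset weyl_coset_add)

text \<open>\<open>lincomb\<close> runs over a set of vectors; injectivity permits summation over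
  the indices.\<close>

lemma weyl_lincomb:
  assumes "finite S" "S \<subseteq> weyl_index n"
  shows "W.lincomb n a (weyl_vector n ` S) = weyl_coset n (\<Sum>x\<in>S. uosp_scalar (a (weyl_vector n x)) * weyl_mon x)"
  using assms
proof (induction S rule: finite_induct)
  case empty
  then show ?case by (simp add: W.lincomb_def weyl_module_simps)
next
  case (insert x S)
  have "weyl_vector n x \<notin> weyl_vector n ` S"
    using weyl_vector_inj[of n] insert by (auto simp: inj_on_def)
  then have "W.lincomb n a (insert (weyl_vector n x) (weyl_vector n ` S))
      = (a (weyl_vector n x) \<odot>\<^bsub>weyl_module n\<^esub> weyl_vector n x) \<oplus>\<^bsub>weyl_module n\<^esub> W.lincomb n a (weyl_vector n ` S)"
    using insert by (intro W.lincomb_insert2) (auto simp: weyl_module_simps weyl_vector_eq)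
  with insert show ?case
    by (simp add: weyl_vector_eq weyl_module_simps)
qed

theorem corollary1p8:
  fixes n :: nat
  shows "inj_on (weyl_vector n) (weyl_index n) \<and>
    vectorspace.basis (class_ring :: complex ring) (weyl_module n)
      (weyl_vector n ` weyl_index n)"
proof (intro conjI weyl_vector_inj)
  let ?A = "weyl_vector n ` weyl_index n"
  have carr: "?A \<subseteq> carrier (weyl_module n)"
    by (auto simp: weyl_module_simps weyl_vector_eq)
  have "W.lin_indpt n ?A"
  proof
    assume "W.lin_dep n ?A"
    then obtain B a v where B: "finite B" "B \<subseteq> ?A" "W.lincomb n a B = \<zero>\<^bsub>weyl_module n\<^esub>" "v \<in> B" "a v \<noteq> 0"
      unfolding W.lin_dep_def by auto
    then obtain S where S: "finite S" "S \<subseteq> weyl_index n" "B = weyl_vector n ` S"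
      by (metis finite_subset_image)
    then have "(\<Sum>x\<in>S. uosp_scalar (a (weyl_vector n x)) * weyl_mon x) \<in> weyl_ideal n"
      using B(3) by (simp add: weyl_lincomb weyl_module_simps weyl_coset_0_iff)
    from weyl_independent[OF S(1,2) this] B(4,5) S(3) show False by auto
  qed
  moreover have "W.span n ?A = carrier (weyl_module n)"
  proof
    show "W.span n ?A \<subseteq> carrier (weyl_module n)"
      by (rule W.span_is_subset2[OF carr])
    \<comment> \<open>\<open>weyl_spanning\<close> speaks of subspaces of the enveloping algebra,
      hence the passage to the preimage.\<close>
    define T where "T = {u. weyl_coset n u \<in> W.span n ?A}"
    have zero: "weyl_coset n 0 \<in> W.span n ?A"
      using W.span_zero[of n ?A] by (simp add: weyl_module_simps)
    have "u \<in> T" for u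
    proof (rule weyl_spanning)
      show "uosp.subspace T"
      proof (rule uosp.subspaceI)
        show "0 \<in> T" using zero by (simp add: T_def)
        show "u + v \<in> T" if "u \<in> T" "v \<in> T" for u v
          using that W.span_add1[OF carr] unfolding T_def by (force simp: weyl_module_simps)
        show "uosp_scalar c * u \<in> T" if "u \<in> T" for c u
          using that submodule.smult_closed[OF W.span_is_submodule[OF carr], of c "weyl_coset n u"]
          unfolding T_def by (simp add: weyl_module_simps)
      qed
      show "weyl_ideal n \<subseteq> T"
        using zero by (auto simp: T_def simp flip: weyl_coset_0_iff)
      show "weyl_mon ` weyl_index n \<subseteq> T"
        using W.in_own_span[OF carr] by (auto simp: T_def weyl_vector_eq)
    qed
    then show "carrier (weyl_module n) \<subseteq> W.span n ?A"
      by (auto simp: weyl_module_simps T_def)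
  qed
  ultimately show "vectorspace.basis class_ring (weyl_module n) ?A"
    using carr by (simp add: W.basis_def)
qed

end
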